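(* Let $\mathcal{H}$ be a complex separable infinite-dimensional Hilbert space and let $T$ be a bounded linear operator on $\mathcal{H}$ with $\operatorname{Ker}T=\{0\}$ and $\overline{\operatorname{Ran}T}=\mathcal{H}$. Then for every $\epsilon>0$ there exist a unitary operator $U$ on $\mathcal{H}$ and a compact operator $K$ on $\mathcal{H}$ with $\|K\|<\epsilon$ such that $(U+K)T$ is strongly irreducible. Moreover, $U$ and $K$ can be chosen so that in addition $U+K$ is invertible (since $\epsilon$ can be chosen small enough).
   Context: A bounded linear operator $A$ on $\mathcal{H}$ is strongly irreducible if no bounded idempotent operator other than $0$ and the identity $I$ commutes with $A$. *)

theory Defs
  imports "HOL-Analysis.Analysis"
begin

text \<open>
  Complex inner product spaces, with the inner product linear in its first argument.
  The norm and the topology are those of the underlying real inner product space, whose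
  inner product is the real part of the complex one; hence \<^term>\<open>norm x\<close> is the square root
  of the complex inner product of \<^term>\<open>x\<close> with itself, and positive definiteness is inherited
  from class \<^class>\<open>real_inner\<close>.
\<close>

class complex_inner = real_inner +
  fixes scaleC :: "complex \<Rightarrow> 'a \<Rightarrow> 'a" (infixr \<open>*\<^sub>C\<close> 75)
    and cinner :: "'a \<Rightarrow> 'a \<Rightarrow> complex"
  assumes scaleC_add_right: "c *\<^sub>C (x + y) = c *\<^sub>C x + c *\<^sub>C y"
    and scaleC_add_left: "(c + d) *\<^sub>C x = c *\<^sub>C x + d *\<^sub>C x"
    and scaleC_scaleC: "c *\<^sub>C (d *\<^sub>C x) = (c * d) *\<^sub>C x"
    and scaleC_one: "1 *\<^sub>C x = x"
    and scaleR_eq_scaleC: "r *\<^sub>R x = complex_of_real r *\<^sub>C x"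
    and cinner_commute: "cinner x y = cnj (cinner y x)"
    and cinner_add_left: "cinner (x + y) z = cinner x z + cinner y z"
    and cinner_scaleC_left: "cinner (c *\<^sub>C x) y = c * cinner x y"
    and inner_eq_Re_cinner: "inner x y = Re (cinner x y)"

class complex_hilbert_space = complex_inner + complete_space

interpretation complex_vector: vector_space "scaleC :: complex \<Rightarrow> 'a \<Rightarrow> 'a::complex_inner"
  by unfold_locales (rule scaleC_add_right scaleC_add_left scaleC_scaleC scaleC_one)+

lemma power2_norm_eq_cinner: "complex_of_real ((norm x)\<^sup>2) = cinner x (x::'a::complex_inner)"
proof (rule complex_eqI)
  show "Re (complex_of_real ((norm x)\<^sup>2)) = Re (cinner x x)"
    by (simp add: power2_norm_eq_inner inner_eq_Re_cinner)
  have "cinner x x = cnj (cinner x x)"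
    by (rule cinner_commute)
  then have "Im (cinner x x) = - Im (cinner x x)"
    by (metis cnj.sel(2))
  then show "Im (complex_of_real ((norm x)\<^sup>2)) = Im (cinner x x)"
    by simp
qed

definition infinite_dimensional :: "'a::complex_inner itself \<Rightarrow> bool" where
  "infinite_dimensional _ \<longleftrightarrow> \<not> (\<exists>B::'a set. finite B \<and> complex_vector.span B = UNIV)"

text \<open>
  The type \<^typ>\<open>'a \<Rightarrow>\<^sub>L 'a\<close> consists of the bounded real-linear maps, with the operator norm.
  The bounded linear operators on the complex space are its complex-homogeneous elements, so
  every operator below, quantified ones included, is required to satisfy the next predicate.
\<close>

definition complex_linear :: "('a::complex_inner \<Rightarrow>\<^sub>L 'a) \<Rightarrow> bool" where
  "complex_linear A \<longleftrightarrow> (\<forall>c x. blinfun_apply A (c *\<^sub>C x) = c *\<^sub>C blinfun_apply A x)"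

definition unitary_operator :: "('a::complex_inner \<Rightarrow>\<^sub>L 'a) \<Rightarrow> bool" where
  "unitary_operator U \<longleftrightarrow> complex_linear U \<and>
     (\<forall>x y. cinner (blinfun_apply U x) (blinfun_apply U y) = cinner x y) \<and>
     surj (blinfun_apply U)"

definition compact_operator :: "('a::complex_inner \<Rightarrow>\<^sub>L 'a) \<Rightarrow> bool" where
  "compact_operator K \<longleftrightarrow> complex_linear K \<and> compact (closure (blinfun_apply K ` cball 0 1))"

definition invertible_operator :: "('a::complex_inner \<Rightarrow>\<^sub>L 'a) \<Rightarrow> bool" where
  "invertible_operator A \<longleftrightarrow> complex_linear A \<and>
     (\<exists>B. complex_linear B \<and> A o\<^sub>L B = id_blinfun \<and> B o\<^sub>L A = id_blinfun)"

definition strongly_irreducible :: "('a::complex_inner \<Rightarrow>\<^sub>L 'a) \<Rightarrow> bool" where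
  "strongly_irreducible A \<longleftrightarrow> complex_linear A \<and>
     (\<forall>P. complex_linear P \<and> P o\<^sub>L P = P \<and> P o\<^sub>L A = A o\<^sub>L P \<longrightarrow> P = 0 \<or> P = id_blinfun)"

end

theory Submission
  imports Defs
begin

text \<open>
  By a multiplicative form of the Weyl-von Neumann theorem there is an orthonormal basis \<open>e n\<close>
  whose normalized images \<open>T (e n) / norm (T (e n))\<close> differ from an orthonormal basis \<open>f n\<close> by a small
  Hilbert-Schmidt error. Hence there is an operator \<open>R\<close>, a small Hilbert-Schmidt perturbation of the
  identity, with \<open>T (e n) = w n * R (f n)\<close>; here the weights \<open>w n\<close> may still be altered by relative errors
  that are square summable. Arranging the basis along the integers and composing \<open>R\<^sup>-\<^sup>1\<close> with the
  unitary that sends each \<open>f n\<close> to the successor of \<open>e n\<close> turns \<open>T\<close> into an injective bilateral weighted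
  shift.

  If the weights are not bounded away from \<open>0\<close>, boundedness of the matrix entries forces every operator
  commuting with the shift to be a formal power series in it, and the only idempotent power series
  are \<open>0\<close> and \<open>1\<close>. Otherwise the basis is ordered and the weights are adjusted such that every point of
  some circle is a simple eigenvalue whose eigenvector depends continuously on it; an idempotent in the
  commutant then acts on all these eigenvectors by the same scalar, and they span a dense subspace.
\<close>

section \<open>Complex inner products\<close>

text \<open>The perturbation acts to the left of \<open>T\<close>, and \<open>T\<close> need not be
  bounded below, so a small \<open>K\<close> changes each \<open>T (e n)\<close> only by a small
  multiple of its length. All errors are therefore relative: spectral bins are measured by relative
  width, and weights by \<open>d n / w n - 1\<close>. The obstacle is that the bilateral shift with
  constant weights is a multiple of a unitary and commutes with many projections, so weights near a
  constant must be bent. Errors need only be square summable: the k-th weight may be changed by a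
  relative amount of order 1/k, while the product of the first k factors (i/(i+1))^2 already decays
  like 1/k^2. This gap between square summable and summable errors is what yields summable
  eigenvectors on a circle. Hilbert space tools are derived for the real inner product; complex
  linearity is recovered afterwards from commutation with complex scalars. Projections onto kernels
  of |B| - B replace the spectral theorem.\<close>

instance complex_hilbert_space \<subseteq> banach ..

lemma cinner_add_right: "cinner x (y + z) = cinner x y + cinner x z"
  by (metis cinner_commute cinner_add_left complex_cnj_add)

lemma cinner_scaleC_right: "cinner x (c *\<^sub>C y) = cnj c * cinner x y"
  by (metis cinner_commute cinner_scaleC_left complex_cnj_mult)

lemma cinner_scaleR_left: "cinner (r *\<^sub>R x) y = of_real r * cinner x y"
  by (simp add: scaleR_eq_scaleC cinner_scaleC_left)

lemma cinner_scaleR_right: "cinner x (r *\<^sub>R y) = of_real r * cinner x y"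
  by (simp add: scaleR_eq_scaleC cinner_scaleC_right)

lemma cinner_zero_left [simp]: "cinner 0 x = 0"
  using cinner_scaleR_left[of 0 0 x] by simp

lemma cinner_zero_right [simp]: "cinner x 0 = 0"
  using cinner_scaleR_right[of x 0 0] by simp

lemma cinner_minus_left: "cinner (- x) y = - cinner x y"
  using cinner_scaleR_left[of "-1" x y] by simp

lemma cinner_minus_right: "cinner x (- y) = - cinner x y"
  using cinner_scaleR_right[of x "-1" y] by simp

lemma cinner_diff_left: "cinner (x - y) z = cinner x z - cinner y z"
  using cinner_add_left[of x "- y" z] by (simp add: cinner_minus_left)

lemma cinner_diff_right: "cinner x (y - z) = cinner x y - cinner x z"
  using cinner_add_right[of x y "- z"] by (simp add: cinner_minus_right)

lemma cinner_sum_left: "cinner (\<Sum>i\<in>A. f i) y = (\<Sum>i\<in>A. cinner (f i) y)"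
  by (induction A rule: infinite_finite_induct) (simp_all add: cinner_add_left)

lemma cinner_self: "cinner x x = of_real ((norm x)\<^sup>2)"
  by (rule power2_norm_eq_cinner[symmetric])

lemma Im_cinner: "Im (cinner x y) = inner x (\<i> *\<^sub>C y)"
  by (simp add: inner_eq_Re_cinner cinner_scaleC_right)

lemma cinner_eq_0_commute: "cinner x y = 0 \<longleftrightarrow> cinner y x = 0"
  by (metis cinner_commute complex_cnj_zero)

lemma scaleC_zero_right [simp]: "c *\<^sub>C (0::'a::complex_inner) = 0"
  by (simp add: complex_vector.scale_zero_right)

lemma scaleC_zero_left [simp]: "0 *\<^sub>C (x::'a::complex_inner) = 0"
  by (simp add: complex_vector.scale_zero_left)

lemma norm_scaleC [simp]: "norm (c *\<^sub>C x) = cmod c * norm (x::'a::complex_inner)"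
proof -
  have "complex_of_real ((norm (c *\<^sub>C x))\<^sup>2) = of_real ((cmod c * norm x)\<^sup>2)"
    by (simp only: power2_norm_eq_cinner cinner_scaleC_left cinner_scaleC_right)
       (use complex_norm_square[of c] in \<open>simp add: cinner_self power_mult_distrib mult.commute\<close>)
  then have "(norm (c *\<^sub>C x))\<^sup>2 = (cmod c * norm x)\<^sup>2"
    using of_real_eq_iff by blast
  then show ?thesis
    by (simp add: power2_eq_iff_nonneg)
qed

text \<open>Rotating the first argument by a unimodular scalar makes the complex inner product real
  and nonnegative. Cauchy-Schwarz, orthogonality and the polarization estimate are carried over from
  the real inner product in this way.\<close>

lemma cinner_eq_norm_phase:
  obtains c where "cmod c = 1" "of_real (cmod (cinner x y)) = cinner (c *\<^sub>C x) y"
proof (cases "cinner x y = 0")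
  case True
  then show ?thesis
    using that[of 1] by (simp add: cinner_scaleC_left)
next
  case False
  define c where "c = cnj (sgn (cinner x y))"
  have "cmod c = 1"
    using False by (simp add: c_def norm_sgn)
  moreover have "of_real (cmod (cinner x y)) = cinner (c *\<^sub>C x) y"
    using False complex_norm_square[of "cinner x y"]
    by (simp add: c_def cinner_scaleC_left sgn_eq power2_eq_square field_simps)
  ultimately show ?thesis
    using that by blast
qed

lemma cmod_cinner_phase:
  obtains c where "cmod c = 1" "cmod (cinner x y) = inner (c *\<^sub>C x) y"
proof -
  obtain c where c: "cmod c = 1" "of_real (cmod (cinner x y)) = cinner (c *\<^sub>C x) y"
    by (rule cinner_eq_norm_phase)
  then have "cmod (cinner x y) = inner (c *\<^sub>C x) y"
    by (metis Re_complex_of_real inner_eq_Re_cinner)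
  with c(1) show ?thesis
    using that by blast
qed

lemma cinner_le_norm: "cmod (cinner x y) \<le> norm x * norm y"
proof -
  obtain c where c: "cmod c = 1" "cmod (cinner x y) = inner (c *\<^sub>C x) y"
    by (rule cmod_cinner_phase)
  then have "cmod (cinner x y) \<le> norm (c *\<^sub>C x) * norm y"
    by (simp add: norm_cauchy_schwarz del: norm_scaleC)
  then show ?thesis
    using c(1) by simp
qed

lemma bounded_linear_cinner_left: "bounded_linear (\<lambda>x. cinner x y)"
  by (rule bounded_linear_intro[where K = "norm y"])
     (simp_all add: cinner_add_left cinner_scaleR_left scaleR_conv_of_real cinner_le_norm)

lemma bounded_linear_cinner_right: "bounded_linear (\<lambda>y. cinner x y)"
  by (rule bounded_linear_intro[where K = "norm x"])
     (simp_all add: cinner_add_right cinner_scaleR_right scaleR_conv_of_real cinner_le_norm mult.commute[of "norm _" "norm x"])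

lemma bounded_linear_scaleC: "bounded_linear (\<lambda>x::'a::complex_inner. c *\<^sub>C x)"
  by (rule bounded_linear_intro[where K = "cmod c"])
     (simp_all add: scaleC_add_right scaleR_eq_scaleC scaleC_scaleC mult.commute)

lemma continuous_on_scaleC_left: "continuous_on A (\<lambda>c. c *\<^sub>C (x::'a::complex_inner))"
proof -
  have "bounded_linear (\<lambda>c. c *\<^sub>C x)"
    by (rule bounded_linear_intro[where K = "norm x"])
       (simp_all add: scaleC_add_left scaleR_eq_scaleC scaleC_scaleC scaleR_conv_of_real)
  then show ?thesis
    by (rule linear_continuous_on)
qed

lemma inner_scaleC_0:
  assumes "\<And>c. inner (c *\<^sub>C x) y = 0"
  shows "cinner x y = 0"
proof -
  obtain c where "cmod (cinner x y) = inner (c *\<^sub>C x) y"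
    by (rule cmod_cinner_phase)
  with assms show ?thesis
    by simp
qed

section \<open>Projections and adjoints\<close>

text \<open>The representing vector minimizes \<open>norm x ^ 2 - 2 * \<phi> x\<close> over the subspace.\<close>

lemma riesz_closed_subspace:
  fixes S :: "'a::{real_inner,banach} set" and \<phi> :: "'a \<Rightarrow> real"
  assumes S: "subspace S" "closed S" and \<phi>: "bounded_linear \<phi>"
  shows "\<exists>u\<in>S. \<forall>x\<in>S. inner u x = \<phi> x"
proof -
  interpret bounded_linear \<phi> by (rule \<phi>)
  obtain M where M: "\<And>x. \<bar>\<phi> x\<bar> \<le> norm x * M"
    using bounded by (auto)
  define J where "J x = (norm x)\<^sup>2 - 2 * \<phi> x" for x
  have J_low: "J x \<ge> - (M\<^sup>2)" for x
  proof -
    have "\<phi> x \<le> norm x * M"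
      using M[of x] by simp
    moreover have "(norm x - M)\<^sup>2 \<ge> 0"
      by simp
    ultimately show ?thesis
      unfolding J_def power2_diff by (simp add: mult.commute)
  qed
  define m where "m = (INF x\<in>S. J x)"
  have bdd: "bdd_below (J ` S)"
    using J_low by (auto intro!: bdd_belowI)
  have ne: "S \<noteq> {}"
    using S(1) subspace_0 by blast
  have m_le: "m \<le> J x" if "x \<in> S" for x
    unfolding m_def using bdd that by (rule cINF_lower)
  have "\<exists>x\<in>S. J x < m + 1 / real (Suc n)" for n
  proof -
    have "m < m + 1 / real (Suc n)"
      by simp
    then show ?thesis
      using cINF_less_iff[OF ne bdd, of "m + 1 / real (Suc n)"] unfolding m_def by blast
  qed
  then obtain u where uS: "\<And>n. u n \<in> S" and uJ: "\<And>n. J (u n) < m + 1 / real (Suc n)"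
    by metis
  \<comment> \<open>\<open>\<phi>\<close> is linear, so its terms cancel and \<open>J\<close> obeys
    the parallelogram law. As \<open>J\<close> is at least \<open>m\<close> at the midpoint,
    minimizing sequences are Cauchy.\<close>
  have parallelogram: "(norm (x - y))\<^sup>2 = 2 * J x + 2 * J y - 4 * J ((1/2) *\<^sub>R (x + y))" for x y
    by (simp add: J_def scaleR add power2_norm_eq_inner inner_simps inner_commute algebra_simps)
  have est: "(norm (u i - u j))\<^sup>2 \<le> 2 / real (Suc i) + 2 / real (Suc j)" for i j
  proof -
    have "(1/2) *\<^sub>R (u i + u j) \<in> S"
      using S(1) uS by (simp add: subspace_add subspace_scale)
    then have "m \<le> J ((1/2) *\<^sub>R (u i + u j))"
      by (rule m_le)
    with uJ[of i] uJ[of j] show ?thesis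
      unfolding parallelogram by linarith
  qed
  have "Cauchy u"
  proof (rule metric_CauchyI)
    fix e :: real
    assume "e > 0"
    then obtain N where N: "real N > 4 / e\<^sup>2"
      using reals_Archimedean2 by blast
    have "dist (u i) (u j) < e" if "i \<ge> N" "j \<ge> N" for i j
    proof -
      have N': "4 < e\<^sup>2 * real (Suc N)"
        using N \<open>e > 0\<close> by (simp add: field_simps) (smt (verit) zero_less_power)
      have "2 / real (Suc i) \<le> 2 / real (Suc N)" "2 / real (Suc j) \<le> 2 / real (Suc N)"
        using that by (auto intro!: divide_left_mono)
      then have "(norm (u i - u j))\<^sup>2 \<le> 4 / real (Suc N)"
        using est[of i j] by simp
      also have "\<dots> < e\<^sup>2"
        using N' by (simp add: field_simps)
      finally show ?thesis
        using \<open>e > 0\<close> power2_less_imp_less by (fastforce simp: dist_norm)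
    qed
    then show "\<exists>M. \<forall>i\<ge>M. \<forall>j\<ge>M. dist (u i) (u j) < e"
      by blast
  qed
  then obtain v where v: "u \<longlonglongrightarrow> v"
    using Cauchy_convergent convergent_def by blast
  have vS: "v \<in> S"
    using closed_sequentially[OF S(2) uS v] .
  have "(\<lambda>n. J (u n)) \<longlonglongrightarrow> J v"
    unfolding J_def by (intro tendsto_intros v tendsto)
  moreover have "(\<lambda>n. m + 1 / real (Suc n)) \<longlonglongrightarrow> m + 0"
    by (intro tendsto_intros LIMSEQ_Suc[OF lim_1_over_n])
  ultimately have "J v \<le> m + 0"
    by (rule LIMSEQ_le) (use uJ less_imp_le in blast)
  then have Jv: "J v \<le> m"
    by simp
  have "inner v x = \<phi> x" if "x \<in> S" for x
  proof -
    define d where "d = inner v x - \<phi> x"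
    have *: "0 \<le> 2 * t * d + t * t * (norm x)\<^sup>2" for t
    proof -
      have "v + t *\<^sub>R x \<in> S"
        using S(1) vS that by (simp add: subspace_add subspace_scale)
      from m_le[OF this] Jv have "J v \<le> J (v + t *\<^sub>R x)"
        by simp
      then show ?thesis
        by (simp add: J_def d_def add scaleR power2_norm_eq_inner inner_simps inner_commute
            algebra_simps)
    qed
    \<comment> \<open>Adding 1 keeps the denominator positive for \<open>x = 0\<close>. At
      \<open>t = - d / c\<close> the quadratic in \<open>t\<close> is at most
      \<open>- d\<^sup>2 / c\<close>, which forces \<open>d = 0\<close>.\<close>
    define c where "c = (norm x)\<^sup>2 + 1"
    have c: "c > 0" "(norm x)\<^sup>2 < c"
      by (simp_all add: c_def add_nonneg_pos)
    have "0 \<le> 2 * (- d / c) * d + (- d / c) * (- d / c) * (norm x)\<^sup>2"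
      by (rule *)
    also have "\<dots> \<le> 2 * (- d / c) * d + (- d / c) * (- d / c) * c"
      using c by (intro add_left_mono mult_left_mono) auto
    also have "\<dots> = - d\<^sup>2 / c"
      using c by (simp add: power2_eq_square field_simps)
    finally have "d\<^sup>2 / c \<le> 0"
      by simp
    then have "d\<^sup>2 \<le> 0"
      using c(1) by (simp add: divide_le_0_iff)
    then show ?thesis
      by (simp add: d_def)
  qed
  with vS show ?thesis
    by blast
qed

lemma projection_exists:
  fixes S :: "'a::{real_inner,banach} set"
  assumes S: "subspace S" "closed S"
  shows "\<exists>E::'a \<Rightarrow>\<^sub>L 'a. \<forall>x. E x \<in> S \<and> (\<forall>y\<in>S. inner (x - E x) y = 0)"
proof -
  have "\<exists>u\<in>S. \<forall>y\<in>S. inner u y = inner x y" for x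
    by (rule riesz_closed_subspace[OF S bounded_linear_inner_right])
  then obtain p where p: "\<And>x. p x \<in> S" "\<And>x y. y \<in> S \<Longrightarrow> inner (p x) y = inner x y"
    by metis
  have uniq: "p x = u" if "u \<in> S" "\<And>y. y \<in> S \<Longrightarrow> inner u y = inner x y" for x u
  proof -
    have "p x - u \<in> S"
      using p that(1) S(1) by (simp add: subspace_diff)
    then have "inner (p x - u) (p x - u) = 0"
      using p(2)[of "p x - u" x] that(2)[of "p x - u"] by (simp add: inner_diff_left)
    then show ?thesis
      by simp
  qed
  have "bounded_linear p"
  proof (rule bounded_linear_intro[where K = 1])
    show "p (x + y) = p x + p y" for x y
      by (rule uniq) (use p S(1) in \<open>simp_all add: subspace_add inner_add_left\<close>)
    show "p (r *\<^sub>R x) = r *\<^sub>R p x" for r x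
      by (rule uniq) (use p S(1) in \<open>simp_all add: subspace_scale\<close>)
    show "norm (p x) \<le> norm x * 1" for x
    proof -
      have "norm (p x) * norm (p x) = inner x (p x)"
        using p(2)[of "p x" x] p(1)[of x] by (metis power2_norm_eq_inner power2_eq_square)
      also have "\<dots> \<le> norm x * norm (p x)"
        by (rule norm_cauchy_schwarz)
      finally show ?thesis
        by (cases "norm (p x) = 0") auto
    qed
  qed
  then have "\<forall>x. blinfun_apply (Blinfun p) x \<in> S \<and> (\<forall>y\<in>S. inner (x - blinfun_apply (Blinfun p) x) y = 0)"
    using p by (simp add: bounded_linear_Blinfun_apply inner_diff_left)
  then show ?thesis
    by blast
qed

definition orth_projection :: "'a::{real_inner,banach} set \<Rightarrow> 'a \<Rightarrow>\<^sub>L 'a" where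
  "orth_projection S = (SOME E. \<forall>x. blinfun_apply E x \<in> S \<and> (\<forall>y\<in>S. inner (x - blinfun_apply E x) y = 0))"

context
  fixes S :: "'a::{real_inner,banach} set"
  assumes S: "subspace S" "closed S"
begin

lemma orth_projection_in: "orth_projection S x \<in> S"
  and orth_projection_diff_orth: "y \<in> S \<Longrightarrow> inner (x - orth_projection S x) y = 0"
  using someI_ex[OF projection_exists[OF S]] unfolding orth_projection_def by auto

lemma inner_orth_projection: "y \<in> S \<Longrightarrow> inner (orth_projection S x) y = inner x y"
  using orth_projection_diff_orth[of y x] by (simp add: inner_diff_left)

lemma orth_projection_unique:
  assumes "u \<in> S" "\<And>y. y \<in> S \<Longrightarrow> inner (x - u) y = 0"
  shows "orth_projection S x = u"
proof -
  have "orth_projection S x - u \<in> S"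
    using orth_projection_in assms(1) S(1) by (simp add: subspace_diff)
  then have "inner (orth_projection S x - u) (orth_projection S x - u) = 0"
    using inner_orth_projection[of "orth_projection S x - u" x] assms(2)[of "orth_projection S x - u"]
    by (simp add: inner_diff_left)
  then show ?thesis
    by simp
qed

lemma orth_projection_id: "x \<in> S \<Longrightarrow> orth_projection S x = x"
  by (rule orth_projection_unique) auto

lemma orth_projection_selfadjoint: "inner (orth_projection S x) y = inner x (orth_projection S y)"
  using inner_orth_projection[of "orth_projection S y" x] inner_orth_projection[of "orth_projection S x" y]
    orth_projection_in by (metis inner_commute)

text \<open>Invariance of \<open>S\<close> under \<open>Z\<close> and its adjoint \<open>Z'\<close>
  means that \<open>Z\<close> preserves both \<open>S\<close> and its orthogonal complement. With
  multiplication by a complex scalar and by its conjugate in these roles, real projections turn out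
  to be complex linear.\<close>

lemma orth_projection_commutes:
  assumes Z: "\<And>x. x \<in> S \<Longrightarrow> Z x \<in> S" "\<And>x. x \<in> S \<Longrightarrow> Z' x \<in> S"
    and adj: "\<And>x y. inner (Z x) y = inner x (Z' y)"
    and diff: "\<And>x y. Z (x - y) = Z x - Z y"
  shows "orth_projection S (Z x) = Z (orth_projection S x)"
proof (rule orth_projection_unique)
  show "Z (orth_projection S x) \<in> S"
    using Z orth_projection_in by blast
  show "inner (Z x - Z (orth_projection S x)) y = 0" if "y \<in> S" for y
    using orth_projection_diff_orth[OF Z(2)[OF that]] by (simp add: diff[symmetric] adj)
qed

end

lemma adjoint_exists:
  fixes A :: "'a::{real_inner,banach} \<Rightarrow>\<^sub>L 'a"
  shows "\<exists>B::'a \<Rightarrow>\<^sub>L 'a. \<forall>x y. inner (A x) y = inner x (B y)"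
proof -
  have "\<exists>u. \<forall>x. inner u x = inner (A x) y" for y
  proof -
    have "bounded_linear (\<lambda>x. inner (A x) y)"
      by (intro bounded_linear_intros)
    from riesz_closed_subspace[OF subspace_UNIV closed_UNIV this] show ?thesis
      by auto
  qed
  then obtain p where p: "\<And>x y. inner (p y) x = inner (A x) y"
    by metis
  have uniq: "p y = u" if "\<And>x. inner u x = inner (A x) y" for y u
    using p that vector_eq_rdot by metis
  have "bounded_linear p"
  proof (rule bounded_linear_intro[where K = "norm A"])
    show "p (x + y) = p x + p y" for x y
      by (rule uniq) (simp add: p inner_simps)
    show "p (r *\<^sub>R x) = r *\<^sub>R p x" for r x
      by (rule uniq) (simp add: p)
    show "norm (p x) \<le> norm x * norm A" for x
    proof -
      have "norm (p x) * norm (p x) = inner (A (p x)) x"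
        by (simp add: p[symmetric] norm_eq_sqrt_inner)
      also have "\<dots> \<le> norm (A (p x)) * norm x"
        by (rule norm_cauchy_schwarz)
      also have "\<dots> \<le> (norm A * norm (p x)) * norm x"
        by (intro mult_right_mono norm_blinfun) auto
      finally show ?thesis
        by (cases "norm (p x) = 0") (auto simp: mult_ac)
    qed
  qed
  then have "\<forall>x y. inner (A x) y = inner x (blinfun_apply (Blinfun p) y)"
    using p by (simp add: bounded_linear_Blinfun_apply inner_commute)
  then show ?thesis
    by blast
qed

text \<open>The real adjoint already is the complex one: evaluating the real identity at
  \<open>\<i> *\<^sub>C x\<close> instead of \<open>x\<close> supplies the imaginary parts.\<close>

lemma complex_linear_adjoint:
  assumes adj: "\<And>x y. inner (blinfun_apply A x) y = inner x (blinfun_apply B y)"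
    and A: "complex_linear A"
  shows "complex_linear B" "cinner (blinfun_apply A x) y = cinner x (blinfun_apply B y)"
proof -
  have cadj: "cinner (A x) y = cinner x (B y)" for x y
  proof (rule complex_eqI)
    show "Re (cinner (A x) y) = Re (cinner x (B y))"
      using adj by (simp add: inner_eq_Re_cinner)
    have "Re (cinner (A (\<i> *\<^sub>C x)) y) = Re (cinner (\<i> *\<^sub>C x) (B y))"
      using adj[of "\<i> *\<^sub>C x" y] by (simp only: inner_eq_Re_cinner)
    then show "Im (cinner (A x) y) = Im (cinner x (B y))"
      using A by (simp add: complex_linear_def cinner_scaleC_left)
  qed
  then show "cinner (A x) y = cinner x (B y)" .
  have "B (c *\<^sub>C y) = c *\<^sub>C B y" for c y
  proof -
    have "inner x (B (c *\<^sub>C y)) = inner x (c *\<^sub>C B y)" for x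
      by (simp add: inner_eq_Re_cinner cadj[symmetric] cinner_scaleC_right)
    then show ?thesis
      using vector_eq_ldot by blast
  qed
  then show "complex_linear B"
    by (simp add: complex_linear_def)
qed

section \<open>Spectral cuts of self-adjoint operators\<close>

text \<open>The iterates tend to \<open>1 - sqrt (1 - A)\<close>; the increments are majorized by those of the scalar
  iteration at \<open>A = 1\<close>.\<close>

fun sqrt_iter :: "'a::real_normed_vector \<Rightarrow>\<^sub>L 'a \<Rightarrow> nat \<Rightarrow> 'a \<Rightarrow>\<^sub>L 'a" where
  "sqrt_iter A 0 = 0"
| "sqrt_iter A (Suc n) = (1/2) *\<^sub>R (A + (sqrt_iter A n o\<^sub>L sqrt_iter A n))"

fun sqrt_bound :: "nat \<Rightarrow> real" where
  "sqrt_bound 0 = 0"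
| "sqrt_bound (Suc n) = (1/2) * (1 + sqrt_bound n * sqrt_bound n)"

lemma sqrt_bound_01: "0 \<le> sqrt_bound n \<and> sqrt_bound n \<le> 1"
  by (induction n) (auto simp: mult_le_one)

lemma sqrt_bound_Suc_ge: "sqrt_bound n \<le> sqrt_bound (Suc n)"
  using sum_squares_ge_zero[of "sqrt_bound n - 1" 0] by (simp add: algebra_simps)

text \<open>Each iterate is a polynomial in \<open>A\<close>. With \<open>Z\<close> equal to
  \<open>A\<close> or to another iterate this shows that the iterates commute with each other; with
  general \<open>Z\<close> it puts the square root into the bicommutant of \<open>A\<close>.\<close>

lemma sqrt_iter_commute:
  assumes "\<And>x. blinfun_apply Z (blinfun_apply A x) = blinfun_apply A (blinfun_apply Z x)"
  shows "blinfun_apply Z (sqrt_iter A n x) = sqrt_iter A n (blinfun_apply Z x)"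
  by (induction n arbitrary: x)
     (simp_all add: assms blinfun.add_left blinfun.scaleR_left blinfun.add_right blinfun.scaleR_right)

lemma sqrt_iter_selfadjoint:
  fixes A :: "'a::real_inner \<Rightarrow>\<^sub>L 'a"
  assumes "\<And>x y. inner (blinfun_apply A x) y = inner x (blinfun_apply A y)"
  shows "inner (sqrt_iter A n x) y = inner x (sqrt_iter A n y)"
  by (induction n arbitrary: x y)
     (simp_all add: assms blinfun.add_left blinfun.scaleR_left inner_add_left inner_add_right
      sqrt_iter_commute[of A A])

lemma sqrt_iter_bounds:
  fixes A :: "'a::real_normed_vector \<Rightarrow>\<^sub>L 'a"
  assumes A: "norm A \<le> 1"
  shows "norm (sqrt_iter A n) \<le> sqrt_bound n"
    and "norm (sqrt_iter A (Suc n) - sqrt_iter A n) \<le> sqrt_bound (Suc n) - sqrt_bound n"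
proof -
  let ?Y = "sqrt_iter A" and ?y = sqrt_bound
  have bound: "norm (?Y n) \<le> ?y n" for n
  proof (induction n)
    case (Suc n)
    have "norm (?Y (Suc n)) \<le> (1/2) * (norm A + norm (?Y n o\<^sub>L ?Y n))"
      using norm_triangle_ineq[of A "?Y n o\<^sub>L ?Y n"] by simp
    also have "\<dots> \<le> (1/2) * (1 + norm (?Y n) * norm (?Y n))"
      using A norm_blinfun_compose[of "?Y n" "?Y n"] by simp
    also have "\<dots> \<le> ?y (Suc n)"
      using Suc by (simp add: mult_mono')
    finally show ?case .
  qed simp
  then show "norm (?Y n) \<le> ?y n" .
  have comm: "?Y n o\<^sub>L ?Y m = ?Y m o\<^sub>L ?Y n" for n m
  proof (rule blinfun_eqI)
    fix x
    have "?Y n (A x) = A (?Y n x)" for x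
      using sqrt_iter_commute[of A A n x] by simp
    then show "(?Y n o\<^sub>L ?Y m) x = (?Y m o\<^sub>L ?Y n) x"
      using sqrt_iter_commute[of "?Y n" A m x] by simp
  qed
  show "norm (?Y (Suc n) - ?Y n) \<le> ?y (Suc n) - ?y n"
  proof (induction n)
    case 0
    then show ?case
      using A by simp
  next
    case (Suc n)
    have "?Y (Suc (Suc n)) - ?Y (Suc n) = (1/2) *\<^sub>R ((?Y (Suc n) o\<^sub>L ?Y (Suc n)) - (?Y n o\<^sub>L ?Y n))"
      by (simp only: sqrt_iter.simps(2)[of A "Suc n"] sqrt_iter.simps(2)[of A n, symmetric])
         (subst (2) sqrt_iter.simps(2), simp only: scaleR_diff_right[symmetric], simp)
    \<comment> \<open>A difference of squares factors because the iterates commute. The scalar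
      increments satisfy the same identity, so the induction closes without loss.\<close>
    also have "\<dots> = (1/2) *\<^sub>R ((?Y (Suc n) + ?Y n) o\<^sub>L (?Y (Suc n) - ?Y n))"
      using comm[of n "Suc n"]
      by (simp only: bounded_bilinear.add_left[OF bounded_bilinear_blinfun_compose]
          bounded_bilinear.diff_right[OF bounded_bilinear_blinfun_compose]) simp
    finally have "norm (?Y (Suc (Suc n)) - ?Y (Suc n))
        = (1/2) * norm ((?Y (Suc n) + ?Y n) o\<^sub>L (?Y (Suc n) - ?Y n))"
      by simp
    also have "\<dots> \<le> (1/2) * ((?y (Suc n) + ?y n) * (?y (Suc n) - ?y n))"
    proof -
      have "norm ((?Y (Suc n) + ?Y n) o\<^sub>L (?Y (Suc n) - ?Y n))
          \<le> norm (?Y (Suc n) + ?Y n) * norm (?Y (Suc n) - ?Y n)"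
        by (rule norm_blinfun_compose)
      also have "\<dots> \<le> (?y (Suc n) + ?y n) * (?y (Suc n) - ?y n)"
      proof (rule mult_mono[OF _ Suc.IH])
        show "norm (?Y (Suc n) + ?Y n) \<le> ?y (Suc n) + ?y n"
          using norm_triangle_ineq[of "?Y (Suc n)" "?Y n"] bound[of "Suc n"] bound[of n] by linarith
        show "0 \<le> ?y (Suc n) + ?y n"
          using sqrt_bound_01[of n] sqrt_bound_01[of "Suc n"] by linarith
      qed simp
      finally show ?thesis
        by simp
    qed
    also have "\<dots> = ?y (Suc (Suc n)) - ?y (Suc n)"
      by (simp only: sqrt_bound.simps(2)[of "Suc n"]) (subst (3) sqrt_bound.simps(2), simp only: algebra_simps)
    finally show ?case .
  qed
qed

lemma square_root_exists:
  fixes A :: "'a::{real_inner,banach} \<Rightarrow>\<^sub>L 'a"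
  assumes A: "norm A \<le> 1" and selfadjoint: "\<And>x y. inner (A x) y = inner x (A y)"
  obtains X :: "'a \<Rightarrow>\<^sub>L 'a" where
    "\<forall>x. blinfun_apply X (X x) = x - blinfun_apply A x"
    "\<forall>x y. inner (blinfun_apply X x) y = inner x (X y)" "\<forall>x. inner (blinfun_apply X x) x \<ge> 0"
    "\<forall>Z. (\<forall>x. blinfun_apply Z (A x) = A (blinfun_apply Z x)) \<longrightarrow>
      (\<forall>x. blinfun_apply Z (blinfun_apply X x) = X (blinfun_apply Z x))"
proof -
  let ?Y = "sqrt_iter A" and ?y = sqrt_bound
  have diff: "norm (?Y m - ?Y n) \<le> ?y m - ?y n" if "n \<le> m" for m n
    using that
  proof (induction m rule: dec_induct)
    case (step m)
    have "norm (?Y (Suc m) - ?Y n) \<le> norm (?Y (Suc m) - ?Y m) + norm (?Y m - ?Y n)"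
      using norm_triangle_ineq[of "?Y (Suc m) - ?Y m" "?Y m - ?Y n"] by simp
    then show ?case
      using step.IH sqrt_iter_bounds(2)[OF A, of m] by linarith
  qed simp
  have mono: "?y n \<le> ?y m" if "n \<le> m" for n m
    using sqrt_bound_Suc_ge that by (rule lift_Suc_mono_le)
  have "convergent ?y"
    by (rule Bseq_monoseq_convergent, rule BseqI'[of _ 1])
       (use sqrt_bound_01 mono in \<open>auto simp: monoseq_def\<close>)
  then have Cy: "Cauchy ?y"
    by (rule convergent_Cauchy)
  have "Cauchy ?Y"
  proof (rule metric_CauchyI)
    fix e :: real
    assume "e > 0"
    then obtain M where M: "\<And>m n. m \<ge> M \<Longrightarrow> n \<ge> M \<Longrightarrow> dist (?y m) (?y n) < e"
      using Cy metric_CauchyD by blast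
    have "dist (?Y m) (?Y n) < e" if "m \<ge> M" "n \<ge> M" for m n
    proof (cases "n \<le> m")
      case True
      then show ?thesis
        using diff[OF True] M[OF that] by (simp add: dist_norm)
    next
      case False
      then have "n \<ge> m"
        by simp
      from diff[OF this] M[OF that] show ?thesis
        by (simp add: dist_norm norm_minus_commute)
    qed
    then show "\<exists>M. \<forall>m\<ge>M. \<forall>n\<ge>M. dist (?Y m) (?Y n) < e"
      by blast
  qed
  then obtain Y where Y: "?Y \<longlonglongrightarrow> Y"
    using Cauchy_convergent[of ?Y] unfolding convergent_def by auto
  have Yx: "(\<lambda>n. ?Y n x) \<longlonglongrightarrow> Y x" for x
    by (intro blinfun.tendsto Y tendsto_const)
  have "(\<lambda>n. ?Y (Suc n)) \<longlonglongrightarrow> (1/2) *\<^sub>R (A + (Y o\<^sub>L Y))"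
    unfolding sqrt_iter.simps
    by (intro tendsto_intros bounded_bilinear.tendsto[OF bounded_bilinear_blinfun_compose] Y)
  then have fixp: "Y = (1/2) *\<^sub>R (A + (Y o\<^sub>L Y))"
    using LIMSEQ_unique LIMSEQ_Suc[OF Y] by blast
  have fixp': "Y x = (1/2) *\<^sub>R (A x + Y (Y x))" for x
    by (subst fixp) (simp add: blinfun.add_left blinfun.scaleR_left)
  have normY: "norm Y \<le> 1"
    by (rule LIMSEQ_le_const2[OF tendsto_norm[OF Y]])
       (use sqrt_iter_bounds(1)[OF A] sqrt_bound_01 order_trans in blast)
  \<comment> \<open>The fixed point equation says (1 - Y)^2 = 1 - A, and
    \<open>norm Y \<le> 1\<close> makes 1 - Y positive.\<close>
  define X where "X = id_blinfun - Y"
  have X: "X x = x - Y x" for x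
    by (simp add: X_def blinfun.diff_left)
  have sq: "X (X x) = x - A x" for x
  proof -
    have "2 *\<^sub>R Y x = A x + Y (Y x)"
      by (subst fixp') simp
    then show ?thesis
      by (simp add: X blinfun.diff_right scaleR_2 algebra_simps)
  qed
  have sa: "inner (X x) y = inner x (X y)" for x y
  proof -
    have "(\<lambda>n. inner (?Y n x) y) \<longlonglongrightarrow> inner (Y x) y"
      by (intro tendsto_intros Yx)
    moreover have "(\<lambda>n. inner (?Y n x) y) \<longlonglongrightarrow> inner x (Y y)"
      unfolding sqrt_iter_selfadjoint[OF selfadjoint] by (intro tendsto_intros Yx)
    ultimately have "inner (Y x) y = inner x (Y y)"
      using LIMSEQ_unique by blast
    then show ?thesis
      by (simp add: X inner_diff_left inner_diff_right)
  qed
  have pos: "inner (X x) x \<ge> 0" for x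
  proof -
    have "inner (Y x) x \<le> norm (Y x) * norm x"
      by (rule norm_cauchy_schwarz)
    also have "\<dots> \<le> (1 * norm x) * norm x"
      using normY norm_blinfun[of Y x] by (meson mult_right_mono norm_ge_zero order_trans)
    finally show ?thesis
      by (simp add: X inner_diff_left power2_norm_eq_inner[symmetric] power2_eq_square)
  qed
  have comm: "Z (X x) = X (Z x)" if Z: "\<And>x. blinfun_apply Z (A x) = A (blinfun_apply Z x)" for Z x
  proof -
    have "(\<lambda>n. Z (?Y n x)) \<longlonglongrightarrow> Z (Y x)"
      by (intro blinfun.tendsto Yx tendsto_const)
    moreover have "(\<lambda>n. Z (?Y n x)) \<longlonglongrightarrow> Y (Z x)"
      unfolding sqrt_iter_commute[of Z A, OF Z] by (rule Yx)
    ultimately have "Z (Y x) = Y (Z x)"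
      using LIMSEQ_unique by blast
    then show ?thesis
      by (simp add: X blinfun.diff_right)
  qed
  show ?thesis
  proof (rule that[of X])
    show "\<forall>Z. (\<forall>x. blinfun_apply Z (A x) = A (blinfun_apply Z x)) \<longrightarrow> (\<forall>x. blinfun_apply Z (X x) = X (blinfun_apply Z x))"
      using comm by simp
  qed (use sq sa pos in simp_all)
qed

text \<open>With \<open>X = \<bar>B\<bar>\<close>, the positive part of \<open>B\<close> lives on the kernel of \<open>X - B\<close>: this
  kernel contains the range of \<open>X + B\<close>, so \<open>X + B\<close> vanishes on its complement.\<close>

lemma spectral_split:
  fixes B :: "'a::{real_inner,banach} \<Rightarrow>\<^sub>L 'a"
  assumes selfadjoint: "\<And>x y. inner (B x) y = inner x (B y)"
  shows "\<exists>E::'a \<Rightarrow>\<^sub>L 'a. (\<forall>x y. inner (blinfun_apply E x) y = inner x (E y)) \<and> (\<forall>x. blinfun_apply E (E x) = E x) \<and>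
    (\<forall>Z Z'. (\<forall>x y. inner (blinfun_apply Z x) y = inner x (blinfun_apply Z' y)) \<and>
        (\<forall>x. blinfun_apply Z (B x) = B (blinfun_apply Z x)) \<longrightarrow>
        (\<forall>x. blinfun_apply Z (blinfun_apply E x) = E (blinfun_apply Z x))) \<and>
    (\<forall>x. E x = x \<longrightarrow> inner (B x) x \<ge> 0) \<and> (\<forall>x. E x = 0 \<longrightarrow> inner (B x) x \<le> 0)"
proof -
  \<comment> \<open>The scaling makes \<open>C\<close> a contraction, so 1 - C C has norm at most 1;
    the square root \<open>X\<close> obtained from it satisfies X X = C C, which makes it the
    modulus of \<open>C\<close>.\<close>
  define c where "c = 1 / (1 + norm B)"
  have c: "c > 0" "c * norm B \<le> 1"
    by (simp_all add: c_def add_pos_nonneg)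
  define C where "C = c *\<^sub>R B"
  have C: "C x = c *\<^sub>R B x" for x
    by (simp add: C_def blinfun.scaleR_left)
  have Csa: "inner (C x) y = inner x (C y)" for x y
    by (simp add: C selfadjoint)
  have Cle: "norm (C x) \<le> norm x" for x
  proof -
    have "norm (C x) \<le> (c * norm B) * norm x"
      using norm_blinfun[of C x] c(1) by (simp add: C_def)
    also have "\<dots> \<le> 1 * norm x"
      using c(2) by (intro mult_right_mono) auto
    finally show ?thesis
      by simp
  qed
  define A where "A = id_blinfun - (C o\<^sub>L C)"
  have A: "A x = x - C (C x)" for x
    by (simp add: A_def blinfun.diff_left)
  have normA: "norm A \<le> 1"
  proof (rule norm_blinfun_bound)
    show "norm (A x) \<le> 1 * norm x" for x
    proof -
      have "(norm (A x))\<^sup>2 = (norm x)\<^sup>2 - 2 * (norm (C x))\<^sup>2 + (norm (C (C x)))\<^sup>2"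
        by (simp add: A power2_norm_eq_inner inner_diff_left inner_diff_right Csa inner_commute)
      moreover have "(norm (C (C x)))\<^sup>2 \<le> (norm (C x))\<^sup>2"
        using Cle by (simp add: power_mono)
      ultimately have "(norm (A x))\<^sup>2 \<le> (norm x)\<^sup>2"
        using zero_le_power2[of "norm (C x)"] by linarith
      then show ?thesis
        using power2_le_imp_le by fastforce
    qed
  qed simp
  have Asa: "inner (A x) y = inner x (A y)" for x y
    by (simp add: A inner_diff_left inner_diff_right Csa)
  obtain X where X2': "\<forall>x. blinfun_apply X (X x) = x - blinfun_apply A x"
    and Xsa': "\<forall>x y. inner (blinfun_apply X x) y = inner x (X y)" and Xpos': "\<forall>x. inner (X x) x \<ge> 0"
    and Xcomm': "\<forall>Z. (\<forall>x. blinfun_apply Z (A x) = A (blinfun_apply Z x)) \<longrightarrow>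
      (\<forall>x. blinfun_apply Z (blinfun_apply X x) = X (blinfun_apply Z x))"
    by (rule square_root_exists[OF normA Asa])
  note Xsa = Xsa'[rule_format] and Xpos = Xpos'[rule_format]
  have X2: "X (X x) = C (C x)" for x
    by (simp add: X2' A)
  have ZX: "Z (X x) = X (Z x)" if "\<And>x. blinfun_apply Z (B x) = B (blinfun_apply Z x)" for Z x
    by (rule Xcomm'[rule_format]) (simp add: A C blinfun.diff_right blinfun.scaleR_right that)
  have XC: "X (C x) = C (X x)" for x
    using ZX[of B x] by (simp add: C blinfun.scaleR_right)
  define L where "L = {x. X x = C x}"
  have L: "subspace L" "closed L"
  proof -
    show "subspace L"
      by (auto simp: L_def subspace_def blinfun.add_right blinfun.scaleR_right)
    show "closed L"
      unfolding L_def by (intro closed_Collect_eq linear_continuous_on blinfun.bounded_linear_right)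
  qed
  let ?E = "orth_projection L"
  have comm: "Z (?E x) = ?E (Z x)"
    if adj: "\<And>x y. inner (blinfun_apply Z x) y = inner x (blinfun_apply Z' y)"
      and Z: "\<And>x. blinfun_apply Z (B x) = B (blinfun_apply Z x)" for Z Z' x
  proof -
    \<comment> \<open>Take adjoints in Z B = B Z. Invariance of \<open>L\<close> under
      \<open>Z\<close> alone would not make \<open>Z\<close> commute with the projection onto
      \<open>L\<close>.\<close>
    have Z': "Z' (B x) = B (Z' x)" for x
    proof -
      have "inner y (Z' (B x)) = inner y (B (Z' x))" for y
        by (simp add: adj[symmetric] selfadjoint[symmetric] Z)
      then show ?thesis
        using vector_eq_ldot by blast
    qed
    have "x \<in> L \<Longrightarrow> Z x \<in> L" "x \<in> L \<Longrightarrow> Z' x \<in> L" for x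
      using ZX[OF Z, of x] ZX[OF Z', of x]
      by (auto simp: L_def C Z Z' blinfun.scaleR_right)
    then show ?thesis
      using orth_projection_commutes[OF L, of Z Z'] adj by (simp add: blinfun.diff_right)
  qed
  have pos: "inner (B x) x \<ge> 0" if "?E x = x" for x
  proof -
    have "X x = C x"
      using that orth_projection_in[OF L, of x] by (simp add: L_def)
    then show ?thesis
      using Xpos[of x] c(1) by (simp add: C zero_le_mult_iff)
  qed
  have neg: "inner (B x) x \<le> 0" if "?E x = 0" for x
  proof -
    have "inner (X x + C x) z = 0" for z
    proof -
      have "X z + C z \<in> L"
        by (simp add: L_def blinfun.add_right X2 XC)
      then have "inner x (X z + C z) = 0"
        using orth_projection_diff_orth[OF L, of "X z + C z" x] that by simp
      then show ?thesis
        by (simp add: inner_add_left inner_add_right Xsa Csa)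
    qed
    then have "X x + C x = 0"
      using inner_eq_zero_iff by blast
    then have "inner (C x) x = - inner (X x) x"
      by (metis add_eq_0_iff inner_minus_left)
    then have "c * inner (B x) x \<le> 0"
      using Xpos[of x] by (simp add: C)
    then show ?thesis
      using c(1) by (simp add: mult_le_0_iff)
  qed
  show ?thesis
  proof (intro exI[of _ ?E] conjI allI impI)
    show "inner (?E x) y = inner x (?E y)" for x y
      by (rule orth_projection_selfadjoint[OF L])
    show "?E (?E x) = ?E x" for x
      by (intro orth_projection_id[OF L] orth_projection_in[OF L])
    show "Z (?E x) = ?E (Z x)" if "(\<forall>x y. inner (blinfun_apply Z x) y = inner x (blinfun_apply Z' y)) \<and>
        (\<forall>x. blinfun_apply Z (B x) = B (blinfun_apply Z x))" for Z Z' x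
      using comm[of Z Z' x] that by simp
  qed (use pos neg in auto)
qed

text \<open>Splitting B - l at 0 for every level \<open>l\<close> gives a substitute for the
  spectral projections of \<open>B\<close> onto the part above \<open>l\<close>. Commutation with
  every \<open>Z\<close> that commutes with \<open>B\<close> replaces functional calculus: it makes
  the cuts commute with each other, with complex scalars and with the projection onto the subspace
  under consideration.\<close>

lemma spectral_cuts:
  fixes B :: "'a::{real_inner,banach} \<Rightarrow>\<^sub>L 'a"
  assumes selfadjoint: "\<And>x y. inner (B x) y = inner x (B y)"
  obtains E :: "real \<Rightarrow> 'a \<Rightarrow>\<^sub>L 'a" where
    "\<forall>l x y. inner (blinfun_apply (E l) x) y = inner x (E l y)"
    "\<forall>l x. blinfun_apply (E l) (E l x) = E l x"
    "\<forall>Z Z' l x. (\<forall>x y. inner (blinfun_apply Z x) y = inner x (blinfun_apply Z' y)) \<and>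
        (\<forall>x. blinfun_apply Z (B x) = B (blinfun_apply Z x)) \<longrightarrow>
        blinfun_apply Z (E l x) = E l (blinfun_apply Z x)"
    "\<forall>l x. E l x = x \<longrightarrow> l * (norm x)\<^sup>2 \<le> inner (B x) x"
    "\<forall>l x. E l x = 0 \<longrightarrow> inner (B x) x \<le> l * (norm x)\<^sup>2"
proof -
  define good where "good l E \<longleftrightarrow> (\<forall>x y. inner (blinfun_apply E x) y = inner x (E y)) \<and>
    (\<forall>x. blinfun_apply E (E x) = E x) \<and>
    (\<forall>Z Z'. (\<forall>x y. inner (blinfun_apply Z x) y = inner x (blinfun_apply Z' y)) \<and>
        (\<forall>x. blinfun_apply Z (B x) = B (blinfun_apply Z x)) \<longrightarrow>
        (\<forall>x. blinfun_apply Z (blinfun_apply E x) = E (blinfun_apply Z x))) \<and>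
    (\<forall>x. E x = x \<longrightarrow> inner (B x) x \<ge> l * (norm x)\<^sup>2) \<and>
    (\<forall>x. E x = 0 \<longrightarrow> inner (B x) x \<le> l * (norm x)\<^sup>2)" for l and E :: "'a \<Rightarrow>\<^sub>L 'a"
  have "\<exists>E. good l E" for l
  proof -
    let ?B = "B - l *\<^sub>R id_blinfun"
    have B: "?B x = B x - l *\<^sub>R x" for x
      by (simp add: blinfun.diff_left blinfun.scaleR_left)
    have "inner (?B x) y = inner x (?B y)" for x y
      by (simp add: B inner_diff_left inner_diff_right selfadjoint)
    from spectral_split[OF this] show ?thesis
      unfolding good_def
      by (simp add: B blinfun.diff_right blinfun.scaleR_right inner_diff_left power2_norm_eq_inner)
  qed
  then obtain E where E: "\<And>l. good l (E l)"
    by metis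
  show ?thesis
  proof (rule that[of E])
    have "(\<forall>x y. inner (blinfun_apply Z x) y = inner x (blinfun_apply Z' y)) \<and>
        (\<forall>x. blinfun_apply Z (B x) = B (blinfun_apply Z x)) \<longrightarrow>
        (\<forall>x. blinfun_apply Z (E l x) = E l (blinfun_apply Z x))" for Z Z' l
      using E[of l] unfolding good_def by (elim conjE allE[of _ Z] allE[of _ Z'])
    then show "\<forall>Z Z' l x. (\<forall>x y. inner (blinfun_apply Z x) y = inner x (blinfun_apply Z' y)) \<and>
        (\<forall>x. blinfun_apply Z (B x) = B (blinfun_apply Z x)) \<longrightarrow>
        blinfun_apply Z (E l x) = E l (blinfun_apply Z x)"
      by blast
  qed (use E in \<open>simp_all add: good_def\<close>)
qed

section \<open>Approximate diagonalization\<close>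

definition complex_subspace :: "'a::complex_inner set \<Rightarrow> bool" where
  "complex_subspace V \<longleftrightarrow> subspace V \<and> (\<forall>c. \<forall>x\<in>V. c *\<^sub>C x \<in> V)"

lemma inner_scaleC_left: "inner (c *\<^sub>C x) y = inner x (cnj c *\<^sub>C (y::'a::complex_inner))"
  by (simp add: inner_eq_Re_cinner cinner_scaleC_left cinner_scaleC_right)

lemma cinner_diff_orth_projection:
  fixes V :: "'a::complex_hilbert_space set"
  assumes "complex_subspace V" "closed V" "y \<in> V"
  shows "cinner (x - orth_projection V x) y = 0"
  using assms orth_projection_diff_orth[of V]
  by (intro inner_scaleC_0) (simp add: inner_scaleC_left complex_subspace_def)

lemma complex_linear_orth_projection:
  fixes V :: "'a::complex_hilbert_space set"
  assumes "complex_subspace V" "closed V"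
  shows "complex_linear (orth_projection V)"
  unfolding complex_linear_def
proof (intro allI)
  fix c and x :: 'a
  have V: "subspace V" "\<And>c x. x \<in> V \<Longrightarrow> c *\<^sub>C x \<in> V"
    using assms by (auto simp: complex_subspace_def)
  show "orth_projection V (c *\<^sub>C x) = c *\<^sub>C orth_projection V x"
  proof (rule orth_projection_commutes[OF V(1) assms(2)])
    show "inner (c *\<^sub>C x) y = inner x (cnj c *\<^sub>C y)" for x y :: 'a
      by (rule inner_scaleC_left)
  qed (use V(2) in \<open>auto simp: complex_vector.scale_right_diff_distrib\<close>)
qed

lemma closed_complex_subspace_orth:
  "complex_subspace {y::'a::complex_inner. \<forall>f\<in>F. cinner y f = 0}"
  "closed {y::'a::complex_inner. \<forall>f\<in>F. cinner y f = 0}"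
proof -
  show "complex_subspace {y::'a. \<forall>f\<in>F. cinner y f = 0}"
    by (auto simp: complex_subspace_def subspace_def cinner_add_left cinner_scaleR_left cinner_scaleC_left)
  have "{y::'a. \<forall>f\<in>F. cinner y f = 0} = (\<Inter>f\<in>F. {y. cinner y f = 0})"
    by auto
  moreover have "closed {y::'a. cinner y f = 0}" for f
    by (intro closed_Collect_eq linear_continuous_on bounded_linear_cinner_left continuous_on_const)
  ultimately show "closed {y::'a. \<forall>f\<in>F. cinner y f = 0}"
    by auto
qed

text \<open>For orthogonal unit vectors, u + w and u - w both have squared length 2, and the values
  of the form there differ by \<open>4 * inner (B u) w\<close>. In a spectral bin this converts the
  width of the bin into almost orthogonality of images.\<close>

lemma polarization_bound:
  fixes B :: "'a::real_inner \<Rightarrow>\<^sub>L 'a"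
  assumes selfadjoint: "\<And>x y. inner (B x) y = inner x (B y)"
    and S: "subspace S"
    and bounds: "\<And>z. z \<in> S \<Longrightarrow> p * (norm z)\<^sup>2 \<le> inner (B z) z" "\<And>z. z \<in> S \<Longrightarrow> inner (B z) z \<le> q * (norm z)\<^sup>2"
    and uw: "u \<in> S" "w \<in> S" "inner u w = 0"
  shows "inner (B u) w \<le> (q - p) * norm u * norm w"
proof (cases "u = 0 \<or> w = 0")
  case True
  then show ?thesis
    by (auto simp: blinfun.zero_right)
next
  case False
  have unit: "inner (B u) w \<le> (q - p) / 2" if "u \<in> S" "w \<in> S" "inner u w = 0" "norm u = 1" "norm w = 1" for u w
  proof -
    have "u + w \<in> S" "u - w \<in> S"
      using S that by (auto simp: subspace_add subspace_diff)
    moreover have "(norm (u + w))\<^sup>2 = 2" "(norm (u - w))\<^sup>2 = 2"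
      using that by (simp_all add: power2_norm_eq_inner inner_simps inner_commute norm_eq_1)
    ultimately have "inner (B (u + w)) (u + w) \<le> q * 2" "p * 2 \<le> inner (B (u - w)) (u - w)"
      using bounds by metis+
    moreover have "inner (B (u + w)) (u + w) - inner (B (u - w)) (u - w) = 4 * inner (B u) w"
      using selfadjoint[of w u]
      by (simp add: blinfun.add_right blinfun.diff_right inner_simps inner_commute)
    ultimately show ?thesis
      by simp
  qed
  have "inner (B (u /\<^sub>R norm u)) (w /\<^sub>R norm w) \<le> (q - p) / 2"
    using uw False S by (intro unit) (auto simp: subspace_scale)
  then have "inner (B u) w \<le> (q - p) / 2 * (norm u * norm w)"
    using False by (simp add: blinfun.scaleR_right field_simps)
  also have "\<dots> \<le> (q - p) * (norm u * norm w)"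
  proof -
    have "p * (norm u)\<^sup>2 \<le> q * (norm u)\<^sup>2"
      using bounds uw(1) order_trans by blast
    then have "p \<le> q"
      using False by simp
    then show ?thesis
      by (intro mult_right_mono) auto
  qed
  finally show ?thesis
    by (simp add: mult.assoc)
qed

text \<open>Telescoping of 1/(n - 1) - 1/n, which dominates 1/n^2. Raising \<open>N\<close> makes
  the bin widths, and later the corrections of the weights, as small in square sum as
  required.\<close>

lemma sum_inverse_square_le:
  assumes "N \<ge> 2"
  shows "(\<Sum>j<J. (1 / real (j + N))\<^sup>2) \<le> 1 / real (N - 1)"
proof -
  have "(\<Sum>j<J. (1 / real (j + N))\<^sup>2) \<le> 1 / real (N - 1) - 1 / real (J + N - 1)"
  proof (induction J)
    case (Suc J)
    have "(1 / real (J + N))\<^sup>2 \<le> 1 / real (J + N - 1) - 1 / real (Suc J + N - 1)"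
    proof -
      have pos: "real (J + N - 1) > 0" "real (J + N) > 0" "real (J + N) = real (J + N - 1) + 1"
        using assms by auto
      have "1 / real (J + N - 1) - 1 / real (Suc J + N - 1) = 1 / (real (J + N - 1) * real (J + N))"
        using pos by (simp add: field_simps)
      also have "\<dots> \<ge> (1 / real (J + N))\<^sup>2"
        using pos by (simp add: power2_eq_square divide_simps)
      finally show ?thesis .
    qed
    with Suc show ?case
      by simp
  qed simp
  then show ?thesis
    by (rule order_trans) simp
qed

text \<open>The vectors are the components of the target in spectral bins \<open>[q (j + 1), q j)\<close> of the
  compression of \<open>T\<^sup>* T\<close>, with \<open>q j\<close> proportional to \<open>1 / (j + N)\<close>: the bins reach down to
  \<open>0\<close>, while the relative widths \<open>1 / (j + N)\<close> are square summable.\<close>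

lemma approximate_eigenvectors:
  fixes T :: "'a::complex_hilbert_space \<Rightarrow>\<^sub>L 'a"
  assumes T: "complex_linear T" "\<And>x. T x = 0 \<Longrightarrow> x = 0"
    and V: "complex_subspace V" "closed V"
    and x: "x \<in> V" "x \<noteq> 0" and eps: "\<epsilon> > 0" and eta: "\<eta> > 0"
  obtains M :: "('a \<times> real) list" where "M \<noteq> []"
    "\<And>p. p \<in> set M \<Longrightarrow> fst p \<in> V \<and> norm (fst p) = 1 \<and> 0 \<le> snd p"
    "\<And>i j. i < length M \<Longrightarrow> j < i \<Longrightarrow> cinner (fst (M ! i)) (fst (M ! j)) = 0"
    "\<And>p y. p \<in> set M \<Longrightarrow> y \<in> V \<Longrightarrow> cinner y (fst p) = 0 \<Longrightarrow>
       cmod (cinner (T (fst p)) (T y)) \<le> snd p * norm (T (fst p)) * norm (T y)"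
    "(\<Sum>p\<leftarrow>M. (snd p)\<^sup>2) \<le> \<eta>"
    "\<And>y. y \<in> V \<Longrightarrow> (\<And>p. p \<in> set M \<Longrightarrow> cinner y (fst p) = 0) \<Longrightarrow> cmod (cinner y x) \<le> \<epsilon> * norm y"
proof -
  have V': "subspace V" "\<And>c x. x \<in> V \<Longrightarrow> c *\<^sub>C x \<in> V"
    using V by (auto simp: complex_subspace_def)
  note pr = orth_projection_in[OF V'(1) V(2)] orth_projection_id[OF V'(1) V(2)]
    orth_projection_selfadjoint[OF V'(1) V(2)]
  let ?P = "orth_projection V"
  have PC: "?P (c *\<^sub>C z) = c *\<^sub>C ?P z" for c z
    using complex_linear_orth_projection[OF V] by (simp add: complex_linear_def)
  obtain T' where adjT: "\<And>x y. inner (blinfun_apply T x) y = inner x (blinfun_apply T' y)"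
    using adjoint_exists[of T] by blast
  have T': "complex_linear T'"
    using complex_linear_adjoint[OF adjT T(1)] by blast
  define B where "B = ?P o\<^sub>L T' o\<^sub>L T o\<^sub>L ?P"
  have B: "B z = ?P (T' (T (?P z)))" for z
    by (simp add: B_def)
  have BC: "B (c *\<^sub>C z) = c *\<^sub>C B z" for c z
    using T(1) T' by (simp add: B PC complex_linear_def)
  have form: "inner (B y) z = inner (T (?P y)) (T (?P z))" for y z
  proof -
    have "inner (B y) z = inner (T' (T (?P y))) (?P z)"
      by (simp only: B pr(3))
    also have "\<dots> = inner (?P z) (T' (T (?P y)))"
      by (rule inner_commute)
    also have "\<dots> = inner (T (?P z)) (T (?P y))"
      by (simp only: adjT)
    also have "\<dots> = inner (T (?P y)) (T (?P z))"
      by (rule inner_commute)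
    finally show ?thesis .
  qed
  have selfadjoint: "inner (B y) z = inner y (B z)" for y z
  proof -
    have "inner (B y) z = inner (B z) y"
      unfolding form by (rule inner_commute)
    then show ?thesis
      by (simp only: inner_commute[of y])
  qed
  have cform: "cinner (B y) z = cinner (T (?P y)) (T (?P z))" for y z
  proof (rule complex_eqI)
    show "Re (cinner (B y) z) = Re (cinner (T (?P y)) (T (?P z)))"
      using form by (simp add: inner_eq_Re_cinner)
    show "Im (cinner (B y) z) = Im (cinner (T (?P y)) (T (?P z)))"
      using T(1) by (simp add: Im_cinner form PC complex_linear_def)
  qed
  obtain E :: "real \<Rightarrow> 'a \<Rightarrow>\<^sub>L 'a" where
      Esa': "\<forall>l x y. inner (blinfun_apply (E l) x) y = inner x (E l y)"
    and Eid': "\<forall>l x. blinfun_apply (E l) (E l x) = E l x"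
    and Ecomm': "\<forall>Z Z' l x. (\<forall>x y. inner (blinfun_apply Z x) y = inner x (blinfun_apply Z' y)) \<and>
        (\<forall>x. blinfun_apply Z (B x) = B (blinfun_apply Z x)) \<longrightarrow>
        blinfun_apply Z (E l x) = E l (blinfun_apply Z x)"
    and Ege': "\<forall>l x. E l x = x \<longrightarrow> l * (norm x)\<^sup>2 \<le> inner (B x) x"
    and Ele': "\<forall>l x. E l x = 0 \<longrightarrow> inner (B x) x \<le> l * (norm x)\<^sup>2"
    by (rule spectral_cuts[OF selfadjoint])
  note Esa = Esa'[rule_format] and Eid = Eid'[rule_format]
    and Ege = Ege'[rule_format] and Ele = Ele'[rule_format]
  have Ecomm: "blinfun_apply Z (E l x) = E l (blinfun_apply Z x)"
    if "\<And>x y. inner (blinfun_apply Z x) y = inner x (blinfun_apply Z' y)"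
      "\<And>x. blinfun_apply Z (B x) = B (blinfun_apply Z x)" for Z Z' l x
  proof (rule Ecomm'[THEN spec[of _ Z], THEN spec[of _ Z'], THEN spec, THEN spec, THEN mp])
    show "(\<forall>x y. inner (blinfun_apply Z x) y = inner x (blinfun_apply Z' y)) \<and>
        (\<forall>x. blinfun_apply Z (B x) = B (blinfun_apply Z x))"
      by (intro conjI allI) (rule that)+
  qed
  have EB: "B (E l z) = E l (B z)" for l z
    by (rule Ecomm[OF selfadjoint]) simp
  have EE: "E m (E l z) = E l (E m z)" for l m z
    by (rule Ecomm[OF Esa]) (simp add: EB)
  have EP: "?P (E l z) = E l (?P z)" for l z
    by (rule Ecomm[OF pr(3)]) (simp add: B pr(1,2))
  \<comment> \<open>Multiplication by \<open>c\<close> commutes with \<open>B\<close> and has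
    multiplication by \<open>cnj c\<close> as its real adjoint, so the commutation clause of the
    cuts applies.\<close>
  have EC: "E l (c *\<^sub>C z) = c *\<^sub>C E l z" for l c z
  proof -
    have app: "blinfun_apply (Blinfun (\<lambda>x::'a. c *\<^sub>C x)) = (\<lambda>x. c *\<^sub>C x)" for c
      by (simp add: bounded_linear_Blinfun_apply bounded_linear_scaleC)
    show ?thesis
      using Ecomm[of "Blinfun (\<lambda>x. c *\<^sub>C x)" "Blinfun (\<lambda>x. cnj c *\<^sub>C x)" l z]
      by (simp add: app inner_scaleC_left BC)
  qed
  have Ecsa: "cinner (E l y) z = cinner y (E l z)" for l y z
    using complex_linear_adjoint(2)[OF Esa] EC by (simp add: complex_linear_def)
  \<comment> \<open>On the part of \<open>E m z\<close> below the lower level \<open>l\<close> the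
    form of \<open>B\<close> would be at least \<open>m\<close> and at most \<open>l\<close> times
    the squared norm, so this part is 0.\<close>
  have Emono: "E l (E m z) = E m z" if "l < m" for l m z
  proof -
    let ?u = "E m z - E l (E m z)"
    have "E m ?u = ?u" "E l ?u = 0"
      by (simp_all add: blinfun.diff_right Eid EE[of m l])
    then have "m * (norm ?u)\<^sup>2 \<le> l * (norm ?u)\<^sup>2"
      using Ege Ele order_trans by blast
    then have "(m - l) * (norm ?u)\<^sup>2 \<le> 0"
      by (simp add: algebra_simps)
    with that have "?u = 0"
      by (simp add: mult_le_0_iff)
    then show ?thesis
      by simp
  qed
  \<comment> \<open>\<open>B\<close> vanishes on the orthogonal complement of \<open>V\<close>, so
    nothing of that complement survives a cut at a positive level.\<close>
  have Ein: "E l z \<in> V" if "l > 0" for l z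
  proof -
    let ?u = "E l z - ?P (E l z)"
    have "E l ?u = ?u"
      by (simp add: blinfun.diff_right Eid EP)
    from Ege[OF this] have "l * (norm ?u)\<^sup>2 \<le> inner (B ?u) ?u" .
    also have "B ?u = 0"
      by (simp add: B blinfun.diff_right pr(1,2))
    finally have "?u = 0"
      using that by (simp add: mult_le_0_iff)
    then show ?thesis
      using pr(1)[of "E l z"] by simp
  qed
  \<comment> \<open>A level strictly above the norm of \<open>B\<close>. The cut there is 0, so bins
    starting at \<open>q 0 = C\<close> exhaust everything above \<open>q J\<close>.\<close>
  define C where "C = (norm T)\<^sup>2 + 1"
  have "C > 0"
    by (simp add: C_def add_nonneg_pos)
  have EC0: "E C z = 0" for z
  proof -
    have "C * (norm (E C z))\<^sup>2 \<le> inner (B (E C z)) (E C z)"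
      by (rule Ege) (rule Eid)
    also have "\<dots> = (norm (T (?P (E C z))))\<^sup>2"
      by (simp add: form power2_norm_eq_inner)
    also have "\<dots> \<le> (norm T * norm (E C z))\<^sup>2"
      using norm_blinfun[of T "E C z"] by (simp add: pr(2)[OF Ein[OF \<open>C > 0\<close>]] power_mono)
    finally have "(norm (E C z))\<^sup>2 \<le> 0"
      by (simp add: C_def power_mult_distrib algebra_simps)
    then show ?thesis
      by simp
  qed
  \<comment> \<open>With this choice \<open>N - 1\<close> exceeds \<open>1 / \<eta>\<close>, so the
    squared relative bin widths sum to at most \<open>\<eta>\<close>.\<close>
  obtain N0 :: nat where N0: "1 / \<eta> < real N0"
    using reals_Archimedean2 by blast
  define N where "N = N0 + 2"
  have N: "N \<ge> 2" "1 / real (N - 1) \<le> \<eta>"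
  proof -
    show "N \<ge> 2"
      by (simp add: N_def)
    have "1 < \<eta> * real N0"
      using N0 eta by (simp add: field_simps)
    then show "1 / real (N - 1) \<le> \<eta>"
      using eta by (simp add: N_def field_simps)
  qed
  define q where "q j = C * real N / real (j + N)" for j
  have q: "q j > 0" "q (Suc j) < q j" "(q j - q (Suc j)) = (1 / real (j + N)) * q (Suc j)" for j
    using \<open>C > 0\<close> N(1) by (simp_all add: q_def field_simps)
  have q0: "q 0 = C"
    using N(1) by (simp add: q_def)
  have q_anti: "q k < q j" if "j < k" for j k
    unfolding q_def using that \<open>C > 0\<close> N(1) by (intro divide_strict_left_mono mult_pos_pos) auto
  define D where "D j = E (q (Suc j)) - E (q j)" for j
  have D: "D j z = E (q (Suc j)) z - E (q j) z" for j z
    by (simp add: D_def blinfun.diff_left)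
  have Emin: "E (q j) (E (q k) z) = E (q (min j k)) z" for j k z
  proof (cases j k rule: linorder_cases)
    case less
    then show ?thesis
      using Emono[OF q_anti[OF less], of z] EE by (simp add: min_def)
  next
    case greater
    then show ?thesis
      using Emono[OF q_anti[OF greater], of z] by (simp add: min_def)
  qed (simp add: Eid)
  have DD: "D j (D k z) = (if j = k then D j z else 0)" for j k z
    by (auto simp: D blinfun.diff_right Emin min_def le_Suc_eq)
  have Dcsa: "cinner (D j y) z = cinner y (D j z)" for j y z
    by (simp add: D cinner_diff_left cinner_diff_right Ecsa)
  have DB: "B (D j z) = D j (B z)" for j z
    by (simp add: D blinfun.diff_right EB)
  have DC: "D j (c *\<^sub>C z) = c *\<^sub>C D j z" for j c z
    by (simp add: D EC complex_vector.scale_right_diff_distrib)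
  have Din: "D j z \<in> V" for j z
    using V'(1) by (simp add: D Ein q subspace_diff)
  have Dge: "q (Suc j) * (norm u)\<^sup>2 \<le> inner (B u) u" and Dle: "inner (B u) u \<le> q j * (norm u)\<^sup>2"
    if "D j u = u" for j u
  proof -
    have "E (q (Suc j)) (D j u) = D j u" "E (q j) (D j u) = 0"
      by (simp_all add: D blinfun.diff_right Emin min_def)
    then have "E (q (Suc j)) u = u" "E (q j) u = 0"
      by (simp_all only: that)
    then show "q (Suc j) * (norm u)\<^sup>2 \<le> inner (B u) u" "inner (B u) u \<le> q j * (norm u)\<^sup>2"
      using Ege Ele by blast+
  qed
  have Dsum: "(\<Sum>j<J. D j z) = E (q J) z" for J z
    by (induction J) (simp_all add: D q0 EC0)
  \<comment> \<open>\<open>B\<close> preserves the bins, so only the component \<open>w\<close> of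
    \<open>y\<close> in the bin of \<open>e\<close> contributes. Polarization bounds the entry by
    the bin width, which is \<open>1 / (j + N)\<close> times the lower bound
    \<open>q (Suc j)\<close> of the form there; one square root of that bound is absorbed into each
    of \<open>T e\<close> and \<open>T w\<close>.\<close>
  have bound: "cmod (cinner (T e) (T y)) \<le> (1 / real (j + N)) * norm (T e) * norm (T y)"
    if e: "D j e = e" and y: "y \<in> V" "cinner y e = 0" for j e y
  proof -
    have eV: "e \<in> V"
      using Din[of j e] e by simp
    define w where "w = D j y"
    have w: "D j w = w" "w \<in> V"
      by (simp_all add: w_def DD Din)
    have ew: "cinner e w = 0"
    proof -
      have "cinner e y = 0"
        using y(2) cinner_eq_0_commute by blast
      then show ?thesis
        using Dcsa[of j e y] e by (simp add: w_def)
    qed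
    have "cinner (T e) (T y) = cinner (B e) y"
      using eV y by (simp add: cform pr)
    also have "\<dots> = cinner (B e) w"
      using DB[of j e] Dcsa[of j "B e" y] by (simp add: e w_def)
    finally have 1: "cmod (cinner (T e) (T y)) = cmod (cinner (B e) w)"
      by simp
    obtain c where c: "cmod c = 1" "cmod (cinner (B e) w) = inner (c *\<^sub>C B e) w"
      by (rule cmod_cinner_phase)
    note c(2)
    also have "inner (c *\<^sub>C B e) w = inner (B (c *\<^sub>C e)) w"
      by (simp add: BC)
    also have "\<dots> \<le> (q j - q (Suc j)) * norm (c *\<^sub>C e) * norm w"
    proof (rule polarization_bound[OF selfadjoint, where S = "{u. D j u = u}"])
      show "subspace {u. D j u = u}"
        by (auto simp: subspace_def blinfun.add_right blinfun.scaleR_right blinfun.zero_right)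
      show "inner (c *\<^sub>C e) w = 0"
        using ew by (simp add: inner_eq_Re_cinner cinner_scaleC_left)
    qed (use Dge Dle e w in \<open>auto simp: DC\<close>)
    also have "\<dots> = (1 / real (j + N)) * ((sqrt (q (Suc j)) * norm e) * (sqrt (q (Suc j)) * norm w))"
      using c(1) q(1)[of "Suc j"] by (simp add: q(3))
    also have "\<dots> \<le> (1 / real (j + N)) * (norm (T e) * norm (T y))"
    proof (intro mult_left_mono mult_mono)
      have root: "sqrt (q (Suc j)) * norm u \<le> norm (T u)" if "D j u = u" "u \<in> V" for u
      proof -
        have "(sqrt (q (Suc j)) * norm u)\<^sup>2 = q (Suc j) * (norm u)\<^sup>2"
          using q(1)[of "Suc j"] by (simp add: power_mult_distrib)
        also have "\<dots> \<le> inner (B u) u"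
          by (rule Dge[OF that(1)])
        also have "\<dots> = (norm (T u))\<^sup>2"
          using that(2) by (simp add: form pr power2_norm_eq_inner)
        finally show ?thesis
          using power2_le_imp_le by fastforce
      qed
      show "sqrt (q (Suc j)) * norm e \<le> norm (T e)"
        using root e eV by blast
      \<comment> \<open>This passes from \<open>w\<close> back to \<open>y\<close>: the images of
        \<open>w\<close> and \<open>y - w\<close> are orthogonal, so Pythagoras applies.\<close>
      have "(norm (T w))\<^sup>2 \<le> (norm (T y))\<^sup>2"
      proof -
        have yw: "y - w \<in> V"
          using V'(1) y(1) w(2) by (simp add: subspace_diff)
        have "cinner (B w) (y - w) = cinner (D j (B w)) (y - w)"
          using DB[of j w] w(1) by simp
        also have "\<dots> = cinner (B w) (D j (y - w))"
          by (rule Dcsa)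
        also have "D j (y - w) = 0"
          by (simp add: blinfun.diff_right w(1) w_def[symmetric])
        finally have "cinner (B w) (y - w) = 0"
          by simp
        then have "inner (T w) (T (y - w)) = 0"
          using cform[of w "y - w"] yw w(2) by (simp add: pr inner_eq_Re_cinner)
        then have "(norm (T w + T (y - w)))\<^sup>2 = (norm (T w))\<^sup>2 + (norm (T (y - w)))\<^sup>2"
          by (simp add: power2_norm_eq_inner inner_simps inner_commute)
        then show ?thesis
          by (simp add: blinfun.diff_right)
      qed
      then have "norm (T w) \<le> norm (T y)"
        using power2_le_imp_le by fastforce
      with root[OF w] show "sqrt (q (Suc j)) * norm w \<le> norm (T y)"
        by linarith
    qed (use q(1)[of "Suc j"] in auto)
    finally show ?thesis
      using 1 by (simp add: mult.assoc)
  qed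
  \<comment> \<open>The part of \<open>x\<close> below level \<open>q J\<close>. The norms decrease
    and the increments are orthogonal, so \<open>v\<close> is Cauchy. The squared norm of
    \<open>T (v J)\<close> is at most \<open>q J * (norm (v 0))\<^sup>2\<close>, so the limit lies
    in the kernel of \<open>T\<close>. Injectivity thus lets finitely many bins suffice.\<close>
  define v where "v J = x - E (q J) x" for J
  have vV: "v J \<in> V" for J
    using V'(1) x(1) Ein[OF q(1)] by (simp add: v_def subspace_diff)
  have Ev: "E (q J) (v J) = 0" for J
    by (simp add: v_def blinfun.diff_right Eid)
  have v_norm: "(norm (v J - v K))\<^sup>2 = (norm (v J))\<^sup>2 - (norm (v K))\<^sup>2" if "J \<le> K" for J K
  proof -
    have "v J - v K = E (q K) (v J)"
      using that by (simp add: v_def blinfun.diff_right Emin min_def)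
    then have "inner (v J - v K) (v K) = 0"
      using Esa[of "q K" "v J" "v K"] by (simp add: Ev)
    then show ?thesis
      by (simp add: power2_norm_eq_inner inner_diff_left inner_diff_right inner_commute)
  qed
  have v_dec: "(norm (v K))\<^sup>2 \<le> (norm (v J))\<^sup>2" if "J \<le> K" for J K
    using v_norm[OF that] zero_le_power2[of "norm (v J - v K)"] by linarith
  have "convergent (\<lambda>J. (norm (v J))\<^sup>2)"
  proof (rule Bseq_monoseq_convergent)
    show "Bseq (\<lambda>J. (norm (v J))\<^sup>2)"
      by (rule BseqI'[of _ "(norm (v 0))\<^sup>2"]) (use v_dec in simp)
    show "monoseq (\<lambda>J. (norm (v J))\<^sup>2)"
      using v_dec by (auto simp: monoseq_def)
  qed
  then have "Cauchy (\<lambda>J. (norm (v J))\<^sup>2)"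
    by (rule convergent_Cauchy)
  have "Cauchy v"
  proof (rule metric_CauchyI)
    fix e :: real
    assume "e > 0"
    then obtain M where M: "\<And>J K. J \<ge> M \<Longrightarrow> K \<ge> M \<Longrightarrow> dist ((norm (v J))\<^sup>2) ((norm (v K))\<^sup>2) < e\<^sup>2"
      using metric_CauchyD[OF \<open>Cauchy (\<lambda>J. (norm (v J))\<^sup>2)\<close>, of "e\<^sup>2"] by auto
    have "dist (v J) (v K) < e" if "J \<ge> M" "K \<ge> M" for J K
    proof -
      have "(norm (v J - v K))\<^sup>2 < e\<^sup>2"
      proof (cases "J \<le> K")
        case True
        then show ?thesis
          using v_norm[OF True] M[OF that] by (simp add: dist_real_def)
      next
        case False
        then have "K \<le> J"
          by simp
        from v_norm[OF this] M[OF that] show ?thesis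
          by (simp add: dist_real_def norm_minus_commute)
      qed
      then show ?thesis
        using \<open>e > 0\<close> power2_less_imp_less by (fastforce simp: dist_norm)
    qed
    then show "\<exists>M. \<forall>J\<ge>M. \<forall>K\<ge>M. dist (v J) (v K) < e"
      by blast
  qed
  then obtain v0 where v0: "v \<longlonglongrightarrow> v0"
    using Cauchy_convergent[of v] unfolding convergent_def by auto
  have "T v0 = 0"
  proof -
    have "(norm (T (v J)))\<^sup>2 \<le> q J * (norm (v 0))\<^sup>2" for J
    proof -
      have "(norm (T (v J)))\<^sup>2 = inner (B (v J)) (v J)"
        by (simp add: form pr(2)[OF vV] power2_norm_eq_inner)
      also have "\<dots> \<le> q J * (norm (v J))\<^sup>2"
        by (rule Ele) (rule Ev)
      also have "\<dots> \<le> q J * (norm (v 0))\<^sup>2"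
        using v_dec[of 0 J] q(1)[of J] by (intro mult_left_mono) auto
      finally show ?thesis .
    qed
    moreover have "(\<lambda>J. q J * (norm (v 0))\<^sup>2) \<longlonglongrightarrow> 0 * (norm (v 0))\<^sup>2"
    proof (intro tendsto_intros)
      have "(\<lambda>j. (C * real N) * (1 / real (j + N))) \<longlonglongrightarrow> (C * real N) * 0"
        by (intro tendsto_intros LIMSEQ_ignore_initial_segment[OF lim_1_over_n])
      then show "q \<longlonglongrightarrow> 0"
        by (simp add: q_def[abs_def])
    qed
    moreover have "(\<lambda>J. (norm (T (v J)))\<^sup>2) \<longlonglongrightarrow> (norm (T v0))\<^sup>2"
      by (intro tendsto_intros blinfun.tendsto v0)
    ultimately have "(norm (T v0))\<^sup>2 \<le> 0 * (norm (v 0))\<^sup>2"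
      by (intro LIMSEQ_le[of _ _ "\<lambda>J. q J * (norm (v 0))\<^sup>2"]) auto
    then show ?thesis
      by simp
  qed
  then have "v0 = 0"
    by (rule T(2))
  then have "(\<lambda>J. norm (v J)) \<longlonglongrightarrow> 0"
    using tendsto_norm[OF v0] by simp
  moreover have "0 < min \<epsilon> (norm x)"
    using eps x(2) by simp
  ultimately have "eventually (\<lambda>J. norm (v J) < min \<epsilon> (norm x)) sequentially"
    by (rule order_tendstoD(2))
  \<comment> \<open>The first bound yields the estimate for vectors orthogonal to the list; the
    second ensures that \<open>x\<close> has a component in some bin, so the list is not
    empty.\<close>
  then obtain J where J: "norm (v J) < \<epsilon>" "norm (v J) < norm x"
    unfolding eventually_sequentially by auto
  let ?ok = "\<lambda>j. D j x \<noteq> 0"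
  define e where "e j = D j x /\<^sub>R norm (D j x)" for j
  have e: "D j (e j) = e j" "norm (e j) = 1" "e j \<in> V" if "?ok j" for j
    using that V'(1) Din by (simp_all add: e_def blinfun.scaleR_right DD subspace_scale)
  define js where "js = filter ?ok [0..<J]"
  define M where "M = map (\<lambda>j. (e j, 1 / real (j + N))) js"
  have js: "j \<in> set js \<longleftrightarrow> j < J \<and> ?ok j" for j
    by (auto simp: js_def)
  have setM: "\<exists>j. j < J \<and> ?ok j \<and> p = (e j, 1 / real (j + N))" if "p \<in> set M" for p
    using that by (auto simp: M_def js)
  show ?thesis
  proof (rule that[of M])
    show "M \<noteq> []"
    proof
      assume "M = []"
      then have "D j x = 0" if "j < J" for j
        using that js by (auto simp: M_def)
      then have "E (q J) x = 0"
        using Dsum[of x J] by simp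
      then show False
        using J(2) by (simp add: v_def)
    qed
    show "fst p \<in> V \<and> norm (fst p) = 1 \<and> 0 \<le> snd p" if "p \<in> set M" for p
      using setM[OF that] e by auto
    show "cinner (fst (M ! i)) (fst (M ! j)) = 0" if "i < length M" "j < i" for i j
    proof -
      have "distinct js"
        by (simp add: js_def)
      then have "js ! i \<noteq> js ! j"
        using that by (simp add: M_def nth_eq_iff_index_eq)
      moreover have "?ok (js ! i)" "?ok (js ! j)"
        using that js[of "js ! i"] js[of "js ! j"] by (auto simp: M_def)
      ultimately have "cinner (e (js ! i)) (e (js ! j)) = 0"
        using Dcsa[of "js ! i" "e (js ! i)" "e (js ! j)"] DD[of "js ! i" "js ! j" "e (js ! j)"] e(1)
        by simp
      then show ?thesis
        using that by (simp add: M_def)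
    qed
    show "cmod (cinner (T (fst p)) (T y)) \<le> snd p * norm (T (fst p)) * norm (T y)"
      if "p \<in> set M" "y \<in> V" "cinner y (fst p) = 0" for p y
      using setM[OF that(1)] bound[OF e(1) that(2)] that(3) by auto
    have "(\<Sum>p\<leftarrow>M. (snd p)\<^sup>2) = (\<Sum>j\<leftarrow>js. (1 / real (j + N))\<^sup>2)"
      by (simp add: M_def comp_def)
    also have "\<dots> \<le> (\<Sum>j\<leftarrow>[0..<J]. (1 / real (j + N))\<^sup>2)"
      unfolding js_def sum_list_map_filter' by (intro sum_list_mono) auto
    also have "\<dots> = (\<Sum>j<J. (1 / real (j + N))\<^sup>2)"
      by (simp add: interv_sum_list_conv_sum_set_nat lessThan_atLeast0)
    also have "\<dots> \<le> \<eta>"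
      by (rule order_trans[OF sum_inverse_square_le[OF N(1)] N(2)])
    finally show "(\<Sum>p\<leftarrow>M. (snd p)\<^sup>2) \<le> \<eta>" .
    show "cmod (cinner y x) \<le> \<epsilon> * norm y"
      if y: "y \<in> V" "\<And>p. p \<in> set M \<Longrightarrow> cinner y (fst p) = 0" for y
    proof -
      have "cinner (D j x) y = 0" if "j < J" for j
      proof (cases "?ok j")
        case True
        then have "cinner y (e j) = 0"
          using y(2)[of "(e j, 1 / real (j + N))"] that js by (force simp: M_def)
        then have "cinner (norm (D j x) *\<^sub>R e j) y = 0"
          using cinner_eq_0_commute by (simp add: cinner_scaleR_left) blast
        then show ?thesis
          using True by (simp add: e_def)
      qed simp
      then have "cinner (E (q J) x) y = 0"
        unfolding Dsum[symmetric] cinner_sum_left by simp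
      then have "cinner y (E (q J) x) = 0"
        using cinner_eq_0_commute by blast
      then have "cmod (cinner y x) = cmod (cinner y (v J))"
        by (simp add: v_def cinner_diff_right)
      also have "\<dots> \<le> norm y * norm (v J)"
        by (rule cinner_le_norm)
      also have "\<dots> \<le> \<epsilon> * norm y"
        using J(1) by (subst mult.commute) (intro mult_right_mono, simp_all)
      finally show ?thesis .
    qed
  qed
qed

definition orthonormal :: "('i \<Rightarrow> 'a::complex_inner) \<Rightarrow> bool" where
  "orthonormal e \<longleftrightarrow> (\<forall>i j. cinner (e i) (e j) = (if i = j then 1 else 0))"

definition complete_family :: "('i \<Rightarrow> 'a::complex_inner) \<Rightarrow> bool" where
  "complete_family e \<longleftrightarrow> (\<forall>y. (\<forall>i. cinner y (e i) = 0) \<longrightarrow> y = 0)"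

lemma orthonormal_norm:
  assumes "orthonormal e"
  shows "norm (e i) = 1"
proof -
  have "complex_of_real ((norm (e i))\<^sup>2) = of_real 1"
    using assms by (simp only: power2_norm_eq_cinner) (simp add: orthonormal_def)
  then have "(norm (e i))\<^sup>2 = 1\<^sup>2"
    by (simp only: of_real_eq_iff) simp
  then show ?thesis
    by (subst (asm) power2_eq_iff_nonneg) auto
qed

lemma exists_orthogonal_to_finite:
  fixes F :: "'a::complex_inner set"
  assumes "infinite_dimensional TYPE('a)" and F: "finite F"
    and orth: "\<And>f g. f \<in> F \<Longrightarrow> g \<in> F \<Longrightarrow> cinner f g = (if f = g then 1 else 0)"
  obtains y where "y \<noteq> 0" "\<And>f. f \<in> F \<Longrightarrow> cinner y f = 0"
proof -
  have "complex_vector.span F \<noteq> UNIV"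
    using assms(1) F by (auto simp: infinite_dimensional_def)
  then obtain x where x: "x \<notin> complex_vector.span F"
    by blast
  define z where "z = (\<Sum>f\<in>F. cinner x f *\<^sub>C f)"
  have "z \<in> complex_vector.span F"
    unfolding z_def by (intro complex_vector.span_sum complex_vector.span_scale complex_vector.span_base)
  then have "x - z \<noteq> 0"
    using x by auto
  moreover have "cinner (x - z) f = 0" if "f \<in> F" for f
    using that F orth
    by (simp add: z_def cinner_diff_left cinner_sum_left cinner_scaleC_left if_distrib[of "(*) _"] cong: if_cong)
  ultimately show ?thesis
    using that by blast
qed

text \<open>Each entry carries a basis vector and its permitted error. Almost orthogonality is
  demanded only against vectors orthogonal to all entries up to and including the i-th, so appending
  entries cannot spoil it.\<close>

definition partial_basis :: "('a::complex_inner \<Rightarrow>\<^sub>L 'a) \<Rightarrow> ('a \<times> real) list \<Rightarrow> bool" where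
  "partial_basis T L \<longleftrightarrow>
    (\<forall>p\<in>set L. norm (fst p) = 1 \<and> 0 \<le> snd p) \<and>
    (\<forall>i<length L. \<forall>j<i. cinner (fst (L ! i)) (fst (L ! j)) = 0) \<and>
    (\<forall>i<length L. \<forall>y. (\<forall>j\<le>i. cinner y (fst (L ! j)) = 0) \<longrightarrow>
      cmod (cinner (T (fst (L ! i))) (T y)) \<le> snd (L ! i) * norm (T (fst (L ! i))) * norm (T y))"

text \<open>The new vectors are taken from the orthogonal complement of the old ones and resolve the
  component of \<open>a\<close> in it; a vector orthogonal to the old ones sees only that
  component.\<close>

lemma partial_basis_extend:
  fixes T :: "'a::complex_hilbert_space \<Rightarrow>\<^sub>L 'a"
  assumes inf: "infinite_dimensional TYPE('a)"
    and T: "complex_linear T" "\<And>x. T x = 0 \<Longrightarrow> x = 0"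
    and L: "partial_basis T L" and eps: "\<epsilon> > 0" and eta: "\<eta> > 0"
  obtains M where "M \<noteq> []" "partial_basis T (L @ M)" "(\<Sum>p\<leftarrow>M. (snd p)\<^sup>2) \<le> \<eta>"
    "\<And>y. (\<And>p. p \<in> set (L @ M) \<Longrightarrow> cinner y (fst p) = 0) \<Longrightarrow> cmod (cinner y a) \<le> \<epsilon> * norm y"
proof -
  define F where "F = fst ` set L"
  define V where "V = {y. \<forall>f\<in>F. cinner y f = 0}"
  have V: "complex_subspace V" "closed V"
    unfolding V_def by (rule closed_complex_subspace_orth)+
  have L1: "norm (fst p) = 1 \<and> 0 \<le> snd p" if "p \<in> set L" for p
    using L that by (simp add: partial_basis_def)
  have L2: "cinner (fst (L ! i)) (fst (L ! j)) = 0" if "i < length L" "j < i" for i j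
    using L that by (simp add: partial_basis_def)
  have L3: "cmod (cinner (T (fst (L ! i))) (T y)) \<le> snd (L ! i) * norm (T (fst (L ! i))) * norm (T y)"
    if "i < length L" "\<forall>j\<le>i. cinner y (fst (L ! j)) = 0" for i y
    using L that by (simp add: partial_basis_def)
  have F_orth: "cinner f g = (if f = g then 1 else 0)" if fg: "f \<in> F" "g \<in> F" for f g
  proof -
    obtain i j where ij: "f = fst (L ! i)" "i < length L" "g = fst (L ! j)" "j < length L"
      using fg unfolding F_def by (metis (no_types, lifting) imageE in_set_conv_nth)
    have "norm f = 1"
      using ij L1[of "L ! i"] by simp
    moreover have "cinner f g = 0" if "f \<noteq> g"
      using ij that L2[of i j] L2[of j i] cinner_eq_0_commute[of f g] by (metis linorder_neqE_nat)
    ultimately show ?thesis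
      by (auto simp: cinner_self)
  qed
  have "finite F"
    by (simp add: F_def)
  then obtain z where "z \<noteq> 0" "\<And>f. f \<in> F \<Longrightarrow> cinner z f = 0"
    by (rule exists_orthogonal_to_finite[OF inf]) (use F_orth in blast)+
  then have z: "z \<noteq> 0" "z \<in> V"
    by (auto simp: V_def)
  have subV: "subspace V"
    using V by (simp add: complex_subspace_def)
  \<comment> \<open>If the old vectors already span \<open>a\<close>, a nonzero vector of
    \<open>V\<close> takes its place so that the list still grows; infinite dimension provides
    one.\<close>
  define x where "x = (if orth_projection V a = 0 then z else orth_projection V a)"
  have x: "x \<in> V" "x \<noteq> 0"
    using z orth_projection_in[OF subV V(2)] by (auto simp: x_def)
  obtain M :: "('a \<times> real) list" where M: "M \<noteq> []"
    "\<And>p. p \<in> set M \<Longrightarrow> fst p \<in> V \<and> norm (fst p) = 1 \<and> 0 \<le> snd p"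
    "\<And>i j. i < length M \<Longrightarrow> j < i \<Longrightarrow> cinner (fst (M ! i)) (fst (M ! j)) = 0"
    "\<And>p y. p \<in> set M \<Longrightarrow> y \<in> V \<Longrightarrow> cinner y (fst p) = 0 \<Longrightarrow>
       cmod (cinner (T (fst p)) (T y)) \<le> snd p * norm (T (fst p)) * norm (T y)"
    "(\<Sum>p\<leftarrow>M. (snd p)\<^sup>2) \<le> \<eta>"
    "\<And>y. y \<in> V \<Longrightarrow> (\<And>p. p \<in> set M \<Longrightarrow> cinner y (fst p) = 0) \<Longrightarrow> cmod (cinner y x) \<le> \<epsilon> * norm y"
    by (rule approximate_eigenvectors[OF T V x eps eta]) (assumption | blast)+
  show ?thesis
  proof (rule that[of M])
    show "M \<noteq> []" "(\<Sum>p\<leftarrow>M. (snd p)\<^sup>2) \<le> \<eta>"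
      by fact+
    show "cmod (cinner y a) \<le> \<epsilon> * norm y"
      if y: "\<And>p. p \<in> set (L @ M) \<Longrightarrow> cinner y (fst p) = 0" for y
    proof -
      have yV: "y \<in> V"
        using y by (auto simp: V_def F_def)
      have "cinner (a - orth_projection V a) y = 0"
        by (rule cinner_diff_orth_projection[OF V yV])
      then have ya: "cinner y a = cinner y (orth_projection V a)"
        using cinner_eq_0_commute[of y "a - orth_projection V a"] by (simp add: cinner_diff_right)
      show ?thesis
      proof (cases "orth_projection V a = 0")
        case True
        then show ?thesis
          using eps ya by simp
      next
        case False
        then have "x = orth_projection V a"
          by (simp add: x_def)
        then show ?thesis
          using M(6)[OF yV] y ya by simp
      qed
    qed
    have Mth: "M ! k \<in> set M" "fst (M ! k) \<in> V" if "k < length M" for k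
      using that M(2)[of "M ! k"] by auto
    show "partial_basis T (L @ M)"
      unfolding partial_basis_def
    proof (intro conjI allI impI ballI)
      show "norm (fst p) = 1" "0 \<le> snd p" if "p \<in> set (L @ M)" for p
        using that L1[of p] M(2)[of p] by auto
      show "cinner (fst ((L @ M) ! i)) (fst ((L @ M) ! j)) = 0" if "i < length (L @ M)" "j < i" for i j
      proof (cases "i < length L")
        case True
        then show ?thesis
          using that L2 by (simp add: nth_append)
      next
        case False
        then have i: "i - length L < length M"
          using that by auto
        show ?thesis
        proof (cases "j < length L")
          case True
          then show ?thesis
            using Mth(2)[OF i] False by (auto simp: nth_append V_def F_def)
        next
          case False
          then show ?thesis
            using i that \<open>\<not> i < length L\<close> M(3)[OF i, of "j - length L"] by (simp add: nth_append)
        qed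
      qed
      show "cmod (cinner (T (fst ((L @ M) ! i))) (T y))
          \<le> snd ((L @ M) ! i) * norm (T (fst ((L @ M) ! i))) * norm (T y)"
        if i: "i < length (L @ M)" and y: "\<forall>j\<le>i. cinner y (fst ((L @ M) ! j)) = 0" for i y
      proof (cases "i < length L")
        case True
        then have "\<forall>j\<le>i. cinner y (fst (L ! j)) = 0"
        proof (intro allI impI)
          fix j
          assume "j \<le> i"
          then show "cinner y (fst (L ! j)) = 0"
            using y[rule_format, of j] True by (simp add: nth_append)
        qed
        then show ?thesis
          using True L3 by (simp add: nth_append)
      next
        case False
        then have k: "i - length L < length M"
          using i by auto
        have "cinner y (fst (L ! j)) = 0" if "j < length L" for j
          using y[rule_format, of j] that False by (simp add: nth_append)
        then have "\<forall>p\<in>set L. cinner y (fst p) = 0"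
          unfolding all_set_conv_all_nth by blast
        then have "y \<in> V"
          by (simp add: V_def F_def)
        moreover have "cinner y (fst (M ! (i - length L))) = 0"
          using y[rule_format, of i] False by (simp add: nth_append)
        ultimately show ?thesis
          using M(4)[OF Mth(1)[OF k]] False by (simp add: nth_append)
      qed
    qed
  qed
qed

lemma approximate_diagonal_basis:
  fixes T :: "'a::complex_hilbert_space \<Rightarrow>\<^sub>L 'a"
  assumes sep: "separable_space (euclidean :: 'a topology)"
    and inf: "infinite_dimensional TYPE('a)"
    and T: "complex_linear T" "\<And>x. T x = 0 \<Longrightarrow> x = 0"
    and eta: "\<eta> > 0"
  obtains e :: "nat \<Rightarrow> 'a" and \<delta> :: "nat \<Rightarrow> real" where
    "orthonormal e" "complete_family e" "\<And>n. 0 \<le> \<delta> n"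
    "summable (\<lambda>n. (\<delta> n)\<^sup>2)" "(\<Sum>n. (\<delta> n)\<^sup>2) \<le> \<eta>"
    "\<And>n y. \<forall>j\<le>n. cinner y (e j) = 0 \<Longrightarrow>
      cmod (cinner (T (e n)) (T y)) \<le> \<delta> n * norm (T (e n)) * norm (T y)"
proof -
  obtain C :: "'a set" where C: "countable C" "closure C = UNIV"
    using sep by (auto simp: separable_space_def)
  have "C \<noteq> {}"
    using C(2) by auto
  \<comment> \<open>The pairing makes every point of the dense set recur as a target, so its
    tolerance \<open>1 / real (Suc k)\<close> becomes arbitrarily small.\<close>
  define a where "a k = from_nat_into C (fst (prod_decode k))" for k
  define target where "target k L \<longleftrightarrow>
    (\<forall>y. (\<forall>p\<in>set L. cinner y (fst p) = 0) \<longrightarrow> cmod (cinner y (a k)) \<le> (1 / real (Suc k)) * norm y)"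
    for k and L :: "('a \<times> real) list"
  have "\<exists>L. \<forall>k. (partial_basis T (L k) \<and> (\<Sum>p\<leftarrow>L k. (snd p)\<^sup>2) \<le> \<eta> * (1 - (1/2)^k)) \<and>
      ((\<exists>M. M \<noteq> [] \<and> L (Suc k) = L k @ M) \<and> target k (L (Suc k)))"
  proof (rule dependent_nat_choice)
    show "\<exists>L. partial_basis T L \<and> (\<Sum>p\<leftarrow>L. (snd p)\<^sup>2) \<le> \<eta> * (1 - (1/2)^0)"
      by (rule exI[of _ "[]"]) (simp add: partial_basis_def)
  next
    fix L k
    assume L: "partial_basis T L \<and> (\<Sum>p\<leftarrow>L. (snd p)\<^sup>2) \<le> \<eta> * (1 - (1/2)^k)"
    \<comment> \<open>Stage \<open>k\<close> may spend \<open>\<eta> * (1/2)^Suc k\<close>, so all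
      stages together stay within \<open>\<eta>\<close>.\<close>
    have eps: "1 / real (Suc k) > 0" and eta': "\<eta> * (1/2)^Suc k > 0"
      using eta by simp_all
    obtain M where M: "M \<noteq> []" "partial_basis T (L @ M)" "(\<Sum>p\<leftarrow>M. (snd p)\<^sup>2) \<le> \<eta> * (1/2)^Suc k"
      "\<And>y. (\<And>p. p \<in> set (L @ M) \<Longrightarrow> cinner y (fst p) = 0) \<Longrightarrow>
        cmod (cinner y (a k)) \<le> (1 / real (Suc k)) * norm y"
      by (rule partial_basis_extend[OF inf T conjunct1[OF L] eps eta', of "a k"]) (assumption | blast)+
    have "(\<Sum>p\<leftarrow>L @ M. (snd p)\<^sup>2) \<le> \<eta> * (1 - (1/2)^Suc k)"
      using conjunct2[OF L] M(3) by (simp add: algebra_simps)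
    then show "\<exists>L'. (partial_basis T L' \<and> (\<Sum>p\<leftarrow>L'. (snd p)\<^sup>2) \<le> \<eta> * (1 - (1/2)^Suc k)) \<and>
      ((\<exists>M. M \<noteq> [] \<and> L' = L @ M) \<and> target k L')"
      using M(1,2,4) unfolding target_def by (intro exI[of _ "L @ M"]) blast
  qed
  then obtain L where L: "\<And>k. partial_basis T (L k)" "\<And>k. (\<Sum>p\<leftarrow>L k. (snd p)\<^sup>2) \<le> \<eta> * (1 - (1/2)^k)"
      "\<And>k. \<exists>M. M \<noteq> [] \<and> L (Suc k) = L k @ M" "\<And>k. target k (L (Suc k))"
    by blast
  have len: "k \<le> length (L k)" for k
  proof (induction k)
    case (Suc k)
    obtain M where "M \<noteq> []" "L (Suc k) = L k @ M"
      using L(3) by blast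
    with Suc show ?case
      by (cases M) auto
  qed simp
  have nth_mono: "L m ! n = L k ! n" if "k \<le> m" "n < length (L k)" for k m n
    using that(1)
  proof (induction m rule: dec_induct)
    case (step m)
    have "length (L k) \<le> length (L m)"
      using step(1)
    proof (induction m rule: dec_induct)
      case (step m)
      then show ?case
        using L(3)[of m] by auto
    qed simp
    then show ?case
      using step L(3)[of m] that(2) by (auto simp: nth_append)
  qed simp
  \<comment> \<open>Stage \<open>Suc n\<close> has more than \<open>n\<close> entries and later
    stages only append, so its n-th entry is final.\<close>
  define p where "p n = L (Suc n) ! n" for n
  have p: "L m ! n = p n" if "n < length (L m)" for m n
  proof (cases "m \<le> Suc n")
    case True
    then show ?thesis
      using nth_mono[of m "Suc n" n] that by (simp add: p_def)
  next
    case False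
    then show ?thesis
      using nth_mono[of "Suc n" m n] len[of "Suc n"] by (simp add: p_def)
  qed
  have inL: "p n \<in> set (L (Suc n))" "n < length (L (Suc n))" for n
    using len[of "Suc n"] by (auto simp: p_def)
  define e where "e n = fst (p n)" for n
  define \<delta> where "\<delta> n = snd (p n)" for n
  have unit: "norm (e n) = 1" "0 \<le> \<delta> n" for n
    using L(1)[of "Suc n"] inL(1)[of n] by (simp_all add: partial_basis_def e_def \<delta>_def)
  have orth_less: "cinner (e i) (e j) = 0" if "j < i" for i j
  proof -
    have "cinner (fst (L (Suc i) ! i)) (fst (L (Suc i) ! j)) = 0"
      using L(1)[of "Suc i"] inL(2)[of i] that by (simp add: partial_basis_def)
    then show ?thesis
      using that inL(2)[of i] by (simp add: p e_def)
  qed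
  have partial_sum: "(\<Sum>i<n. (\<delta> i)\<^sup>2) \<le> \<eta>" for n
  proof -
    have "(\<Sum>i<n. (\<delta> i)\<^sup>2) \<le> (\<Sum>i<length (L n). (\<delta> i)\<^sup>2)"
      using len[of n] by (intro sum_mono2) auto
    also have "\<dots> = (\<Sum>i<length (L n). (snd (L n ! i))\<^sup>2)"
      by (simp add: p \<delta>_def)
    also have "\<dots> = (\<Sum>p\<leftarrow>L n. (snd p)\<^sup>2)"
      by (simp add: sum_list_sum_nth lessThan_atLeast0)
    also have "\<dots> \<le> \<eta> * (1 - (1/2)^n)"
      by (rule L(2))
    also have "\<dots> \<le> \<eta>"
      using eta by (simp add: algebra_simps)
    finally show ?thesis .
  qed
  show ?thesis
  proof (rule that[of e \<delta>])
    show "orthonormal e"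
      unfolding orthonormal_def
    proof (intro allI)
      fix i j :: nat
      show "cinner (e i) (e j) = (if i = j then 1 else 0)"
        using orth_less[of i j] orth_less[of j i] cinner_eq_0_commute[of "e i" "e j"] unit(1)[of i]
        by (cases i j rule: linorder_cases) (auto simp: cinner_self)
    qed
    show "complete_family e"
      unfolding complete_family_def
    proof (intro allI impI)
      fix y
      assume y: "\<forall>i. cinner y (e i) = 0"
      have ak: "cmod (cinner y (a k)) \<le> (1 / real (Suc k)) * norm y" for k
      proof -
        have "cinner y (fst r) = 0" if r: "r \<in> set (L (Suc k))" for r
        proof -
          obtain n where "n < length (L (Suc k))" "r = L (Suc k) ! n"
            using r by (auto simp: in_set_conv_nth)
          then show ?thesis
            using y p[of n "Suc k"] by (simp add: e_def)
        qed
        then show ?thesis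
          using L(4)[of k] by (simp add: target_def)
      qed
      have "cinner y c = 0" if c: "c \<in> C" for c
      proof -
        obtain i where i: "from_nat_into C i = c"
          using from_nat_into_surj[OF C(1) c] by blast
        have "cmod (cinner y c) \<le> (1 / real (Suc j)) * norm y" for j
        proof -
          have "cmod (cinner y c) \<le> (1 / real (Suc (prod_encode (i, j)))) * norm y"
            using ak[of "prod_encode (i, j)"] i by (simp add: a_def)
          also have "\<dots> \<le> (1 / real (Suc j)) * norm y"
            using le_prod_encode_2[of j i] by (intro mult_right_mono divide_left_mono) auto
          finally show ?thesis .
        qed
        moreover have "(\<lambda>j. (1 / real (Suc j)) * norm y) \<longlonglongrightarrow> 0 * norm y"
          by (intro tendsto_intros LIMSEQ_Suc[OF lim_1_over_n])
        ultimately have "cmod (cinner y c) \<le> 0 * norm y"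
          by (intro LIMSEQ_le_const) auto
        then show ?thesis
          by simp
      qed
      moreover have "closed {z. cinner y z = 0}"
        by (intro closed_Collect_eq linear_continuous_on bounded_linear_cinner_right continuous_on_const)
      ultimately have "closure C \<subseteq> {z. cinner y z = 0}"
        by (intro closure_minimal) auto
      then have "cinner y y = 0"
        using C(2) by auto
      then show "y = 0"
        by (simp add: cinner_self)
    qed
    show "0 \<le> \<delta> n" for n
      by (rule unit)
    show "summable (\<lambda>n. (\<delta> n)\<^sup>2)"
      by (rule summableI_nonneg_bounded[of _ \<eta>]) (use partial_sum in auto)
    then show "(\<Sum>n. (\<delta> n)\<^sup>2) \<le> \<eta>"
      using partial_sum by (intro suminf_le_const)
    show "cmod (cinner (T (e n)) (T y)) \<le> \<delta> n * norm (T (e n)) * norm (T y)"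
      if y: "\<forall>j\<le>n. cinner y (e j) = 0" for n y
    proof -
      have "\<forall>j\<le>n. cinner y (fst (L (Suc n) ! j)) = 0"
        using y p[of _ "Suc n"] inL(2)[of n] by (auto simp: e_def)
      then have "cmod (cinner (T (fst (L (Suc n) ! n))) (T y))
          \<le> snd (L (Suc n) ! n) * norm (T (fst (L (Suc n) ! n))) * norm (T y)"
        using L(1)[of "Suc n"] inL(2)[of n] unfolding partial_basis_def by blast
      then show ?thesis
        by (simp add: e_def \<delta>_def p_def)
    qed
  qed
qed

section \<open>Orthonormalizing the almost orthogonal images\<close>

lemma subspace_closure:
  fixes S :: "'a::real_normed_vector set"
  assumes "subspace S"
  shows "subspace (closure S)"
proof (rule subspaceI)
  show "0 \<in> closure S"
    using assms closure_subset subspace_0 by blast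
  show "x + y \<in> closure S" if xy: "x \<in> closure S" "y \<in> closure S" for x y
  proof -
    obtain u v where "\<And>n. u n \<in> S" "u \<longlonglongrightarrow> x" "\<And>n. v n \<in> S" "v \<longlonglongrightarrow> y"
      using xy unfolding closure_sequential by blast
    then have "(\<forall>n. u n + v n \<in> S) \<and> (\<lambda>n. u n + v n) \<longlonglongrightarrow> x + y"
      using assms by (auto intro: subspace_add tendsto_add)
    then show ?thesis
      unfolding closure_sequential by (rule exI[of _ "\<lambda>n. u n + v n"])
  qed
  show "c *\<^sub>R x \<in> closure S" if x: "x \<in> closure S" for c x
  proof -
    obtain u where "\<And>n. u n \<in> S" "u \<longlonglongrightarrow> x"
      using x unfolding closure_sequential by blast
    then have "(\<forall>n. c *\<^sub>R u n \<in> S) \<and> (\<lambda>n. c *\<^sub>R u n) \<longlonglongrightarrow> c *\<^sub>R x"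
      using assms by (auto intro: subspace_scale tendsto_scaleR)
    then show ?thesis
      unfolding closure_sequential by (rule exI[of _ "\<lambda>n. c *\<^sub>R u n"])
  qed
qed

text \<open>Gram-Schmidt from behind: \<open>T (e n)\<close> is orthogonalized against the images of all later
  basis vectors, to which it is already almost orthogonal.\<close>

lemma orthonormal_near_images:
  fixes T :: "'a::complex_hilbert_space \<Rightarrow>\<^sub>L 'a"
  assumes T: "complex_linear T" "\<And>x. T x = 0 \<Longrightarrow> x = 0"
    and e: "orthonormal e" and \<delta>: "\<And>n::nat. 0 \<le> \<delta> n" "\<And>n. \<delta> n < 1"
    and almost: "\<And>n y. \<forall>j\<le>n. cinner y (e j) = 0 \<Longrightarrow>
      cmod (cinner (T (e n)) (T y)) \<le> \<delta> n * norm (T (e n)) * norm (T y)"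
  obtains f :: "nat \<Rightarrow> 'a" where "orthonormal f"
    "\<And>n. norm (T (e n) /\<^sub>R norm (T (e n)) - f n) \<le> 2 * \<delta> n"
proof -
  have "norm (e n) = 1" for n
    using e by (rule orthonormal_norm)
  then have Te: "norm (T (e n)) > 0" for n
    using T(2)[of "e n"] by (metis norm_zero zero_less_norm_iff zero_neq_one)
  define g where "g n = T (e n) /\<^sub>R norm (T (e n))" for n
  have g: "norm (g n) = 1" for n
    using Te[of n] by (simp add: g_def)
  \<comment> \<open>The image of the full orthogonal complement of the first \<open>n\<close> basis
    vectors: it contains \<open>T (e n)\<close> and all later images, and \<open>W (Suc n)\<close>
    is exactly the set on which the almost orthogonality of \<open>T (e n)\<close> is given.\<close>
  define W where "W n = T ` {y. \<forall>f\<in>e ` {..<n}. cinner y f = 0}" for n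
  define N where "N n = closure (W n)" for n
  have W: "complex_subspace (W n)" for n
  proof -
    have V: "complex_subspace {y. \<forall>f\<in>e ` {..<n}. cinner y f = 0}" (is "complex_subspace ?V")
      by (rule closed_complex_subspace_orth)
    have "linear (blinfun_apply T)"
      by (simp add: blinfun.bounded_linear_right bounded_linear.linear)
    then have "subspace (W n)"
      unfolding W_def using V by (intro linear_subspace_image) (auto simp: complex_subspace_def)
    moreover have "c *\<^sub>C z \<in> W n" if z: "z \<in> W n" for c z
    proof -
      obtain y where y: "y \<in> ?V" "z = T y"
        using z unfolding W_def by blast
      have "c *\<^sub>C y \<in> ?V"
        using V y(1) unfolding complex_subspace_def by blast
      moreover have "c *\<^sub>C z = T (c *\<^sub>C y)"
        using T(1) y(2) by (simp add: complex_linear_def)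
      ultimately show ?thesis
        unfolding W_def by blast
    qed
    ultimately show ?thesis
      by (simp add: complex_subspace_def)
  qed
  have N: "complex_subspace (N n)" "closed (N n)" "subspace (N n)" for n
  proof -
    show sub: "subspace (N n)"
      using W[of n] by (simp add: N_def complex_subspace_def subspace_closure)
    show "closed (N n)"
      by (simp add: N_def)
    have "c *\<^sub>C z \<in> N n" if "z \<in> N n" for c z
    proof -
      have "(\<lambda>z. c *\<^sub>C z) ` closure (W n) \<subseteq> closure ((\<lambda>z. c *\<^sub>C z) ` W n)"
        by (intro image_closure_subset linear_continuous_on bounded_linear_scaleC closure_subset) auto
      also have "\<dots> \<subseteq> closure (W n)"
        using W[of n] by (intro closure_mono) (auto simp: complex_subspace_def)
      finally show ?thesis
        using that by (auto simp: N_def)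
    qed
    with sub show "complex_subspace (N n)"
      by (simp add: complex_subspace_def)
  qed
  have N_anti: "N m \<subseteq> N n" if "n \<le> m" for m n
    unfolding N_def W_def using that by (intro closure_mono image_mono) auto
  have gN: "g n \<in> N n" for n
  proof -
    have "T (e n) \<in> W n"
      using e unfolding W_def by (auto simp: orthonormal_def)
    then have "T (e n) \<in> N n"
      unfolding N_def using closure_subset by blast
    then show ?thesis
      using N(3) by (simp add: g_def subspace_scale)
  qed
  have g_almost: "cmod (cinner (g n) z) \<le> \<delta> n * norm z" if "z \<in> N (Suc n)" for n z
  proof -
    have "closed {z. cmod (cinner (g n) z) \<le> \<delta> n * norm z}"
      by (intro closed_Collect_le continuous_intros linear_continuous_on bounded_linear_cinner_right)
    moreover have "W (Suc n) \<subseteq> {z. cmod (cinner (g n) z) \<le> \<delta> n * norm z}"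
    proof
      fix z
      assume "z \<in> W (Suc n)"
      then obtain y where y: "z = T y" "\<forall>j\<le>n. cinner y (e j) = 0"
        unfolding W_def by (auto simp: less_Suc_eq_le)
      have "cinner (g n) z = cinner (T (e n)) (T y) / of_real (norm (T (e n)))"
        by (simp add: g_def y(1) cinner_scaleR_left field_simps)
      then have "cmod (cinner (g n) z) = cmod (cinner (T (e n)) (T y)) / norm (T (e n))"
        by (simp add: norm_divide)
      also have "\<dots> \<le> \<delta> n * norm z"
        using almost[OF y(2)] Te[of n] by (simp add: y(1) divide_simps mult_ac)
      finally show "z \<in> {z. cmod (cinner (g n) z) \<le> \<delta> n * norm z}"
        by simp
    qed
    ultimately have "N (Suc n) \<subseteq> {z. cmod (cinner (g n) z) \<le> \<delta> n * norm z}"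
      unfolding N_def by (rule closure_minimal[rotated])
    then show ?thesis
      using that by blast
  qed
  define u where "u n = orth_projection (N (Suc n)) (g n)" for n
  have uN: "u n \<in> N (Suc n)" for n
    unfolding u_def by (rule orth_projection_in[OF N(3,2)])
  \<comment> \<open>The squared norm of the projection \<open>u n\<close> is the inner product of
    \<open>g n\<close> with \<open>u n\<close>, to which the almost orthogonality applies.\<close>
  have u_small: "norm (u n) \<le> \<delta> n" for n
  proof -
    have "cinner (g n - u n) (u n) = 0"
      unfolding u_def by (rule cinner_diff_orth_projection[OF N(1,2)]) (rule uN[unfolded u_def])
    then have "of_real ((norm (u n))\<^sup>2) = cinner (g n) (u n)"
      by (simp add: cinner_diff_left power2_norm_eq_cinner del: of_real_power)
    then have "(norm (u n))\<^sup>2 \<le> \<delta> n * norm (u n)"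
      using g_almost[OF uN] by (metis abs_power2 norm_of_real)
    then show ?thesis
      using \<delta>(1)[of n] by (cases "norm (u n) = 0") (auto simp: power2_eq_square)
  qed
  define h where "h n = g n - u n" for n
  have h_norm: "\<bar>norm (h n) - 1\<bar> \<le> \<delta> n" "norm (h n) > 0" for n
  proof -
    have "\<bar>norm (h n) - norm (g n)\<bar> \<le> norm (h n - g n)"
      by (rule norm_triangle_ineq3)
    then show "\<bar>norm (h n) - 1\<bar> \<le> \<delta> n"
      using u_small[of n] g[of n] by (simp add: h_def)
    then show "norm (h n) > 0"
      using \<delta>(2)[of n] by linarith
  qed
  define f where "f n = h n /\<^sub>R norm (h n)" for n
  have h_orth: "cinner (h n) z = 0" if "z \<in> N (Suc n)" for n z
    unfolding h_def u_def by (rule cinner_diff_orth_projection[OF N(1,2) that])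
  have fN: "f n \<in> N n" for n
    using gN[of n] uN[of n] N_anti[of n "Suc n"] N(3)
    by (auto simp: f_def h_def intro!: subspace_scale subspace_diff)
  have f_less: "cinner (f n) (f m) = 0" if "n < m" for n m
    using h_orth[of "f m" n] fN[of m] N_anti[of "Suc n" m] that by (auto simp: f_def[of n] cinner_scaleR_left)
  show ?thesis
  proof (rule that[of f])
    show "orthonormal f"
      unfolding orthonormal_def
    proof (intro allI)
      fix i j :: nat
      have "norm (f i) = 1"
        using h_norm(2)[of i] by (simp add: f_def)
      then show "cinner (f i) (f j) = (if i = j then 1 else 0)"
        using f_less[of i j] f_less[of j i] cinner_eq_0_commute[of "f i" "f j"]
        by (cases i j rule: linorder_cases) (auto simp: cinner_self)
    qed
    \<comment> \<open>One \<open>\<delta> n\<close> comes from subtracting \<open>u n\<close>, the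
      other from renormalizing \<open>h n\<close>.\<close>
    show "norm (T (e n) /\<^sub>R norm (T (e n)) - f n) \<le> 2 * \<delta> n" for n
    proof -
      have "g n - f n = u n + (h n - f n)"
        by (simp add: h_def)
      also have "norm \<dots> \<le> norm (u n) + norm (h n - f n)"
        by (rule norm_triangle_ineq)
      also have "h n - f n = (norm (h n) - 1) *\<^sub>R f n"
      proof -
        have "norm (h n) *\<^sub>R f n = h n"
          using h_norm(2)[of n] by (simp add: f_def)
        then show ?thesis
          by (simp add: scaleR_diff_left)
      qed
      also have "norm \<dots> = \<bar>norm (h n) - 1\<bar>"
        using h_norm(2)[of n] by (simp add: f_def abs_mult)
      finally show ?thesis
        using u_small[of n] h_norm(1)[of n] unfolding g_def by linarith
    qed
  qed
qed

section \<open>Operators given by orthogonal series\<close>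

lemma orthonormal_sum_norm:
  assumes "orthonormal f" "finite F"
  shows "(norm (\<Sum>i\<in>F. c i *\<^sub>C f i))\<^sup>2 = (\<Sum>i\<in>F. (cmod (c i))\<^sup>2)"
proof -
  have "cinner (\<Sum>i\<in>F. c i *\<^sub>C f i) (f j) = c j" if "j \<in> F" for j
    using assms that by (simp add: cinner_sum_left cinner_scaleC_left orthonormal_def if_distrib[of "(*) _"] cong: if_cong)
  then have inner: "cinner (f j) (\<Sum>i\<in>F. c i *\<^sub>C f i) = cnj (c j)" if "j \<in> F" for j
    using that cinner_commute by metis
  have "complex_of_real ((norm (\<Sum>i\<in>F. c i *\<^sub>C f i))\<^sup>2)
      = (\<Sum>j\<in>F. c j * cinner (f j) (\<Sum>i\<in>F. c i *\<^sub>C f i))"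
    unfolding power2_norm_eq_cinner by (subst cinner_sum_left) (simp add: cinner_scaleC_left)
  also have "\<dots> = (\<Sum>j\<in>F. c j * cnj (c j))"
    by (intro sum.cong refl) (simp add: inner)
  also have "\<dots> = (\<Sum>j\<in>F. of_real ((cmod (c j))\<^sup>2))"
    by (simp only: complex_norm_square)
  also have "\<dots> = of_real (\<Sum>j\<in>F. (cmod (c j))\<^sup>2)"
    by (rule of_real_sum[symmetric])
  finally show ?thesis
    by (simp only: of_real_eq_iff)
qed

lemma bessel_inequality:
  assumes f: "orthonormal f" and F: "finite F"
  shows "(\<Sum>i\<in>F. (cmod (cinner x (f i)))\<^sup>2) \<le> (norm x)\<^sup>2"
proof -
  define z where "z = (\<Sum>i\<in>F. cinner x (f i) *\<^sub>C f i)"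
  have "cinner (x - z) (f j) = 0" if "j \<in> F" for j
    using f F that
    by (simp add: z_def cinner_diff_left cinner_sum_left cinner_scaleC_left orthonormal_def if_distrib[of "(*) _"] cong: if_cong)
  then have "cinner (f j) (x - z) = 0" if "j \<in> F" for j
    using that cinner_eq_0_commute by blast
  then have "cinner z (x - z) = 0"
    by (subst z_def) (simp add: cinner_sum_left cinner_scaleC_left)
  then have "inner z (x - z) = 0"
    by (simp add: inner_eq_Re_cinner)
  then have "(norm x)\<^sup>2 = (norm z)\<^sup>2 + (norm (x - z))\<^sup>2"
    by (simp add: power2_norm_eq_inner inner_diff_left inner_diff_right inner_commute)
  then show ?thesis
    using orthonormal_sum_norm[OF f F, of "\<lambda>i. cinner x (f i)"] by (simp add: z_def)
qed

lemma summable_bessel: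
  fixes f :: "nat \<Rightarrow> 'a::complex_inner"
  assumes "orthonormal f"
  shows "summable (\<lambda>i. (cmod (cinner x (f i)))\<^sup>2)"
  by (rule summableI_nonneg_bounded[of _ "(norm x)\<^sup>2"]) (simp_all add: bessel_inequality[OF assms])

text \<open>The bound on finite combinations is what orthonormal families (with
  \<open>C = 1\<close>) and families with square summable norms have in common. Unitaries, basis
  expansions and Hilbert-Schmidt operators are all built here, with Bessel's inequality controlling
  the coefficients.\<close>

lemma series_operator:
  fixes f k :: "nat \<Rightarrow> 'a::complex_hilbert_space"
  assumes f: "orthonormal f" and C: "C \<ge> 0"
    and bound: "\<And>c F. finite F \<Longrightarrow> norm (\<Sum>i\<in>F. c i *\<^sub>C k i) \<le> C * sqrt (\<Sum>i\<in>F. (cmod (c i))\<^sup>2)"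
  obtains A :: "'a \<Rightarrow>\<^sub>L 'a" where "complex_linear A" "norm A \<le> C"
    "\<forall>x. (\<lambda>i. cinner x (f i) *\<^sub>C k i) sums A x"
proof -
  have summ: "summable (\<lambda>i. cinner x (f i) *\<^sub>C k i)" for x
  proof (rule summable_Cauchy[THEN iffD2], intro allI impI)
    fix e :: real
    assume "e > 0"
    \<comment> \<open>Dividing by \<open>C + 1\<close> also covers \<open>C = 0\<close>.\<close>
    define e' where "e' = (e / (C + 1))\<^sup>2"
    have "e' > 0"
      using \<open>e > 0\<close> C by (simp add: e'_def)
    then obtain N where N: "\<And>m n. m \<ge> N \<Longrightarrow> norm (\<Sum>i=m..<n. (cmod (cinner x (f i)))\<^sup>2) < e'"
      using summable_bessel[OF f, of x] unfolding summable_Cauchy by blast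
    have "norm (\<Sum>i=m..<n. cinner x (f i) *\<^sub>C k i) < e" if "m \<ge> N" for m n
    proof -
      have "sqrt (\<Sum>i=m..<n. (cmod (cinner x (f i)))\<^sup>2) < sqrt e'"
        using N[OF that, of n] by simp
      also have "sqrt e' = e / (C + 1)"
        using \<open>e > 0\<close> C by (simp add: e'_def)
      finally have "(C + 1) * sqrt (\<Sum>i=m..<n. (cmod (cinner x (f i)))\<^sup>2) < e"
        using C by (simp add: field_simps)
      moreover have "norm (\<Sum>i=m..<n. cinner x (f i) *\<^sub>C k i) \<le> C * sqrt (\<Sum>i=m..<n. (cmod (cinner x (f i)))\<^sup>2)"
        by (rule bound) simp
      moreover have "0 \<le> sqrt (\<Sum>i=m..<n. (cmod (cinner x (f i)))\<^sup>2)"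
        by (simp add: sum_nonneg)
      ultimately show ?thesis
        unfolding distrib_right by linarith
    qed
    then show "\<exists>N. \<forall>m\<ge>N. \<forall>n. norm (\<Sum>i=m..<n. cinner x (f i) *\<^sub>C k i) < e"
      by blast
  qed
  define A where "A x = (\<Sum>i. cinner x (f i) *\<^sub>C k i)" for x
  have A: "(\<lambda>i. cinner x (f i) *\<^sub>C k i) sums A x" for x
    unfolding A_def by (rule summable_sums[OF summ])
  have AC: "A (c *\<^sub>C x) = c *\<^sub>C A x" for c x
    using bounded_linear.sums[OF bounded_linear_scaleC A, of c x] A[of "c *\<^sub>C x"] sums_unique2
    by (simp add: cinner_scaleC_left scaleC_scaleC)
  have norm_A: "norm (A x) \<le> C * norm x" for x
  proof -
    have "norm (\<Sum>i<n. cinner x (f i) *\<^sub>C k i) \<le> C * norm x" for n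
    proof -
      have "norm (\<Sum>i<n. cinner x (f i) *\<^sub>C k i) \<le> C * sqrt (\<Sum>i<n. (cmod (cinner x (f i)))\<^sup>2)"
        by (rule bound) simp
      also have "\<dots> \<le> C * norm x"
        using bessel_inequality[OF f, of "{..<n}" x] C by (intro mult_left_mono real_le_lsqrt) auto
      finally show ?thesis .
    qed
    moreover have "(\<lambda>n. norm (\<Sum>i<n. cinner x (f i) *\<^sub>C k i)) \<longlonglongrightarrow> norm (A x)"
      using A[of x] by (intro tendsto_norm) (simp add: sums_def)
    ultimately show ?thesis
      by (intro LIMSEQ_le_const2) auto
  qed
  have bl: "bounded_linear A"
  proof (rule bounded_linear_intro[where K = C])
    show "A (x + y) = A x + A y" for x y
      using sums_add[OF A[of x] A[of y]] A[of "x + y"] sums_unique2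
      by (simp add: cinner_add_left scaleC_add_left)
    show "A (r *\<^sub>R x) = r *\<^sub>R A x" for r x
      by (simp add: scaleR_eq_scaleC AC)
    show "norm (A x) \<le> norm x * C" for x
      using norm_A[of x] by (simp add: mult.commute)
  qed
  have app: "blinfun_apply (Blinfun A) = A"
    by (rule bounded_linear_Blinfun_apply[OF bl])
  show ?thesis
  proof (rule that[of "Blinfun A"])
    show "complex_linear (Blinfun A)"
      by (simp add: complex_linear_def app AC)
    show "\<forall>x. (\<lambda>i. cinner x (f i) *\<^sub>C k i) sums Blinfun A x"
      using A by (simp add: app)
    show "norm (Blinfun A) \<le> C"
      by (rule norm_blinfun_bound[OF C]) (simp add: app norm_A)
  qed
qed

lemma series_at_basis:
  assumes f: "orthonormal f" and A: "\<forall>x. (\<lambda>i. cinner x (f i) *\<^sub>C k i) sums A x"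
  shows "A (f m) = (k m :: 'a::complex_inner)"
proof -
  have "(\<lambda>i. cinner (f m) (f i) *\<^sub>C k i) = (\<lambda>i. if i = m then k m else 0)"
    using f by (auto simp: orthonormal_def fun_eq_iff scaleC_one)
  then have "(\<lambda>i. cinner (f m) (f i) *\<^sub>C k i) sums k m"
    using sums_single[of m k] by (auto simp: eq_commute cong: if_cong)
  then show ?thesis
    using A sums_unique2 by blast
qed

lemma cinner_series:
  assumes "(\<lambda>i. a i *\<^sub>C k i) sums (x :: 'a::complex_inner)"
  shows "(\<lambda>i. a i * cinner (k i) y) sums cinner x y"
  using bounded_linear.sums[OF bounded_linear_cinner_left[of y] assms] by (simp add: cinner_scaleC_left)

lemma cinner_series_orthonormal:
  assumes e: "orthonormal e" and x: "(\<lambda>i. a i *\<^sub>C e i) sums (x :: 'a::complex_inner)"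
  shows "cinner x (e j) = a j"
proof -
  have "(\<lambda>i. a i * cinner (e i) (e j)) = (\<lambda>i. if i = j then a j else 0)"
    using e by (auto simp: orthonormal_def fun_eq_iff)
  then have "(\<lambda>i. a i * cinner (e i) (e j)) sums a j"
    using sums_single[of j a] by (auto simp: eq_commute cong: if_cong)
  then show ?thesis
    using cinner_series[OF x, of "e j"] sums_unique2 by blast
qed

lemma orthonormal_series_bound:
  assumes "orthonormal f" "finite F"
  shows "norm (\<Sum>i\<in>F. c i *\<^sub>C f i) \<le> 1 * sqrt (\<Sum>i\<in>F. (cmod (c i))\<^sup>2)"
  using orthonormal_sum_norm[OF assms, of c, symmetric] by simp

lemma orthonormal_expansion:
  fixes f :: "nat \<Rightarrow> 'a::complex_hilbert_space"
  assumes f: "orthonormal f" "complete_family f"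
  shows "(\<lambda>i. cinner x (f i) *\<^sub>C f i) sums x"
proof -
  obtain A :: "'a \<Rightarrow>\<^sub>L 'a" where A: "\<forall>x. (\<lambda>i. cinner x (f i) *\<^sub>C f i) sums A x"
    by (rule series_operator[OF f(1) zero_le_one orthonormal_series_bound[OF f(1)]])
  have "cinner (A x - x) (f j) = 0" for j
    using cinner_series_orthonormal[OF f(1) A[rule_format, of x], of j] by (simp add: cinner_diff_left)
  then have "A x - x = 0"
    using f(2) unfolding complete_family_def by blast
  then show ?thesis
    using A[rule_format, of x] by simp
qed

text \<open>The series with the two bases exchanged is both the inverse and the adjoint.\<close>

lemma unitary_of_bases:
  fixes f g :: "nat \<Rightarrow> 'a::complex_hilbert_space"
  assumes f: "orthonormal f" "complete_family f" and g: "orthonormal g" "complete_family g"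
  obtains U where "unitary_operator U" "norm U \<le> 1" "\<And>n. U (f n) = g n"
    "\<exists>V. complex_linear V \<and> U o\<^sub>L V = id_blinfun \<and> V o\<^sub>L U = id_blinfun"
proof -
  obtain U :: "'a \<Rightarrow>\<^sub>L 'a" where U: "complex_linear U" "norm U \<le> 1"
    "\<forall>x. (\<lambda>i. cinner x (f i) *\<^sub>C g i) sums U x"
    by (rule series_operator[OF f(1) zero_le_one orthonormal_series_bound[OF g(1)]])
  obtain V :: "'a \<Rightarrow>\<^sub>L 'a" where V: "complex_linear V" "norm V \<le> 1"
    "\<forall>x. (\<lambda>i. cinner x (g i) *\<^sub>C f i) sums V x"
    by (rule series_operator[OF g(1) zero_le_one orthonormal_series_bound[OF f(1)]])
  have VU: "V (U x) = x" for x
  proof -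
    have "(\<lambda>i. cinner x (f i) *\<^sub>C f i) sums V (U x)"
      using V(3)[rule_format, of "U x"]
      by (simp add: cinner_series_orthonormal[OF g(1) U(3)[rule_format]])
    then show ?thesis
      using orthonormal_expansion[OF f] sums_unique2 by blast
  qed
  have UV: "U (V x) = x" for x
  proof -
    have "(\<lambda>i. cinner x (g i) *\<^sub>C g i) sums U (V x)"
      using U(3)[rule_format, of "V x"]
      by (simp add: cinner_series_orthonormal[OF f(1) V(3)[rule_format]])
    then show ?thesis
      using orthonormal_expansion[OF g] sums_unique2 by blast
  qed
  have adj: "cinner (U x) y = cinner x (V y)" for x y
  proof -
    have "(\<lambda>i. cnj (cinner y (g i) * cinner (f i) x)) sums cnj (cinner (V y) x)"
      using cinner_series[OF V(3)[rule_format, of y], of x] by (subst sums_cnj)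
    moreover have "cnj (cinner y (g i) * cinner (f i) x) = cinner x (f i) * cinner (g i) y" for i
      using cinner_commute[of y "g i"] cinner_commute[of "f i" x] by (simp add: mult.commute)
    moreover have "cnj (cinner (V y) x) = cinner x (V y)"
      using cinner_commute[of x "V y"] by simp
    ultimately show ?thesis
      using cinner_series[OF U(3)[rule_format, of x], of y] sums_unique2 by auto
  qed
  show ?thesis
  proof (rule that[of U])
    show "unitary_operator U"
      unfolding unitary_operator_def
    proof (intro conjI allI)
      show "cinner (U x) (U y) = cinner x y" for x y
        by (simp add: adj VU)
      show "surj (blinfun_apply U)"
        using UV by (metis surjI)
    qed (rule U(1))
    show "U (f n) = g n" for n
      by (rule series_at_basis[OF f(1) U(3)])
    show "\<exists>V. complex_linear V \<and> U o\<^sub>L V = id_blinfun \<and> V o\<^sub>L U = id_blinfun"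
      by (intro exI[of _ V] conjI blinfun_eqI) (simp_all add: V(1) UV VU)
  qed (rule U(2))
qed

section \<open>Hilbert-Schmidt perturbations of the identity\<close>

lemma hilbert_schmidt_bound:
  fixes k :: "'i \<Rightarrow> 'a::complex_inner"
  assumes "finite F"
  shows "norm (\<Sum>i\<in>F. c i *\<^sub>C k i) \<le> sqrt (\<Sum>i\<in>F. (norm (k i))\<^sup>2) * sqrt (\<Sum>i\<in>F. (cmod (c i))\<^sup>2)"
proof -
  have "norm (\<Sum>i\<in>F. c i *\<^sub>C k i) \<le> (\<Sum>i\<in>F. norm (c i *\<^sub>C k i))"
    by (rule norm_sum)
  also have "\<dots> = (\<Sum>i\<in>F. \<bar>norm (k i)\<bar> * \<bar>cmod (c i)\<bar>)"
    by (simp add: mult.commute)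
  also have "\<dots> \<le> L2_set (\<lambda>i. norm (k i)) F * L2_set (\<lambda>i. cmod (c i)) F"
    by (rule L2_set_mult_ineq)
  finally show ?thesis
    by (simp add: L2_set_def)
qed

text \<open>A finite-rank truncation of a series operator maps the unit ball into such a
  set.\<close>

lemma compact_bounded_combinations:
  fixes k :: "nat \<Rightarrow> 'a::complex_inner"
  shows "compact {\<Sum>i<n. c i *\<^sub>C k i |c. \<forall>i<n. cmod (c i) \<le> 1}"
proof (induction n)
  case (Suc n)
  let ?S = "{\<Sum>i<n. c i *\<^sub>C k i |c. \<forall>i<n. cmod (c i) \<le> 1}"
  have "{\<Sum>i<Suc n. c i *\<^sub>C k i |c. \<forall>i<Suc n. cmod (c i) \<le> 1}
      = (\<lambda>(s, a). s + a *\<^sub>C k n) ` (?S \<times> cball 0 1)" (is "?L = ?R")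
  proof
    show "?L \<subseteq> ?R"
    proof clarify
      fix c :: "nat \<Rightarrow> complex"
      assume c: "\<forall>i<Suc n. cmod (c i) \<le> 1"
      then have "(\<Sum>i<n. c i *\<^sub>C k i, c n) \<in> ?S \<times> cball 0 1"
        by auto
      then show "(\<Sum>i<Suc n. c i *\<^sub>C k i) \<in> ?R"
        by (intro image_eqI[of _ _ "(\<Sum>i<n. c i *\<^sub>C k i, c n)"]) simp_all
    qed
    show "?R \<subseteq> ?L"
    proof clarify
      fix a :: complex and c :: "nat \<Rightarrow> complex"
      assume a: "a \<in> cball 0 1" and c: "\<forall>i<n. cmod (c i) \<le> 1"
      have "(\<Sum>i<n. c i *\<^sub>C k i) + a *\<^sub>C k n = (\<Sum>i<Suc n. (c(n := a)) i *\<^sub>C k i)"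
        by simp
      moreover have "\<forall>i<Suc n. cmod ((c(n := a)) i) \<le> 1"
        using a c by (auto simp: less_Suc_eq)
      ultimately show "\<exists>c'. (\<Sum>i<n. c i *\<^sub>C k i) + a *\<^sub>C k n = (\<Sum>i<Suc n. c' i *\<^sub>C k i) \<and>
          (\<forall>i<Suc n. cmod (c' i) \<le> 1)"
        by blast
    qed
  qed
  moreover have "compact ?R"
  proof (intro compact_continuous_image compact_Times Suc.IH compact_cball)
    have "continuous_on A (\<lambda>a. a *\<^sub>C k n)" for A
      by (rule continuous_on_scaleC_left)
    then have "continuous_on UNIV (\<lambda>p. snd p *\<^sub>C k n)"
      using continuous_on_compose2[of UNIV "\<lambda>a. a *\<^sub>C k n" UNIV snd] by (simp add: continuous_on_snd)
    then show "continuous_on (?S \<times> cball 0 1) (\<lambda>(s, a). s + a *\<^sub>C k n)"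
      unfolding case_prod_beta
      by (intro continuous_intros) (rule continuous_on_subset, auto)
  qed
  ultimately show ?case
    by simp
qed simp

text \<open>By Cauchy-Schwarz the truncations converge uniformly on the unit ball, so its image is
  totally bounded.\<close>

lemma hilbert_schmidt_operator:
  fixes f k :: "nat \<Rightarrow> 'a::complex_hilbert_space"
  assumes f: "orthonormal f" and k: "summable (\<lambda>i. (norm (k i))\<^sup>2)"
  obtains A :: "'a \<Rightarrow>\<^sub>L 'a" where "compact_operator A" "norm A \<le> sqrt (\<Sum>i. (norm (k i))\<^sup>2)" "\<And>n. A (f n) = k n"
proof -
  define C where "C = sqrt (\<Sum>i. (norm (k i))\<^sup>2)"
  have C: "C \<ge> 0"
    by (simp add: C_def suminf_nonneg k)
  have "norm (\<Sum>i\<in>F. c i *\<^sub>C k i) \<le> C * sqrt (\<Sum>i\<in>F. (cmod (c i))\<^sup>2)" if "finite F" for F and c :: "nat \<Rightarrow> complex"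
  proof -
    have "sqrt (\<Sum>i\<in>F. (norm (k i))\<^sup>2) \<le> C"
      unfolding C_def using sum_le_suminf[OF k that] by simp
    then show ?thesis
      using hilbert_schmidt_bound[OF that, of c k] by (meson mult_right_mono order_trans real_sqrt_ge_zero sum_nonneg zero_le_power2)
  qed
  then obtain A :: "'a \<Rightarrow>\<^sub>L 'a" where A: "complex_linear A" "norm A \<le> C"
    "\<forall>x. (\<lambda>i. cinner x (f i) *\<^sub>C k i) sums A x"
    by (rule series_operator[OF f C])
  have tail: "norm (A x - (\<Sum>i<n. cinner x (f i) *\<^sub>C k i)) \<le> sqrt (\<Sum>i. (norm (k (i + n)))\<^sup>2) * norm x" for x n
  proof -
    let ?t = "sqrt (\<Sum>i. (norm (k (i + n)))\<^sup>2)"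
    have k': "summable (\<lambda>i. (norm (k (i + n)))\<^sup>2)"
      using k by (rule summable_ignore_initial_segment)
    have "(\<lambda>i. cinner x (f (i + n)) *\<^sub>C k (i + n)) sums (A x - (\<Sum>i<n. cinner x (f i) *\<^sub>C k i))"
      using A(3)[rule_format, of x]
        sums_iff_shift[of "\<lambda>i. cinner x (f i) *\<^sub>C k i" n "A x - (\<Sum>i<n. cinner x (f i) *\<^sub>C k i)"]
      by simp
    then have "(\<lambda>m. norm (\<Sum>i<m. cinner x (f (i + n)) *\<^sub>C k (i + n)))
        \<longlonglongrightarrow> norm (A x - (\<Sum>i<n. cinner x (f i) *\<^sub>C k i))"
      by (intro tendsto_norm) (simp add: sums_def)
    moreover have "norm (\<Sum>i<m. cinner x (f (i + n)) *\<^sub>C k (i + n)) \<le> ?t * norm x" for m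
    proof -
      have f': "orthonormal (\<lambda>i. f (i + n))"
        using f by (simp add: orthonormal_def)
      have "norm (\<Sum>i<m. cinner x (f (i + n)) *\<^sub>C k (i + n))
          \<le> sqrt (\<Sum>i<m. (norm (k (i + n)))\<^sup>2) * sqrt (\<Sum>i<m. (cmod (cinner x (f (i + n))))\<^sup>2)"
        by (rule hilbert_schmidt_bound) simp
      also have "\<dots> \<le> ?t * norm x"
      proof (rule mult_mono)
        show "sqrt (\<Sum>i<m. (norm (k (i + n)))\<^sup>2) \<le> ?t"
          using sum_le_suminf[OF k', of "{..<m}"] by simp
        show "sqrt (\<Sum>i<m. (cmod (cinner x (f (i + n))))\<^sup>2) \<le> norm x"
          using bessel_inequality[OF f', of "{..<m}" x] by (intro real_le_lsqrt) auto
      qed (simp_all add: suminf_nonneg k' sum_nonneg)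
      finally show ?thesis .
    qed
    ultimately show ?thesis
      by (intro LIMSEQ_le_const2) auto
  qed
  have "compact (closure (A ` cball 0 1))"
    unfolding compact_eq_totally_bounded
  proof (intro conjI allI impI)
    show "complete (closure (A ` cball 0 1))"
      by (simp add: complete_eq_closed)
    fix e :: real
    assume "e > 0"
    then have "(e / 3)\<^sup>2 > 0"
      by simp
    then obtain n where n: "norm (\<Sum>i. (norm (k (i + n)))\<^sup>2) < (e / 3)\<^sup>2"
      using suminf_exist_split[OF _ k] by blast
    have t: "sqrt (\<Sum>i. (norm (k (i + n)))\<^sup>2) < e / 3"
      using n \<open>e > 0\<close> by (intro real_less_lsqrt) auto
    let ?Q = "{\<Sum>i<n. c i *\<^sub>C k i |c. \<forall>i<n. cmod (c i) \<le> 1}"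
    have "e / 3 > 0"
      using \<open>e > 0\<close> by simp
    then obtain X where X: "finite X" "?Q \<subseteq> (\<Union>x\<in>X. ball x (e / 3))"
      using compact_bounded_combinations[of k n, unfolded compact_eq_totally_bounded, THEN conjunct2]
      by blast
    \<comment> \<open>One third of \<open>e\<close> pays for the net of the truncation, one third
      for the tail. Finitely many closed balls still cover the closure, and the last third makes
      room for open balls of radius \<open>e\<close>.\<close>
    have "A ` cball 0 1 \<subseteq> (\<Union>x\<in>X. cball x (2 * (e / 3)))"
    proof
      fix z
      assume "z \<in> A ` cball 0 1"
      then obtain x where x: "norm x \<le> 1" "z = A x"
        by auto
      have "cmod (cinner x (f i)) \<le> 1" for i
      proof -
        have "(cmod (cinner x (f i)))\<^sup>2 \<le> (norm x)\<^sup>2"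
          using bessel_inequality[OF f, of "{i}" x] by simp
        then have "cmod (cinner x (f i)) \<le> norm x"
          using power2_le_imp_le norm_ge_zero by blast
        with x(1) show ?thesis
          by linarith
      qed
      then have "(\<Sum>i<n. cinner x (f i) *\<^sub>C k i) \<in> ?Q"
        by (intro CollectI exI[of _ "\<lambda>i. cinner x (f i)"]) simp
      then obtain y where y: "y \<in> X" "dist y (\<Sum>i<n. cinner x (f i) *\<^sub>C k i) < e / 3"
        using X(2) by auto
      have "dist (\<Sum>i<n. cinner x (f i) *\<^sub>C k i) z \<le> e / 3"
      proof -
        have "norm (z - (\<Sum>i<n. cinner x (f i) *\<^sub>C k i)) \<le> sqrt (\<Sum>i. (norm (k (i + n)))\<^sup>2) * norm x"
          unfolding x(2) by (rule tail)
        also have "\<dots> \<le> (e / 3) * 1"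
          using t x(1) \<open>e > 0\<close> by (intro mult_mono) auto
        finally show ?thesis
          by (simp add: dist_norm norm_minus_commute)
      qed
      with y have "dist y z \<le> 2 * (e / 3)"
        using dist_triangle[of y z "\<Sum>i<n. cinner x (f i) *\<^sub>C k i"] by linarith
      with y(1) show "z \<in> (\<Union>x\<in>X. cball x (2 * (e / 3)))"
        by auto
    qed
    then have "closure (A ` cball 0 1) \<subseteq> (\<Union>x\<in>X. cball x (2 * (e / 3)))"
      using X(1) by (intro closure_minimal closed_UN) auto
    also have "\<dots> \<subseteq> (\<Union>x\<in>X. ball x e)"
      using \<open>e > 0\<close> by (intro UN_mono) auto
    finally show "\<exists>X. finite X \<and> closure (A ` cball 0 1) \<subseteq> (\<Union>x\<in>X. ball x e)"
      using X(1) by blast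
  qed
  then have "compact_operator A"
    using A(1) by (simp add: compact_operator_def)
  then show ?thesis
    using A(2) series_at_basis[OF f A(3)] that unfolding C_def by blast
qed

lemma compact_operator_compose_left:
  assumes K: "compact_operator K" and A: "complex_linear A"
  shows "compact_operator (A o\<^sub>L K)"
proof -
  let ?C = "closure (K ` cball 0 1)"
  have "continuous_on UNIV (blinfun_apply A)"
    by (intro linear_continuous_on blinfun.bounded_linear_right)
  then have AC: "compact (A ` ?C)"
    using K by (auto simp: compact_operator_def intro: compact_continuous_image continuous_on_subset)
  have "(A o\<^sub>L K) ` cball 0 1 \<subseteq> A ` ?C"
    using closure_subset by fastforce
  then have "closure ((A o\<^sub>L K) ` cball 0 1) \<subseteq> A ` ?C"
    by (rule closure_minimal) (rule compact_imp_closed[OF AC])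
  then have "A ` ?C \<inter> closure ((A o\<^sub>L K) ` cball 0 1) = closure ((A o\<^sub>L K) ` cball 0 1)"
    by blast
  then have "compact (closure ((A o\<^sub>L K) ` cball 0 1))"
    using compact_Int_closed[OF AC closed_closure] by metis
  then show ?thesis
    using K A by (simp add: compact_operator_def complex_linear_def)
qed

text \<open>The equation x + K x = y is solved as a fixed point of the contraction taking x to y - K
  x; uniqueness of the fixed point makes the solution linear in y.\<close>

lemma neumann_inverse:
  fixes K :: "'a::complex_hilbert_space \<Rightarrow>\<^sub>L 'a"
  assumes K: "complex_linear K" and c: "norm K \<le> c" "c < 1"
  obtains G :: "'a \<Rightarrow>\<^sub>L 'a" where "complex_linear G" "norm G \<le> 1 / (1 - c)"
    "\<And>x. G x + K (G x) = x" "\<And>x. G (x + K x) = x"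
proof -
  have "0 \<le> c"
    using c(1) norm_ge_zero order_trans by blast
  have Kle: "norm (K x) \<le> c * norm x" for x
    using norm_blinfun[of K x] c(1) by (meson mult_right_mono norm_ge_zero order_trans)
  have "\<exists>!x. y - K x = x" for y
  proof (rule banach_fix_type[OF \<open>0 \<le> c\<close> c(2)], intro allI)
    show "dist (y - K u) (y - K v) \<le> c * dist u v" for u v
      using Kle[of "v - u"] by (simp add: dist_norm blinfun.diff_right norm_minus_commute)
  qed
  then obtain G where G: "\<And>y. y - K (G y) = G y" and uniq: "\<And>y x. y - K x = x \<Longrightarrow> x = G y"
    by metis
  have GR: "G (x + K x) = x" for x
    by (rule uniq[symmetric]) simp
  have RG: "G x + K (G x) = x" for x
    using G[of x] by (metis diff_add_cancel)
  have GC: "G (a *\<^sub>C x) = a *\<^sub>C G x" for a x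
    using K by (intro uniq[symmetric])
      (simp add: complex_linear_def complex_vector.scale_right_diff_distrib[symmetric] G)
  have Gnorm: "norm (G x) \<le> (1 / (1 - c)) * norm x" for x
  proof -
    have "norm (G x) \<le> norm x + norm (K (G x))"
      using norm_triangle_ineq4[of x "K (G x)"] by (simp add: G)
    then have "(1 - c) * norm (G x) \<le> norm x"
      using Kle[of "G x"] by (simp add: algebra_simps)
    then show ?thesis
      using c(2) by (simp add: field_simps)
  qed
  have bl: "bounded_linear G"
  proof (rule bounded_linear_intro[where K = "1 / (1 - c)"])
    show "G (x + y) = G x + G y" for x y
      by (rule uniq[symmetric]) (use G[of x] G[of y] in \<open>simp add: blinfun.add_right algebra_simps\<close>)
    show "G (r *\<^sub>R x) = r *\<^sub>R G x" for r x
      by (simp add: scaleR_eq_scaleC GC)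
    show "norm (G x) \<le> norm x * (1 / (1 - c))" for x
      using Gnorm[of x] by (simp add: mult.commute)
  qed
  have app: "blinfun_apply (Blinfun G) = G"
    by (rule bounded_linear_Blinfun_apply[OF bl])
  show ?thesis
  proof (rule that[of "Blinfun G"])
    show "complex_linear (Blinfun G)"
      by (simp add: complex_linear_def app GC)
    show "norm (Blinfun G) \<le> 1 / (1 - c)"
      using Gnorm c(2) by (intro norm_blinfun_bound) (simp_all add: app)
  qed (simp_all add: app RG GR)
qed

text \<open>Let 1 + K0 map \<open>f n\<close> to \<open>T (e n) /\<^sub>R w n\<close>. Its inverse
  \<open>G\<close> maps \<open>T (e n)\<close> to \<open>w n *\<^sub>R f n\<close>, and
  \<open>U\<close> carries \<open>f n\<close> on to \<open>e (\<pi> n)\<close>. Hence U + K is to be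
  U G, that is K = - U G K0, whose norm is at most c/(1 - c).\<close>

lemma realize_on_basis:
  fixes T :: "'a::complex_hilbert_space \<Rightarrow>\<^sub>L 'a"
  assumes T: "complex_linear T" "closure (range (blinfun_apply T)) = UNIV"
    and e: "orthonormal e" "complete_family e" and f: "orthonormal (f :: nat \<Rightarrow> 'a)"
    and w: "\<And>n. w n > 0" and \<pi>: "bij \<pi>"
    and k: "summable (\<lambda>n. (norm (T (e n) /\<^sub>R w n - f n))\<^sup>2)"
      "sqrt (\<Sum>n. (norm (T (e n) /\<^sub>R w n - f n))\<^sup>2) \<le> c"
    and c: "c < 1" "c / (1 - c) < \<epsilon>"
  obtains U K :: "'a \<Rightarrow>\<^sub>L 'a" where "unitary_operator U" "compact_operator K" "norm K < \<epsilon>"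
    "invertible_operator (U + K)" "\<And>n. (U + K) (T (e n)) = w n *\<^sub>R e (\<pi> n)"
proof -
  obtain K0 :: "'a \<Rightarrow>\<^sub>L 'a" where K0: "compact_operator K0"
      "norm K0 \<le> sqrt (\<Sum>n. (norm (T (e n) /\<^sub>R w n - f n))\<^sup>2)" "\<And>n. K0 (f n) = T (e n) /\<^sub>R w n - f n"
    using hilbert_schmidt_operator[OF f k(1)] by blast
  have K0c: "complex_linear K0" "norm K0 \<le> c"
    using K0(1,2) k(2) by (auto simp: compact_operator_def)
  obtain G :: "'a \<Rightarrow>\<^sub>L 'a" where G: "complex_linear G" "norm G \<le> 1 / (1 - c)"
    "\<And>x. G x + K0 (G x) = x" "\<And>x. G (x + K0 x) = x"
    using neumann_inverse[OF K0c c(1)] by blast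
  have GT: "G (T (e n)) = w n *\<^sub>R f n" for n
  proof -
    have "T (e n) = w n *\<^sub>R (f n + K0 (f n))"
      using w[of n] by (simp add: K0(3))
    then show ?thesis
      by (simp add: blinfun.scaleR_right G(4))
  qed
  \<comment> \<open>The dense range of \<open>T\<close> enters here: a vector orthogonal to all
    \<open>f n\<close> is orthogonal to all \<open>G (T (e n))\<close>, hence to \<open>G\<close> of
    the range of \<open>T\<close>, and by continuity to the range of \<open>G\<close>, which is the
    whole space.\<close>
  have cf: "complete_family f"
    unfolding complete_family_def
  proof (intro allI impI)
    fix y
    assume y: "\<forall>i. cinner y (f i) = 0"
    obtain G' where adjG: "\<And>x y. inner (blinfun_apply G x) y = inner x (blinfun_apply G' y)"
      using adjoint_exists[of G] by blast
    obtain T' where adjT: "\<And>x y. inner (blinfun_apply T x) y = inner x (blinfun_apply T' y)"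
      using adjoint_exists[of T] by blast
    have cG: "cinner (G x) y = cinner x (G' y)" for x y
      by (rule complex_linear_adjoint(2)[OF adjG G(1)])
    have cT: "cinner (T x) y = cinner x (T' y)" for x y
      by (rule complex_linear_adjoint(2)[OF adjT T(1)])
    have "cinner (e n) (T' (G' y)) = 0" for n
    proof -
      have "cinner (f n) y = 0"
        using y cinner_eq_0_commute by blast
      then show ?thesis
        unfolding cT[symmetric] cG[symmetric] GT by (simp add: cinner_scaleR_left)
    qed
    then have "T' (G' y) = 0"
      using e(2) cinner_eq_0_commute unfolding complete_family_def by blast
    then have "cinner (T x) (G' y) = 0" for x
      by (simp add: cT)
    moreover have "closed {z. cinner z (G' y) = 0}"
      by (intro closed_Collect_eq linear_continuous_on bounded_linear_cinner_left continuous_on_const)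
    ultimately have "closure (range T) \<subseteq> {z. cinner z (G' y) = 0}"
      by (intro closure_minimal) auto
    then have "cinner (G z) y = 0" for z
      using T(2) by (auto simp: cG)
    from this[of "y + K0 y"] show "y = 0"
      by (simp add: G(4) cinner_self)
  qed
  have e': "orthonormal (\<lambda>n. e (\<pi> n))" "complete_family (\<lambda>n. e (\<pi> n))"
  proof -
    show "orthonormal (\<lambda>n. e (\<pi> n))"
      using e(1) bij_is_inj[OF \<pi>] by (auto simp: orthonormal_def inj_eq)
    show "complete_family (\<lambda>n. e (\<pi> n))"
      using e(2) bij_is_surj[OF \<pi>] unfolding complete_family_def by (metis surjD)
  qed
  obtain U :: "'a \<Rightarrow>\<^sub>L 'a" where U: "unitary_operator U" "norm U \<le> 1" "\<And>n. U (f n) = e (\<pi> n)"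
    "\<exists>V. complex_linear V \<and> U o\<^sub>L V = id_blinfun \<and> V o\<^sub>L U = id_blinfun"
    using unitary_of_bases[OF f cf e'] by metis
  obtain V where V: "complex_linear V" "U o\<^sub>L V = id_blinfun" "V o\<^sub>L U = id_blinfun"
    using U(4) by blast
  have UV: "U (V x) = x" and VU: "V (U x) = x" for x
    using V(2,3) by (metis blinfun_apply_blinfun_compose blinfun_apply_id_blinfun)+
  have Uc: "complex_linear U"
    using U(1) by (simp add: unitary_operator_def)
  define K where "K = (- (U o\<^sub>L G)) o\<^sub>L K0"
  have UK: "(U + K) x = U (G x)" for x
  proof -
    have "x = G x + G (K0 x)"
      using G(4)[of x] by (simp add: blinfun.add_right)
    then have "U x = U (G x) + U (G (K0 x))"
      by (metis blinfun.add_right)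
    then show ?thesis
      by (simp add: K_def blinfun.add_left blinfun.minus_left)
  qed
  show ?thesis
  proof (rule that[of U K])
    show "unitary_operator U"
      by (rule U(1))
    have "complex_linear (- (U o\<^sub>L G))"
      using Uc G(1) by (simp add: complex_linear_def blinfun.minus_left complex_vector.scale_minus_right)
    then show "compact_operator K"
      unfolding K_def by (rule compact_operator_compose_left[OF K0(1)])
    have "norm K \<le> norm (- (U o\<^sub>L G)) * norm K0"
      unfolding K_def by (rule norm_blinfun_compose)
    also have "\<dots> \<le> (1 * (1 / (1 - c))) * c"
    proof (rule mult_mono)
      have "norm (U o\<^sub>L G) \<le> norm U * norm G"
        by (rule norm_blinfun_compose)
      also have "\<dots> \<le> 1 * (1 / (1 - c))"
        using U(2) G(2) by (intro mult_mono) auto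
      finally show "norm (- (U o\<^sub>L G)) \<le> 1 * (1 / (1 - c))"
        by simp
    qed (use K0c c in auto)
    also have "\<dots> < \<epsilon>"
      using c(2) by simp
    finally show "norm K < \<epsilon>" .
    show "(U + K) (T (e n)) = w n *\<^sub>R e (\<pi> n)" for n
      unfolding UK GT by (simp add: blinfun.scaleR_right U(3))
    show "invertible_operator (U + K)"
      unfolding invertible_operator_def
    proof (intro conjI exI[of _ "(id_blinfun + K0) o\<^sub>L V"])
      show "complex_linear (U + K)"
        using Uc G(1) by (simp add: complex_linear_def UK)
      show "complex_linear ((id_blinfun + K0) o\<^sub>L V)"
        using V(1) K0c(1) by (simp add: complex_linear_def blinfun.add_left scaleC_add_right)
      show "(U + K) o\<^sub>L ((id_blinfun + K0) o\<^sub>L V) = id_blinfun"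
        by (rule blinfun_eqI) (simp add: UK blinfun.add_left[of id_blinfun] G(4) UV)
      show "((id_blinfun + K0) o\<^sub>L V) o\<^sub>L (U + K) = id_blinfun"
        by (rule blinfun_eqI) (simp add: UK VU blinfun.add_left[of id_blinfun] G(3))
    qed
  qed
qed

section \<open>Bilateral weighted shifts\<close>

text \<open>All terms of Parseval's sum are 0; projecting \<open>u\<close> onto the vectors
  orthogonal to those \<open>z j\<close> at which \<open>y\<close> has coordinate 0 avoids summation
  over a general index type. It is applied to a column of a matrix and a column of its adjoint: the
  corresponding entry of a product vanishes when their supports are disjoint.\<close>

lemma cinner_vanish:
  fixes z :: "'i \<Rightarrow> 'a::complex_hilbert_space"
  assumes z: "orthonormal z" "complete_family z"
    and disj: "\<And>j. cinner y (z j) = 0 \<or> cinner u (z j) = 0"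
  shows "cinner y u = 0"
proof -
  define V where "V = {x. \<forall>f\<in>{z j |j. cinner y (z j) = 0}. cinner x f = 0}"
  have V: "complex_subspace V" "closed V"
    unfolding V_def by (rule closed_complex_subspace_orth)+
  have subV: "subspace V"
    using V by (simp add: complex_subspace_def)
  define u' where "u' = orth_projection V u"
  have u'V: "u' \<in> V"
    unfolding u'_def by (rule orth_projection_in[OF subV V(2)])
  have u': "cinner (u - u') v = 0" if "v \<in> V" for v
    unfolding u'_def by (rule cinner_diff_orth_projection[OF V that])
  have "cinner u' (z j) = 0" for j
  proof (cases "cinner y (z j) = 0")
    case True
    then show ?thesis
      using u'V by (auto simp: V_def)
  next
    case False
    then have "z j \<in> V"
      using z(1) by (auto simp: V_def orthonormal_def)
    then show ?thesis
      using u' disj[of j] False by (force simp: cinner_diff_left)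
  qed
  then have "u' = 0"
    using z(2) unfolding complete_family_def by blast
  moreover have "y \<in> V"
    by (auto simp: V_def)
  ultimately have "cinner u y = 0"
    using u' by force
  then show ?thesis
    using cinner_eq_0_commute by blast
qed

lemma cinner_single:
  fixes z :: "'i \<Rightarrow> 'a::complex_hilbert_space"
  assumes z: "orthonormal z" "complete_family z"
    and disj: "\<And>j. j \<noteq> n \<Longrightarrow> cinner y (z j) = 0 \<or> cinner u (z j) = 0"
  shows "cinner y u = cinner y (z n) * cinner (z n) u"
proof -
  have "cinner (y - cinner y (z n) *\<^sub>C z n) u = 0"
  proof (rule cinner_vanish[OF z])
    fix j
    show "cinner (y - cinner y (z n) *\<^sub>C z n) (z j) = 0 \<or> cinner u (z j) = 0"
      using disj[of j] z(1) by (cases "j = n") (auto simp: cinner_diff_left cinner_scaleC_left orthonormal_def)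
  qed
  then show ?thesis
    by (simp add: cinner_diff_left cinner_scaleC_left)
qed

lemma complete_family_eqI:
  assumes "complete_family z" "\<And>j. cinner x (z j) = cinner y (z j)"
  shows "x = y"
proof -
  have "cinner (x - y) (z j) = 0" for j
    by (simp add: cinner_diff_left assms(2))
  then have "x - y = 0"
    using assms(1) unfolding complete_family_def by blast
  then show ?thesis
    by simp
qed

lemma int_step_constant:
  assumes "\<And>n::int. f (n + 1) = f n"
  shows "f m = f n"
proof -
  have nat: "f (n + int k) = f n" for n k
  proof (induction k)
    case (Suc k)
    then show ?case
      using assms[of "n + int k"] by (simp add: ac_simps)
  qed simp
  show ?thesis
  proof (cases "n \<le> m")
    case True
    then show ?thesis
      using nat[of n "nat (m - n)"] by simp
  next
    case False
    then show ?thesis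
      using nat[of m "nat (n - m)"] by simp
  qed
qed

locale weighted_shift =
  fixes z :: "int \<Rightarrow> 'a::complex_hilbert_space" and w :: "int \<Rightarrow> real" and A :: "'a \<Rightarrow>\<^sub>L 'a"
  assumes z: "orthonormal z" "complete_family z" and w: "\<And>n. w n > 0"
    and A: "complex_linear A" "\<And>n. A (z n) = w n *\<^sub>R z (n + 1)"
begin

text \<open>The adjoint of \<open>A\<close> is the backward weighted shift.\<close>

lemma shift_coordinate: "cinner (A x) (z (n + 1)) = of_real (w n) * cinner x (z n)"
proof -
  obtain A' where adj: "\<And>x y. inner (blinfun_apply A x) y = inner x (blinfun_apply A' y)"
    using adjoint_exists[of A] by blast
  have cadj: "cinner (A x) y = cinner x (A' y)" for x y
    by (rule complex_linear_adjoint(2)[OF adj A(1)])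
  have "A' (z (n + 1)) = w n *\<^sub>R z n"
  proof (rule complete_family_eqI[OF z(2)])
    fix m
    have "cinner (A' (z (n + 1))) (z m) = cnj (cinner (A (z m)) (z (n + 1)))"
      unfolding cadj by (rule cinner_commute)
    also have "\<dots> = cinner (w n *\<^sub>R z n) (z m)"
      using z(1) by (auto simp: A(2) cinner_scaleR_left orthonormal_def)
    finally show "cinner (A' (z (n + 1))) (z m) = cinner (w n *\<^sub>R z n) (z m)" .
  qed
  then show ?thesis
    by (simp add: cadj cinner_scaleR_right)
qed

lemma zero_operatorI:
  assumes P: "complex_linear P" "\<And>n m. cinner (P (z n)) (z m) = 0"
  shows "P = 0"
proof (rule blinfun_eqI)
  fix x
  obtain P' where adj: "\<And>x y. inner (blinfun_apply P x) y = inner x (blinfun_apply P' y)"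
    using adjoint_exists[of P] by blast
  have cadj: "cinner (P x) y = cinner x (P' y)" for x y
    by (rule complex_linear_adjoint(2)[OF adj P(1)])
  have "cinner (P x) (z m) = 0" for m
  proof -
    have "P' (z m) = 0"
    proof (rule complete_family_eqI[OF z(2)])
      show "cinner (P' (z m)) (z n) = cinner 0 (z n)" for n
        using P(2)[of n m] cinner_eq_0_commute by (simp add: cadj) blast
    qed
    then show ?thesis
      by (simp add: cadj)
  qed
  then show "P x = blinfun_apply 0 x"
    using z(2) by (simp add: complete_family_def)
qed

lemma complement_idempotent:
  assumes "complex_linear P" "P o\<^sub>L P = P" "P o\<^sub>L A = A o\<^sub>L P"
  defines "Q \<equiv> id_blinfun - P"
  shows "complex_linear Q" "Q o\<^sub>L Q = Q" "Q o\<^sub>L A = A o\<^sub>L Q"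
proof -
  have PP: "P (P x) = P x" and PA: "P (A x) = A (P x)" for x
    using assms(2,3) by (metis blinfun_apply_blinfun_compose)+
  show "complex_linear Q"
    using assms(1) by (simp add: Q_def complex_linear_def blinfun.diff_left complex_vector.scale_right_diff_distrib)
  show "Q o\<^sub>L Q = Q" "Q o\<^sub>L A = A o\<^sub>L Q"
    by (rule blinfun_eqI, simp add: Q_def blinfun.diff_left blinfun.diff_right PP PA)+
qed

lemma entry_step:
  assumes "P o\<^sub>L A = A o\<^sub>L P"
  shows "of_real (w n) * cinner (P (z (n + 1))) (z (m + 1)) = of_real (w m) * cinner (P (z n)) (z m)"
proof -
  have "P (A (z n)) = A (P (z n))"
    using assms by (metis blinfun_apply_blinfun_compose)
  then have "cinner (w n *\<^sub>R P (z (n + 1))) (z (m + 1)) = cinner (A (P (z n))) (z (m + 1))"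
    by (simp add: A(2) blinfun.scaleR_right)
  then show ?thesis
    by (simp add: shift_coordinate cinner_scaleR_left)
qed

text \<open>Along the \<open>k\<close>-th superdiagonal the entries are inversely proportional to the products of
  \<open>k\<close> consecutive weights, which are not bounded away from \<open>0\<close>.\<close>

lemma commutant_lower_triangular:
  assumes wM: "\<And>n. w n \<le> M" and small: "\<And>\<epsilon>. \<epsilon> > 0 \<Longrightarrow> \<exists>n. w n < \<epsilon>"
    and PA: "P o\<^sub>L A = A o\<^sub>L P" and "m < n"
  shows "cinner (P (z n)) (z m) = 0"
proof -
  define k where "k = nat (n - m)"
  have k: "m = n - int k" "k \<ge> 1"
    using \<open>m < n\<close> by (auto simp: k_def)
  define W where "W n = (\<Prod>j<k. w (n - int k + int j))" for n
  have Wpos: "W n > 0" for n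
    by (simp add: W_def prod_pos w)
  have W_step: "W (n + 1) * w (n - int k) = W n * w n" for n
  proof -
    have "W (n + 1) * w (n - int k) = (\<Prod>j<Suc k. w (n - int k + int j))"
      by (subst prod.lessThan_Suc_shift) (simp add: W_def algebra_simps)
    also have "\<dots> = W n * w n"
      by (simp add: W_def)
    finally show ?thesis .
  qed
  define F where "F n = cinner (P (z n)) (z (n - int k)) * of_real (W n)" for n
  have "F (n + 1) = F n" for n
  proof -
    let ?p = "cinner (P (z (n + 1))) (z (n + 1 - int k))" and ?q = "cinner (P (z n)) (z (n - int k))"
    have eq: "n - int k + 1 = n + 1 - int k"
      by simp
    have "of_real (w n) * ?p = of_real (w (n - int k)) * ?q"
      using entry_step[OF PA, of n "n - int k"] unfolding eq .
    then have "of_real (w n) * ?p * of_real (W (n + 1)) = of_real (W (n + 1) * w (n - int k)) * ?q"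
      by (simp add: mult_ac)
    also have "\<dots> = of_real (w n) * (?q * of_real (W n))"
      by (simp only: W_step) (simp add: mult_ac)
    finally show ?thesis
      using w[of n] by (simp add: F_def)
  qed
  then have F: "F n = F m" for m
    by (rule int_step_constant)
  have Mpos: "M > 0"
    using w[of 0] wM[of 0] by linarith
  have "cmod (F n) \<le> norm P * (\<epsilon> * M ^ (k - 1))" if eps: "\<epsilon> > 0" for \<epsilon>
  proof -
    obtain i where i: "w i < \<epsilon>"
      using small[OF eps] by blast
    \<comment> \<open>With this offset \<open>w i\<close> is the last of the \<open>k\<close>
      factors of \<open>W m\<close>; the other factors are bounded by \<open>M\<close>.\<close>
    define m where "m = i + 1"
    have "W m = (\<Prod>j<Suc (k - 1). w (m - int k + int j))"
      using k(2) by (simp add: W_def)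
    also have "\<dots> = (\<Prod>j<k - 1. w (m - int k + int j)) * w i"
      using k(2) by (subst prod.lessThan_Suc) (simp add: m_def of_nat_diff)
    also have "\<dots> \<le> (\<Prod>j<k - 1. M) * \<epsilon>"
      using i w wM Mpos less_imp_le by (intro mult_mono prod_mono) (auto intro: prod_nonneg simp: less_imp_le)
    finally have W: "W m \<le> \<epsilon> * M ^ (k - 1)"
      by (simp add: mult.commute)
    have unit: "norm (z j) = 1" for j
      using z(1) by (rule orthonormal_norm)
    have "cmod (cinner (P (z m)) (z (m - int k))) \<le> norm (P (z m)) * norm (z (m - int k))"
      by (rule cinner_le_norm)
    also have "\<dots> \<le> norm P"
      using norm_blinfun[of P "z m"] by (simp add: unit)
    finally have "cmod (F m) \<le> norm P * W m"
      using Wpos[of m] by (simp add: F_def norm_mult mult_right_mono)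
    also have "\<dots> \<le> norm P * (\<epsilon> * M ^ (k - 1))"
      using W by (intro mult_left_mono) auto
    finally show ?thesis
      by (simp only: F[of m])
  qed
  then have bound: "cmod (F n) \<le> \<epsilon> * (norm P * M ^ (k - 1))" if "\<epsilon> > 0" for \<epsilon>
    using that by (simp add: mult_ac)
  have "cmod (F n) \<le> 0"
  proof (rule field_le_epsilon)
    fix e :: real
    assume "e > 0"
    let ?D = "norm P * M ^ (k - 1) + 1"
    have D: "?D > 0"
      using Mpos by (simp add: add_nonneg_pos)
    have "cmod (F n) \<le> (e / ?D) * (norm P * M ^ (k - 1))"
      using D \<open>e > 0\<close> by (intro bound) simp
    also have "\<dots> \<le> (e / ?D) * ?D"
      using D \<open>e > 0\<close> by (intro mult_left_mono) auto
    also have "\<dots> = e"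
      using D by simp
    finally show "cmod (F n) \<le> 0 + e"
      by simp
  qed
  then show ?thesis
    using Wpos[of n] by (simp add: F_def k(1))
qed

text \<open>For a triangular matrix the diagonal of the square is the square of the diagonal, and
  commuting with \<open>A\<close> makes the diagonal constant. Suppose the diagonals 0, ..., k - 1
  vanish with k > 0. A nonzero term in the entry of P P from \<open>n\<close> to
  \<open>n + k\<close> would pass through some \<open>j\<close> with both j >= n + k and j <= n, so
  diagonal k of P = P P vanishes as well.\<close>

lemma idempotent_zero_diagonal:
  assumes tri: "\<And>m n. m < n \<Longrightarrow> cinner (blinfun_apply P (z n)) (z m) = 0"
    and P: "complex_linear P" "P o\<^sub>L P = P" "P o\<^sub>L A = A o\<^sub>L P"
  shows "cinner (P (z 0)) (z 0) \<in> {0, 1}"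
    and "cinner (P (z 0)) (z 0) = 0 \<Longrightarrow> P = 0"
proof -
  obtain P' where adj: "\<And>x y. inner (blinfun_apply P x) y = inner x (blinfun_apply P' y)"
    using adjoint_exists[of P] by blast
  have cadj: "cinner (P x) y = cinner x (P' y)" for x y
    by (rule complex_linear_adjoint(2)[OF adj P(1)])
  have PP: "P (P x) = P x" for x
    using P(2) by (metis blinfun_apply_blinfun_compose)
  have P'0: "cinner (P' (z m)) (z j) = 0 \<longleftrightarrow> cinner (P (z j)) (z m) = 0" for m j
    unfolding cadj by (rule cinner_eq_0_commute)
  have sq: "cinner (P (z n)) (z m) = cinner (P (z n)) (P' (z m))" for n m
    by (simp add: cadj[symmetric] PP)
  have "cinner (P (z 0)) (P' (z 0)) = cinner (P (z 0)) (z 0) * cinner (z 0) (P' (z 0))"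
  proof (rule cinner_single[OF z])
    show "cinner (P (z 0)) (z j) = 0 \<or> cinner (P' (z 0)) (z j) = 0" if "j \<noteq> 0" for j
      unfolding P'0 using that tri[of j 0] tri[of 0 j] by (cases "j < 0") auto
  qed
  then show "cinner (P (z 0)) (z 0) \<in> {0, 1}"
    by (simp add: cadj[symmetric] PP)
  assume zero: "cinner (P (z 0)) (z 0) = 0"
  have diag: "cinner (P (z n)) (z n) = 0" for n
  proof -
    have "cinner (P (z (n + 1))) (z (n + 1)) = cinner (P (z n)) (z n)" for n
      using entry_step[OF P(3), of n n] w[of n] by simp
    then have "cinner (P (z n)) (z n) = cinner (P (z 0)) (z 0)"
      by (rule int_step_constant)
    then show ?thesis
      using zero by simp
  qed
  have nonneg: "\<forall>n. cinner (P (z n)) (z (n + int k)) = 0" for k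
  proof (induction k rule: less_induct)
    case (less k)
    show ?case
    proof (cases "k = 0")
      case True
      then show ?thesis
        using diag by simp
    next
      case False
      have low: "cinner (P (z n)) (z j) = 0" if "j < n + int k" for n j
      proof (cases "j < n")
        case True
        then show ?thesis
          by (rule tri)
      next
        case False
        then have "nat (j - n) < k" "j = n + int (nat (j - n))"
          using that by auto
        then show ?thesis
          using less.IH by metis
      qed
      show ?thesis
      proof
        fix n
        show "cinner (P (z n)) (z (n + int k)) = 0"
          unfolding sq
        proof (rule cinner_vanish[OF z])
          fix j
          show "cinner (P (z n)) (z j) = 0 \<or> cinner (P' (z (n + int k))) (z j) = 0"
            unfolding P'0 using low[of j n] low[of "n + int k" j] False by (cases "j < n + int k") auto
        qed
      qed
    qed
  qed
  show "P = 0"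
  proof (rule zero_operatorI[OF P(1)])
    show "cinner (P (z n)) (z m) = 0" for n m
      using tri[of m n] nonneg[of "nat (m - n)"] by (cases "m < n") (auto dest: spec[of _ n])
  qed
qed

lemma strongly_irreducible_if_weights_small:
  assumes "\<And>n. w n \<le> M" "\<And>\<epsilon>. \<epsilon> > 0 \<Longrightarrow> \<exists>n. w n < \<epsilon>"
  shows "strongly_irreducible A"
  unfolding strongly_irreducible_def
proof (intro conjI A(1) allI impI)
  fix P
  assume "complex_linear P \<and> P o\<^sub>L P = P \<and> P o\<^sub>L A = A o\<^sub>L P"
  then have P: "complex_linear P" "P o\<^sub>L P = P" "P o\<^sub>L A = A o\<^sub>L P"
    by auto
  have tri: "cinner (R (z n)) (z m) = 0" if "R o\<^sub>L A = A o\<^sub>L R" "m < n" for R m n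
    by (rule commutant_lower_triangular[of M]) (use assms that in auto)
  \<comment> \<open>The complementary idempotent reduces diagonal 1 to diagonal 0.\<close>
  define Q where "Q = id_blinfun - P"
  have Q: "complex_linear Q" "Q o\<^sub>L Q = Q" "Q o\<^sub>L A = A o\<^sub>L Q"
    unfolding Q_def by (rule complement_idempotent[OF P])+
  consider "cinner (P (z 0)) (z 0) = 0" | "cinner (P (z 0)) (z 0) = 1"
    using idempotent_zero_diagonal(1)[OF tri[OF P(3)] P] by blast
  then show "P = 0 \<or> P = id_blinfun"
  proof cases
    case 1
    then show ?thesis
      using idempotent_zero_diagonal(2)[OF tri[OF P(3)] P] by blast
  next
    case 2
    then have "cinner (Q (z 0)) (z 0) = 0"
      using z(1) by (simp add: Q_def blinfun.diff_left cinner_diff_left orthonormal_def)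
    then have "Q = 0"
      using idempotent_zero_diagonal(2)[OF tri[OF Q(3)] Q] by blast
    then show ?thesis
      by (simp add: Q_def)
  qed
qed

end

section \<open>Fourier coefficients and eigenvectors on a circle\<close>

lemma has_integral_cis:
  fixes k :: int
  shows "((\<lambda>t. cis (of_int k * t)) has_integral (if k = 0 then 2 * pi else 0)) {0..2*pi}"
proof (cases "k = 0")
  case True
  then show ?thesis
    using has_integral_const_real[of "1::complex" 0 "2*pi"] by (simp add: scaleR_conv_of_real)
next
  case False
  define F where "F t = cis (of_int k * t) / (\<i> * of_int k)" for t
  have "((\<lambda>t. cis (of_int k * t)) has_integral (F (2*pi) - F 0)) {0..2*pi}"
  proof (rule fundamental_theorem_of_calculus)
    fix t :: real
    have "((\<lambda>t. cis (of_int k * t)) has_vector_derivative (of_int k *\<^sub>R (\<i> * cis (of_int k * t)))) (at t within {0..2*pi})"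
      unfolding has_vector_derivative_def
      by (rule has_derivative_eq_rhs[OF has_derivative_cis[OF has_derivative_mult_right[OF has_derivative_ident]]])
         (simp add: fun_eq_iff mult.commute)
    then have "(F has_vector_derivative (of_int k *\<^sub>R (\<i> * cis (of_int k * t))) / (\<i> * of_int k)) (at t within {0..2*pi})"
      unfolding F_def by (rule has_vector_derivative_divide)
    also have "(of_int k *\<^sub>R (\<i> * cis (of_int k * t))) / (\<i> * of_int k) = cis (of_int k * t)"
      using False by (simp add: scaleR_conv_of_real)
    finally show "(F has_vector_derivative cis (of_int k * t)) (at t within {0..2*pi})" .
  qed simp
  moreover have "F (2*pi) = F 0"
    using cis_multiple_2pi[of "of_int k"] by (simp add: F_def mult_ac)
  ultimately show ?thesis
    using False by simp
qed

text \<open>Absolute summability gives uniform convergence, so the series can be integrated term by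
  term against \<open>cis (of_int (\<nu> m) * t)\<close>, which isolates the m-th coefficient. The
  injection \<open>\<nu>\<close> lets integer frequencies be summed by an ordinary series.\<close>

lemma fourier_uniqueness:
  fixes a :: "nat \<Rightarrow> complex" and \<nu> :: "nat \<Rightarrow> int"
  assumes \<nu>: "inj \<nu>" and a: "summable (\<lambda>n. cmod (a n))"
    and zero: "\<And>t. (\<Sum>n. a n * cis (- of_int (\<nu> n) * t)) = 0"
  shows "a m = 0"
proof -
  define f where "f n t = a n * cis (of_int (\<nu> m - \<nu> n) * t)" for n and t :: real
  have "uniform_limit {0..2*pi} (\<lambda>N t. \<Sum>n<N. f n t) (\<lambda>t. \<Sum>n. f n t) sequentially"
    by (rule Weierstrass_m_test[OF _ a]) (simp add: f_def norm_mult)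
  moreover have "(\<Sum>n. f n t) = 0" for t
  proof -
    have "summable (\<lambda>n. a n * cis (- of_int (\<nu> n) * t))"
      by (rule summable_norm_cancel) (simp add: norm_mult a)
    then have "(\<Sum>n. cis (of_int (\<nu> m) * t) * (a n * cis (- of_int (\<nu> n) * t)))
        = cis (of_int (\<nu> m) * t) * (\<Sum>n. a n * cis (- of_int (\<nu> n) * t))"
      by (rule suminf_mult)
    moreover have "cis (of_int (\<nu> m) * t) * (a n * cis (- of_int (\<nu> n) * t)) = f n t" for n
      by (simp add: f_def cis_mult left_diff_distrib)
    ultimately show ?thesis
      by (simp only: zero) simp
  qed
  ultimately have lim: "uniform_limit {0..2*pi} (\<lambda>N t. \<Sum>n<N. f n t) (\<lambda>t. 0) sequentially"
    by simp
  have cont: "continuous_on {0..2*pi} (\<lambda>t. \<Sum>n<N. f n t)" for N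
    unfolding f_def by (intro continuous_intros)
  obtain I J where IJ: "\<And>N. ((\<lambda>t. \<Sum>n<N. f n t) has_integral I N) {0..2*pi}"
      "((\<lambda>t. 0) has_integral J) {0..2*pi}" "I \<longlonglongrightarrow> J"
    using uniform_limit_integral[OF lim cont sequentially_bot] by blast
  have "J = 0"
    using IJ(2) has_integral_0 has_integral_unique by blast
  have integral_f: "((\<lambda>t. f n t) has_integral (a n * (if n = m then 2 * pi else 0))) {0..2*pi}" for n
    using has_integral_mult_right[OF has_integral_cis[of "\<nu> m - \<nu> n"], of "a n"] inj_eq[OF \<nu>, of m n]
    by (auto simp: f_def[abs_def])
  have "((\<lambda>t. \<Sum>n<N. f n t) has_integral (\<Sum>n<N. a n * (if n = m then 2 * pi else 0))) {0..2*pi}" for N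
    by (rule has_integral_sum) (simp_all add: integral_f)
  then have "I N = (\<Sum>n<N. a n * (if n = m then 2 * pi else 0))" for N
    using IJ(1) has_integral_unique by blast
  then have "I N = a m * (2 * pi)" if "N > m" for N
    using that by (simp add: if_distrib[of "(*) _"] if_distrib[of of_real] cong: if_cong)
  then have "eventually (\<lambda>N. I N = a m * (2 * pi)) sequentially"
    using eventually_gt_at_top[of m] by (rule eventually_mono[rotated])
  then have "I \<longlonglongrightarrow> a m * (2 * pi)"
    by (rule tendsto_eventually)
  then have "a m * (2 * pi) = 0"
    using IJ(3) \<open>J = 0\<close> LIMSEQ_unique by blast
  then show ?thesis
    by simp
qed

context weighted_shift
begin

text \<open>The vectors \<open>v t\<close> are eigenvectors to the points \<open>r * cis t\<close> of a circle, and the eigenspaces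
  are one-dimensional. Hence an idempotent in the commutant acts on \<open>v t\<close> as multiplication by
  \<open>\<kappa> t \<in> {0, 1}\<close>, and \<open>\<kappa>\<close> is continuous.\<close>

lemma strongly_irreducible_if_eigenvectors:
  fixes b :: "int \<Rightarrow> real" and r :: real
  assumes r: "r > 0" and b: "\<And>n. b n > 0" "b 0 = 1" "\<And>n. b (n + 1) * r = b n * w n"
    and summable: "summable (\<lambda>n. b (int_decode n))"
  shows "strongly_irreducible A"
proof -
  let ?z = "\<lambda>n. z (int_decode n)"
  have oz: "orthonormal ?z"
    using z(1) bij_int_decode by (auto simp: orthonormal_def bij_def inj_eq)
  have unit: "norm (z j) = 1" for j
    using z(1) by (rule orthonormal_norm)
  \<comment> \<open>The coordinates of the eigenvector are forced by the recursion along the shift.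
    Their moduli do not depend on \<open>t\<close>, so the summability of \<open>b\<close> serves
    all \<open>t\<close> uniformly.\<close>
  define e where "e n t = of_real (b n) * cis (- of_int n * t)" for n and t :: real
  have norm_e: "cmod (e n t) = b n" for n t
    using b(1)[of n] by (simp add: e_def norm_mult)
  define v where "v t = (\<Sum>n. e (int_decode n) t *\<^sub>C ?z n)" for t
  have "summable (\<lambda>n. e (int_decode n) t *\<^sub>C ?z n)" for t
    by (rule summable_norm_cancel) (simp add: norm_e unit summable)
  then have v: "(\<lambda>n. e (int_decode n) t *\<^sub>C ?z n) sums v t" for t
    unfolding v_def by (rule summable_sums)
  have v_coord: "cinner (v t) (z m) = e m t" for t m
    using cinner_series_orthonormal[OF oz v, of t "int_encode m"] by simp
  have e_step: "of_real (w m) * e m t = of_real r * cis t * e (m + 1) t" for m t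
  proof -
    have "cis t * cis (- of_int (m + 1) * t) = cis (- of_int m * t)"
      by (simp add: cis_mult algebra_simps)
    then have "of_real r * cis t * e (m + 1) t = of_real (b (m + 1) * r) * cis (- of_int m * t)"
      by (simp add: e_def)
    then show ?thesis
      unfolding b(3) by (simp add: e_def)
  qed
  have Av: "A (v t) = (of_real r * cis t) *\<^sub>C v t" for t
  proof (rule complete_family_eqI[OF z(2)])
    fix j
    show "cinner (A (v t)) (z j) = cinner ((of_real r * cis t) *\<^sub>C v t) (z j)"
      using shift_coordinate[of "v t" "j - 1"] e_step[of "j - 1" t]
      by (simp add: v_coord cinner_scaleC_left)
  qed
  \<comment> \<open>The coordinates of \<open>y\<close> and of \<open>v t\<close> obey the same
    first-order recursion, so their quotient is constant; this is why the eigenvalue is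
    simple.\<close>
  have eigenspace: "y = cinner y (z 0) *\<^sub>C v t" if y: "A y = (of_real r * cis t) *\<^sub>C y" for y t
  proof (rule complete_family_eqI[OF z(2)])
    fix j
    define F where "F m = cinner y (z m) / e m t" for m
    have enz: "e m t \<noteq> 0" for m
      using norm_e[of m t] b(1)[of m] by force
    have "F (m + 1) = F m" for m
    proof -
      have "of_real (w m) * cinner y (z m) = of_real r * cis t * cinner y (z (m + 1))"
        using shift_coordinate[of y m] by (simp add: y cinner_scaleC_left)
      then have "(of_real r * cis t) * (cinner y (z (m + 1)) * e m t) = (of_real (w m) * cinner y (z m)) * e m t"
        by (simp only: mult.assoc)
      also have "\<dots> = cinner y (z m) * (of_real (w m) * e m t)"
        by (simp only: mult_ac)
      also have "\<dots> = (of_real r * cis t) * (cinner y (z m) * e (m + 1) t)"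
        unfolding e_step by (simp only: mult_ac)
      finally have "(of_real r * cis t) * (cinner y (z (m + 1)) * e m t)
          = (of_real r * cis t) * (cinner y (z m) * e (m + 1) t)" .
      then have "cinner y (z (m + 1)) * e m t = cinner y (z m) * e (m + 1) t"
        using r by (subst (asm) mult_left_cancel) auto
      then show ?thesis
        using enz by (simp add: F_def field_simps)
    qed
    then have "F j = F 0"
      by (rule int_step_constant)
    then have "cinner y (z j) = cinner y (z 0) * e j t"
      using enz by (simp add: F_def e_def[of 0] b(2) field_simps)
    then show "cinner y (z j) = cinner (cinner y (z 0) *\<^sub>C v t) (z j)"
      by (simp add: cinner_scaleC_left v_coord)
  qed
  \<comment> \<open>As a function of \<open>t\<close>, \<open>cinner (P (v t)) (z m)\<close> is a
    Fourier series whose coefficients are the matrix entries of \<open>P\<close> scaled by the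
    positive \<open>b n\<close>. This expresses that the \<open>v t\<close> span a dense
    subspace.\<close>
  have zeroI: "P = 0" if P: "complex_linear P" "\<And>t. P (v t) = 0" for P
  proof (rule zero_operatorI[OF P(1)])
    fix n m
    let ?a = "\<lambda>i. of_real (b (int_decode i)) * cinner (P (?z i)) (z m)"
    have "?a (int_encode n) = 0"
    proof (rule fourier_uniqueness[of int_decode])
      show "inj int_decode"
        using bij_int_decode by (simp add: bij_def)
      show "summable (\<lambda>i. cmod (?a i))"
      proof (rule summable_comparison_test'[where N = 0])
        show "summable (\<lambda>i. b (int_decode i) * norm P)"
          using summable by (rule summable_mult2)
        show "norm (cmod (?a i)) \<le> b (int_decode i) * norm P" for i
        proof -
          have "cmod (cinner (P (?z i)) (z m)) \<le> norm (P (?z i)) * norm (z m)"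
            by (rule cinner_le_norm)
          also have "\<dots> \<le> norm P"
            using norm_blinfun[of P "?z i"] by (simp add: unit)
          finally show ?thesis
            using b(1)[of "int_decode i"] by (simp add: norm_mult mult_left_mono)
        qed
      qed
      show "(\<Sum>i. ?a i * cis (- of_int (int_decode i) * t)) = 0" for t
      proof -
        have "(\<lambda>i. P (e (int_decode i) t *\<^sub>C ?z i)) sums P (v t)"
          by (rule bounded_linear.sums[OF blinfun.bounded_linear_right v])
        then have "(\<lambda>i. e (int_decode i) t *\<^sub>C P (?z i)) sums 0"
          using P by (simp add: complex_linear_def)
        from cinner_series[OF this, of "z m"] show ?thesis
          by (simp add: sums_iff e_def mult_ac)
      qed
    qed
    then show "cinner (P (z n)) (z m) = 0"
      using b(1)[of n] by simp
  qed
  show ?thesis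
    unfolding strongly_irreducible_def
  proof (intro conjI A(1) allI impI)
    fix P
    assume "complex_linear P \<and> P o\<^sub>L P = P \<and> P o\<^sub>L A = A o\<^sub>L P"
    then have P: "complex_linear P" "P o\<^sub>L P = P" "P o\<^sub>L A = A o\<^sub>L P"
      by auto
    have PP: "P (P x) = P x" and PA: "A (P x) = P (A x)" for x
      using P(2,3) by (metis blinfun_apply_blinfun_compose)+
    define \<kappa> where "\<kappa> t = cinner (P (v t)) (z 0)" for t
    have Pv: "P (v t) = \<kappa> t *\<^sub>C v t" for t
      unfolding \<kappa>_def
    proof (rule eigenspace)
      show "A (P (v t)) = (of_real r * cis t) *\<^sub>C P (v t)"
        using P(1) by (simp add: PA Av complex_linear_def)
    qed
    have \<kappa>01: "\<kappa> t \<in> {0, 1}" for t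
    proof -
      have "P (P (v t)) = \<kappa> t *\<^sub>C (\<kappa> t *\<^sub>C v t)"
        using P(1) by (simp add: Pv complex_linear_def)
      then have "cinner (\<kappa> t *\<^sub>C v t) (z 0) = cinner (\<kappa> t *\<^sub>C (\<kappa> t *\<^sub>C v t)) (z 0)"
        by (simp only: PP) (simp only: Pv)
      then have "\<kappa> t = \<kappa> t * \<kappa> t"
        by (simp add: cinner_scaleC_left v_coord e_def b(2))
      then show ?thesis
        by auto
    qed
    have "continuous_on UNIV v"
    proof (rule uniform_limit_theorem)
      show "uniform_limit UNIV (\<lambda>N t. \<Sum>n<N. e (int_decode n) t *\<^sub>C ?z n) v sequentially"
        unfolding v_def[abs_def]
        by (rule Weierstrass_m_test[OF _ summable]) (simp add: norm_e unit)
      have "continuous_on UNIV (\<lambda>t. e n t *\<^sub>C z n)" for n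
      proof -
        have "continuous_on UNIV (e n)"
          unfolding e_def[abs_def] by (intro continuous_intros)
        then show ?thesis
          by (rule continuous_on_compose2[OF continuous_on_scaleC_left[of UNIV "z n"]]) auto
      qed
      then show "\<forall>\<^sub>F N in sequentially. continuous_on UNIV (\<lambda>t. \<Sum>n<N. e (int_decode n) t *\<^sub>C ?z n)"
        by (intro always_eventually allI continuous_on_sum)
    qed simp
    then have "continuous_on UNIV \<kappa>"
      unfolding \<kappa>_def[abs_def]
      by (intro bounded_linear.continuous_on[OF bounded_linear_cinner_left]
          bounded_linear.continuous_on[OF blinfun.bounded_linear_right])
    then have "connected (range \<kappa>)"
      using connected_continuous_image connected_UNIV by blast
    moreover have "finite (range \<kappa>)"
      using \<kappa>01 by (intro finite_subset[of "range \<kappa>" "{0, 1}"]) auto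
    ultimately obtain c where "range \<kappa> = {c}"
      using connected_finite_iff_sing[of "range \<kappa>"] by auto
    then have c: "\<kappa> t = c" for t
      by (metis rangeI singletonD)
    consider "c = 0" | "c = 1"
      using \<kappa>01[of 0] c by auto
    then show "P = 0 \<or> P = id_blinfun"
    proof cases
      case 1
      then show ?thesis
        using zeroI[OF P(1)] Pv c by simp
    next
      case 2
      have "id_blinfun - P = 0"
      proof (rule zeroI)
        show "complex_linear (id_blinfun - P)"
          by (rule complement_idempotent(1)[OF P])
        show "(id_blinfun - P) (v t) = 0" for t
          using 2 c by (simp add: blinfun.diff_left Pv scaleC_one)
      qed
      then show ?thesis
        by simp
    qed
  qed
qed

end

context weighted_shift
begin

text \<open>The bounds telescope: the products of w / r to the right and of r / w to the left are at
  most \<open>(real m / real (k + m))\<^sup>2\<close>. The square makes them summable, and a large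
  offset \<open>m\<close> keeps the prescribed factors near 1 from the first weight on.\<close>

lemma strongly_irreducible_if_decay:
  fixes r :: real and m :: nat
  assumes r: "r > 0" and m: "m \<ge> 1"
    and right: "\<And>k. w (int k) \<le> r * (real (k + m) / real (k + m + 1))\<^sup>2"
    and left: "\<And>k. r * (real (k + m + 1) / real (k + m))\<^sup>2 \<le> w (- int k - 1)"
  shows "strongly_irreducible A"
proof -
  define bp where "bp k = (\<Prod>i<k. w (int i) / r)" for k :: nat
  define bn where "bn k = (\<Prod>i<k. r / w (- int i - 1))" for k :: nat
  \<comment> \<open>The solution of the recursion \<open>b (n + 1) * r = b n * w n\<close> with
    \<open>b 0 = 1\<close>, written as a product in each direction.\<close>
  define b where "b n = (if n \<ge> 0 then bp (nat n) else bn (nat (- n)))" for n :: int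
  have bp_pos: "bp k > 0" and bn_pos: "bn k > 0" for k
    using r w by (simp_all add: bp_def bn_def prod_pos)
  have m0: "real m > 0" "real (k + m) > 0" "real (k + m + 1) > 0" for k
    using m by auto
  have bp_le: "bp k \<le> (real m / real (k + m))\<^sup>2" for k
  proof (induction k)
    case 0
    then show ?case
      using m0 by (simp add: bp_def)
  next
    case (Suc k)
    have "bp (Suc k) = bp k * (w (int k) / r)"
      by (simp add: bp_def)
    also have "\<dots> \<le> (real m / real (k + m))\<^sup>2 * (real (k + m) / real (k + m + 1))\<^sup>2"
      using Suc right[of k] r w[of "int k"] bp_pos[of k]
      by (intro mult_mono) (simp_all add: divide_le_eq mult.commute)
    also have "\<dots> = (real m / real (Suc k + m))\<^sup>2"
      using m0(2)[of k] by (simp add: power_mult_distrib[symmetric] add.commute)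
    finally show ?case .
  qed
  have bn_le: "bn k \<le> (real m / real (k + m))\<^sup>2" for k
  proof (induction k)
    case 0
    then show ?case
      using m0 by (simp add: bn_def)
  next
    case (Suc k)
    let ?\<rho> = "(real (k + m + 1) / real (k + m))\<^sup>2"
    have "?\<rho> > 0"
      by (intro zero_less_power divide_pos_pos m0(2,3))
    have "bn (Suc k) = bn k * (r / w (- int k - 1))"
      by (simp add: bn_def)
    also have "r / w (- int k - 1) \<le> r / (r * ?\<rho>)"
      using left[of k] r \<open>?\<rho> > 0\<close> w by (intro divide_left_mono mult_pos_pos) auto
    also have "r / (r * ?\<rho>) = (real (k + m) / real (k + m + 1))\<^sup>2"
      using r by (simp add: power_divide)
    finally have "bn (Suc k) \<le> bn k * (real (k + m) / real (k + m + 1))\<^sup>2"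
      using bn_pos[of k] by simp
    also have "\<dots> \<le> (real m / real (k + m))\<^sup>2 * (real (k + m) / real (k + m + 1))\<^sup>2"
      using Suc by (intro mult_right_mono) auto
    also have "\<dots> = (real m / real (Suc k + m))\<^sup>2"
      using m0(2)[of k] by (simp add: power_mult_distrib[symmetric] add.commute)
    finally show ?case .
  qed
  show ?thesis
  proof (rule strongly_irreducible_if_eigenvectors[OF r])
    show pos: "b n > 0" for n
      using bp_pos bn_pos by (simp add: b_def)
    show "b 0 = 1"
      by (simp add: b_def bp_def)
    show "b (n + 1) * r = b n * w n" for n
    proof (cases "n \<ge> 0")
      case True
      then have "b (n + 1) = b n * (w n / r)"
        by (simp add: b_def bp_def nat_add_distrib)
      then show ?thesis
        using r by simp
    next
      case False
      define k where "k = nat (- n - 1)"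
      have n: "n = - int k - 1"
        using False by (simp add: k_def)
      have "b n = bn (Suc k)"
        by (simp add: b_def n nat_add_distrib)
      moreover have "b (n + 1) = bn k"
        by (simp add: b_def n bp_def bn_def)
      ultimately show ?thesis
        using w[of n] by (simp add: bn_def n)
    qed
    show "summable (\<lambda>n. b (int_decode n))"
    proof (rule summable_comparison_test'[where N = 0])
      have "summable (\<lambda>n. inverse (real n ^ 2))"
        by (rule inverse_power_summable) simp
      then have "summable (\<lambda>n. inverse (real (Suc n) ^ 2))"
        by (rule summable_Suc_iff[where f = "\<lambda>n. inverse (real n ^ 2)", THEN iffD2])
      then show "summable (\<lambda>n. (2 * real m)\<^sup>2 * inverse (real (Suc n) ^ 2))"
        by (rule summable_mult)
      \<comment> \<open>\<open>int_decode\<close> sends 2 k to k and 2 k + 1 to - k - 1, so the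
        modulus of \<open>int_decode n\<close> is at least \<open>n div 2\<close>.\<close>
      fix n :: nat
      have "Suc n \<le> 2 * (n div 2 + m)"
        using m by presburger
      then have half: "real (Suc n) \<le> 2 * real (n div 2 + m)"
        by (metis of_nat_le_iff of_nat_mult of_nat_numeral)
      have "b (int_decode n) \<le> (real m / real (n div 2 + m))\<^sup>2"
      proof (cases "even n")
        case True
        then have "b (int_decode n) = bp (n div 2)"
          by (simp add: int_decode_def sum_decode_def b_def)
        then show ?thesis
          using bp_le by simp
      next
        case False
        then have "b (int_decode n) = bn (Suc (n div 2))"
          by (simp add: int_decode_def sum_decode_def b_def nat_add_distrib)
        also have "\<dots> \<le> (real m / real (Suc (n div 2) + m))\<^sup>2"
          by (rule bn_le)
        also have "\<dots> \<le> (real m / real (n div 2 + m))\<^sup>2"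
          using m0(2)[of "n div 2"] by (intro power_mono divide_left_mono) auto
        finally show ?thesis .
      qed
      also have "\<dots> \<le> (2 * real m / real (Suc n))\<^sup>2"
      proof (rule power_mono)
        have "real m / real (n div 2 + m) = (2 * real m) / (2 * real (n div 2 + m))"
          by (rule mult_divide_mult_cancel_left[symmetric]) simp
        also have "\<dots> \<le> 2 * real m / real (Suc n)"
          using half by (intro divide_left_mono) auto
        finally show "real m / real (n div 2 + m) \<le> 2 * real m / real (Suc n)" .
      qed simp
      also have "\<dots> = (2 * real m)\<^sup>2 * inverse (real (Suc n) ^ 2)"
        by (simp only: power_divide) (simp only: divide_inverse)
      finally show "norm (b (int_decode n)) \<le> (2 * real m)\<^sup>2 * inverse (real (Suc n) ^ 2)"
        using pos[of "int_decode n"] by simp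
    qed
  qed
qed

end

section \<open>Choice of the weights\<close>

lemma sum_reindexed_le:
  fixes g :: "nat \<Rightarrow> real"
  assumes "finite F" "inj_on h F" and g: "\<And>k. 0 \<le> g k" "\<And>K. (\<Sum>k<K. g k) \<le> B"
  shows "(\<Sum>n\<in>F. g (h n)) \<le> B"
proof -
  obtain K where "h ` F \<subseteq> {..<K}"
    using assms(1) finite_nat_iff_bounded[of "h ` F"] by auto
  have "(\<Sum>n\<in>F. g (h n)) = (\<Sum>k\<in>h ` F. g k)"
    using assms(2) by (simp add: sum.reindex)
  also have "\<dots> \<le> (\<Sum>k<K. g k)"
    using \<open>h ` F \<subseteq> {..<K}\<close> g(1) by (intro sum_mono2) auto
  also have "\<dots> \<le> B"
    by (rule g(2))
  finally show ?thesis .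
qed

lemma fast_subsequence:
  fixes X :: "nat \<Rightarrow> real"
  assumes X: "X \<longlonglongrightarrow> l" and s: "s > 0"
  obtains \<psi> :: "nat \<Rightarrow> nat" where "strict_mono \<psi>" "\<And>k. \<bar>X (\<psi> k) - l\<bar> \<le> s * (1/2)^k"
proof -
  have "\<exists>N. \<forall>n\<ge>N. \<bar>X n - l\<bar> < s * (1/2)^k" for k
    using LIMSEQ_D[OF X, of "s * (1/2)^k"] s by simp
  then obtain N where N: "\<And>k n. n \<ge> N k \<Longrightarrow> \<bar>X n - l\<bar> < s * (1/2)^k"
    by metis
  \<comment> \<open>The sum dominates \<open>N k\<close>, and the summand \<open>k\<close> makes the
    sequence strictly increasing.\<close>
  define \<psi> where "\<psi> k = k + (\<Sum>i\<le>k. N i)" for k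
  show ?thesis
  proof (rule that[of \<psi>])
    show "strict_mono \<psi>"
      by (rule strict_monoI_Suc) (simp add: \<psi>_def)
    show "\<bar>X (\<psi> k) - l\<bar> \<le> s * (1/2)^k" for k
    proof -
      have "N k \<le> (\<Sum>i\<le>k. N i)"
        by (rule member_le_sum) auto
      then have "\<psi> k \<ge> N k"
        by (simp add: \<psi>_def)
      then show ?thesis
        using N less_imp_le by blast
    qed
  qed
qed

text \<open>\<open>\<tau>\<close> bounds how far \<open>d\<close> lies on the wrong side of
  \<open>r\<close>, relative to \<open>r\<close>. The margin costs at most 3/x because ((x + 1)/x)^2
  <= 1 + 3/x, and the mixed term (3/x) times \<open>\<tau>\<close> is at most three times
  \<open>\<tau>\<close>, which accounts for the factor 4.\<close>

lemma weight_error: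
  fixes x d r \<tau> :: real
  assumes x: "x \<ge> 1" and r: "r > 0" and \<tau>: "\<tau> \<ge> 0"
  shows "d \<le> r * (1 + \<tau>) \<Longrightarrow> d > 0 \<Longrightarrow> \<bar>d / min d (r * (x / (x + 1))\<^sup>2) - 1\<bar> \<le> 4 * \<tau> + 3 / x"
    and "r * (1 - \<tau>) \<le> d \<Longrightarrow> d > 0 \<Longrightarrow> \<bar>d / max d (r * ((x + 1) / x)\<^sup>2) - 1\<bar> \<le> 4 * \<tau> + 3 / x"
proof -
  have inv: "((x + 1) / x)\<^sup>2 = 1 + 2 / x + (1 / x) * (1 / x)"
    using x by (simp add: power2_eq_square field_simps)
  have "(1 / x) * (1 / x) \<le> 1 * (1 / x)"
    using x by (intro mult_right_mono) auto
  with inv have le: "((x + 1) / x)\<^sup>2 \<le> 1 + 3 / x"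
    by simp
  have "3 / x \<le> 3"
    using x by (simp add: field_simps)
  have rec: "(x / (x + 1))\<^sup>2 * ((x + 1) / x)\<^sup>2 = 1"
    using x by (simp add: power_mult_distrib[symmetric])
  have ge1: "((x + 1) / x)\<^sup>2 \<ge> 1"
    using x by (simp add: inv)
  have pos: "(x / (x + 1))\<^sup>2 > 0"
    using x by simp
  show "\<bar>d / min d (r * (x / (x + 1))\<^sup>2) - 1\<bar> \<le> 4 * \<tau> + 3 / x" if d: "d \<le> r * (1 + \<tau>)" "d > 0"
  proof (cases "d \<le> r * (x / (x + 1))\<^sup>2")
    case True
    then show ?thesis
      using d \<tau> x by (simp add: min_def)
  next
    case False
    define y where "y = r * (x / (x + 1))\<^sup>2"
    have y: "y > 0" "y < d"
      using r pos False by (simp_all add: y_def)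
    have dy: "d / y = (d / r) * ((x + 1) / x)\<^sup>2"
      using r x by (simp add: y_def field_simps)
    have "(d / r) * ((x + 1) / x)\<^sup>2 \<le> (1 + \<tau>) * (1 + 3 / x)"
      using d r le ge1 \<tau> x by (intro mult_mono) (auto simp: field_simps)
    also have "\<dots> = 1 + \<tau> + 3 / x + (3 / x) * \<tau>"
      by (simp add: algebra_simps add_divide_distrib)
    also have "\<dots> \<le> 1 + \<tau> + 3 / x + 3 * \<tau>"
      using \<open>3 / x \<le> 3\<close> \<tau> by (intro add_left_mono mult_right_mono) auto
    finally have "d / y \<le> 1 + (4 * \<tau> + 3 / x)"
      using dy by simp
    moreover have "1 \<le> d / y"
      using y by simp
    ultimately show ?thesis
      using y by (simp add: min_def y_def[symmetric] abs_if)
  qed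
  show "\<bar>d / max d (r * ((x + 1) / x)\<^sup>2) - 1\<bar> \<le> 4 * \<tau> + 3 / x" if d: "r * (1 - \<tau>) \<le> d" "d > 0"
  proof (cases "r * ((x + 1) / x)\<^sup>2 \<le> d")
    case True
    then show ?thesis
      using d \<tau> x by (simp add: max_def)
  next
    case False
    define y where "y = r * ((x + 1) / x)\<^sup>2"
    have y: "y > d" "y > 0"
      using False d by (simp_all add: y_def)
    have y_le: "y \<le> r * (1 + 3 / x)"
      unfolding y_def using le r by (intro mult_left_mono) auto
    have "(1 - (4 * \<tau> + 3 / x)) * y \<le> d"
    \<comment> \<open>If the allowed error exceeds 1 the left side is nonpositive; otherwise its
      factor is nonnegative and \<open>y\<close> may be replaced by its upper bound.\<close>
    proof (cases "4 * \<tau> + 3 / x \<le> 1")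
      case True
      then have "(1 - (4 * \<tau> + 3 / x)) * y \<le> (1 - (4 * \<tau> + 3 / x)) * (r * (1 + 3 / x))"
        using y_le by (intro mult_left_mono) auto
      also have "\<dots> = r * ((1 - (4 * \<tau> + 3 / x)) * (1 + 3 / x))"
        by simp
      also have "\<dots> \<le> r * (1 - \<tau>)"
      proof (intro mult_left_mono)
        have "(1 - (4 * \<tau> + 3 / x)) * (1 + 3 / x) = 1 - 4 * \<tau> - (3 / x) * (4 * \<tau> + 3 / x)"
          by (simp add: algebra_simps)
        also have "\<dots> \<le> 1 - \<tau>"
        proof -
          have "0 \<le> (3 / x) * (4 * \<tau> + 3 / x)"
            using \<tau> x by (intro mult_nonneg_nonneg add_nonneg_nonneg) auto
          then show ?thesis
            using \<tau> by linarith
        qed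
        finally show "(1 - (4 * \<tau> + 3 / x)) * (1 + 3 / x) \<le> 1 - \<tau>" .
      qed (use r in simp)
      finally show ?thesis
        using d by linarith
    next
      case False
      then have "(1 - (4 * \<tau> + 3 / x)) * y \<le> 0"
        using y by (intro mult_nonpos_nonneg) auto
      then show ?thesis
        using d by linarith
    qed
    then have "1 - (4 * \<tau> + 3 / x) \<le> d / y"
      using y by (simp add: field_simps)
    moreover have "d / y \<le> 1"
      using y by simp
    ultimately show ?thesis
      using y by (simp add: max_def y_def[symmetric] abs_if)
  qed
qed

text \<open>If the \<open>d n\<close> are not bounded away from \<open>0\<close> they serve as weights in any order. Otherwise let
  \<open>r > 0\<close> be a limit point: the weights on the right are pushed below \<open>r\<close> and the ones on the left
  above \<open>r\<close>. Members of a fast convergent subsequence go to either side, so that both sides are infinite;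
  all other indices go to the side on which \<open>d n\<close> already is.\<close>

lemma choose_weights:
  fixes d :: "nat \<Rightarrow> real"
  assumes d: "\<And>n. 0 < d n" "\<And>n. d n \<le> M" and eta: "\<eta> > 0"
  obtains \<sigma> :: "int \<Rightarrow> nat" and w :: "nat \<Rightarrow> real" where
    "bij \<sigma>" "\<And>n. w n > 0" "summable (\<lambda>n. (d n / w n - 1)\<^sup>2)" "(\<Sum>n. (d n / w n - 1)\<^sup>2) \<le> \<eta>"
    "((\<forall>n. w n \<le> M) \<and> (\<forall>\<epsilon>>0. \<exists>n. w n < \<epsilon>)) \<or>
     (\<exists>r>0. \<exists>m\<ge>1. \<forall>k. w (\<sigma> (int k)) \<le> r * (real (k + m) / real (k + m + 1))\<^sup>2 \<and>
        r * (real (k + m + 1) / real (k + m))\<^sup>2 \<le> w (\<sigma> (- int k - 1)))"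
proof (cases "\<forall>\<epsilon>>0. \<exists>n. d n < \<epsilon>")
  case True
  have 0: "(d n / d n - 1)\<^sup>2 = 0" for n
    using d(1)[of n] by simp
  show ?thesis
  proof (rule that[of int_encode d])
    show "summable (\<lambda>n. (d n / d n - 1)\<^sup>2)" "(\<Sum>n. (d n / d n - 1)\<^sup>2) \<le> \<eta>"
      unfolding 0 using eta by simp_all
  qed (use True d bij_int_encode in auto)
next
  case False
  then obtain a where a: "a > 0" "\<And>n. d n \<ge> a"
    by (auto simp: not_less)
  have "bounded (range d)"
    using d by (intro boundedI[of _ M]) (auto simp: abs_of_pos)
  then obtain r \<phi> where \<phi>: "strict_mono \<phi>" "(d \<circ> \<phi>) \<longlonglongrightarrow> r"
    using bounded_imp_convergent_subsequence by blast
  have "a \<le> r"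
    by (rule LIMSEQ_le_const[OF \<phi>(2)]) (use a in auto)
  with a(1) have r: "r > 0"
    by simp
  \<comment> \<open>The squares of \<open>\<tau>\<close> will sum to at most
    \<open>2 * s\<^sup>2\<close> and enter with factor 32, so they use at most half of
    \<open>\<eta>\<close>.\<close>
  define s where "s = min 1 (sqrt (\<eta> / 128))"
  have s: "s > 0" "128 * s\<^sup>2 \<le> \<eta>"
  proof -
    show "s > 0"
      using eta by (simp add: s_def)
    have "s\<^sup>2 \<le> (sqrt (\<eta> / 128))\<^sup>2"
      using \<open>s > 0\<close> by (intro power_mono) (auto simp: s_def)
    then show "128 * s\<^sup>2 \<le> \<eta>"
      using eta by simp
  qed
  obtain \<psi> where \<psi>: "strict_mono \<psi>" "\<And>k. \<bar>(d \<circ> \<phi>) (\<psi> k) - r\<bar> \<le> (s * r) * (1/2)^k"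
    using fast_subsequence[OF \<phi>(2), of "s * r"] s(1) r by auto
  define \<theta> where "\<theta> k = \<phi> (\<psi> k)" for k
  have \<theta>_inj: "inj \<theta>"
    by (simp add: \<theta>_def inj_def strict_mono_eq[OF \<phi>(1)] strict_mono_eq[OF \<psi>(1)])
  have \<theta>: "\<bar>d (\<theta> k) / r - 1\<bar> \<le> s * (1/2)^k" for k
  proof -
    have "\<bar>d (\<theta> k) / r - 1\<bar> = \<bar>d (\<theta> k) - r\<bar> / r"
      using r by (simp add: abs_if field_simps)
    also have "\<dots> \<le> s * (1/2)^k"
      using \<psi>(2)[of k] r by (simp add: \<theta>_def field_simps)
    finally show ?thesis .
  qed
  \<comment> \<open>Only members of the subsequence may be put on the wrong side of
    \<open>r\<close>, and there the deviation decays geometrically.\<close>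
  define \<tau> where "\<tau> n = (if n \<in> range \<theta> then \<bar>d n / r - 1\<bar> else 0)" for n
  \<comment> \<open>Even members of the subsequence go to the left side, odd members to the
    right.\<close>
  define L where "L = range (\<lambda>k. \<theta> (2 * k)) \<union> {n. n \<notin> range \<theta> \<and> d n > r}"
  define R where "R = - L"
  have infL: "infinite L"
  proof -
    have "inj (\<lambda>k. \<theta> (2 * k))"
      by (simp add: inj_def inj_eq[OF \<theta>_inj])
    then have "infinite (range (\<lambda>k. \<theta> (2 * k)))"
      by (rule range_inj_infinite)
    then show ?thesis
      by (simp add: L_def)
  qed
  have infR: "infinite R"
  proof -
    have "inj (\<lambda>k. \<theta> (2 * k + 1))"
      by (simp add: inj_def inj_eq[OF \<theta>_inj])
    then have "infinite (range (\<lambda>k. \<theta> (2 * k + 1)))"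
      by (rule range_inj_infinite)
    moreover have "\<theta> (2 * k + 1) \<noteq> \<theta> (2 * l)" for k l
      using inj_eq[OF \<theta>_inj, of "2 * k + 1" "2 * l"] by presburger
    then have "range (\<lambda>k. \<theta> (2 * k + 1)) \<subseteq> R"
      by (auto simp: R_def L_def)
    ultimately show ?thesis
      using finite_subset by blast
  qed
  have \<tau>0: "\<tau> n \<ge> 0" for n
    by (simp add: \<tau>_def)
  have dR: "d n \<le> r * (1 + \<tau> n)" if "n \<in> R" for n
  proof (cases "n \<in> range \<theta>")
    case True
    then have "d n / r \<le> 1 + \<tau> n"
      by (simp add: \<tau>_def)
    then show ?thesis
      using r by (simp add: field_simps)
  next
    case False
    then show ?thesis
      using that r by (simp add: R_def L_def \<tau>_def)
  qed
  have dL: "r * (1 - \<tau> n) \<le> d n" if "n \<in> L" for n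
  proof (cases "n \<in> range \<theta>")
    case True
    then have "1 - \<tau> n \<le> d n / r"
      by (simp add: \<tau>_def abs_if)
    then show ?thesis
      using r by (simp add: field_simps)
  next
    case False
    then show ?thesis
      using that r by (auto simp: L_def \<tau>_def)
  qed
  define iR where "iR = the_inv_into UNIV (enumerate R)"
  define iL where "iL = the_inv_into UNIV (enumerate L)"
  have bR: "bij_betw (enumerate R) UNIV R" and bL: "bij_betw (enumerate L) UNIV L"
    using infR infL by (auto intro: bij_enumerate)
  have iR: "iR (enumerate R k) = k" and iL: "iL (enumerate L k) = k" for k
    using bR bL by (simp_all add: iR_def iL_def bij_betw_def the_inv_into_f_f)
  have injR: "inj_on iR R" and injL: "inj_on iL L"
    using bij_betw_the_inv_into[OF bR] bij_betw_the_inv_into[OF bL]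
    by (auto simp: iR_def iL_def bij_betw_def)
  have inR: "enumerate R k \<in> R" and inL: "enumerate L k \<in> L" for k
    using infR infL enumerate_in_set by auto
  define \<sigma> where "\<sigma> k = (if k \<ge> 0 then enumerate R (nat k) else enumerate L (nat (- k - 1)))" for k :: int
  have "bij \<sigma>"
  proof (rule bijI)
    show "inj \<sigma>"
    proof (rule injI)
      fix k l
      assume eq: "\<sigma> k = \<sigma> l"
      have enum: "nat k = nat l" if "enumerate R (nat k) = enumerate R (nat l)" for k l
        using that iR by metis
      have enum': "nat (- k - 1) = nat (- l - 1)" if "enumerate L (nat (- k - 1)) = enumerate L (nat (- l - 1))" for k l
        using that iL by metis
      have disj: "enumerate R i \<noteq> enumerate L j" for i j
        using inR[of i] inL[of j] by (auto simp: R_def)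
      show "k = l"
        using eq enum[of k l] enum'[of k l] disj[of "nat k" "nat (- l - 1)"] disj[of "nat l" "nat (- k - 1)"]
        by (auto simp: \<sigma>_def split: if_splits)
    qed
    have "n \<in> range \<sigma>" for n
    proof (cases "n \<in> L")
      case True
      then obtain k where "enumerate L k = n"
        using bL unfolding bij_betw_def by (metis imageE)
      then have "\<sigma> (- int k - 1) = n"
        by (simp add: \<sigma>_def)
      then show ?thesis
        by blast
    next
      case False
      then obtain k where "enumerate R k = n"
        using bR unfolding bij_betw_def R_def by (metis ComplI imageE)
      then have "\<sigma> (int k) = n"
        by (simp add: \<sigma>_def)
      then show ?thesis
        by blast
    qed
    then show "surj \<sigma>"
      by blast
  qed
  \<comment> \<open>Each side will contribute at most \<open>\<eta> / 144\<close> with factor 18, a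
    quarter of \<open>\<eta>\<close> together.\<close>
  obtain m0 :: nat where m0: "144 / \<eta> < real m0"
    using reals_Archimedean2 by blast
  define m where "m = m0 + 2"
  have m: "m \<ge> 2" "m \<ge> 1" "1 / real (m - 1) \<le> \<eta> / 144"
  proof -
    have "144 \<le> \<eta> * (1 + real m0)"
      using m0 eta by (simp add: field_simps)
    then show "1 / real (m - 1) \<le> \<eta> / 144"
      using eta by (simp add: m_def field_simps)
  qed (simp_all add: m_def)
  define x where "x k = real (k + m)" for k
  have x: "x k \<ge> 1" "x k + 1 = real (k + m + 1)" for k
    using m by (simp_all add: x_def)
  define w where "w n = (if n \<in> L then max (d n) (r * ((x (iL n) + 1) / x (iL n))\<^sup>2)
    else min (d n) (r * (x (iR n) / (x (iR n) + 1))\<^sup>2))" for n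
  define y where "y n = (if n \<in> L then x (iL n) else x (iR n))" for n
  have wpos: "w n > 0" for n
  proof -
    have "x k > 0" for k
      using x(1)[of k] by linarith
    then have "0 < r * (x k / (x k + 1))\<^sup>2" for k
      using r x(1)[of k] by (intro mult_pos_pos zero_less_power divide_pos_pos) auto
    then show ?thesis
      using d(1)[of n] by (auto simp: w_def less_max_iff_disj)
  qed
  have err: "\<bar>d n / w n - 1\<bar> \<le> 4 * \<tau> n + 3 / y n" for n
  proof (cases "n \<in> L")
    case True
    then show ?thesis
      using weight_error(2)[OF x(1) r \<tau>0 dL[OF True] d(1)] by (simp add: w_def y_def)
  next
    case False
    then have "n \<in> R"
      by (simp add: R_def)
    from weight_error(1)[OF x(1) r \<tau>0 dR[OF this] d(1)] False show ?thesis
      by (simp add: w_def y_def)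
  qed
  \<comment> \<open>(a + b)^2 <= 2 a^2 + 2 b^2 turns the factors 4 and 3 into 32 and 18.\<close>
  have err2: "(d n / w n - 1)\<^sup>2 \<le> 32 * (\<tau> n)\<^sup>2 + 18 * (1 / y n)\<^sup>2" for n
  proof -
    have "(d n / w n - 1)\<^sup>2 \<le> (4 * \<tau> n + 3 / y n)\<^sup>2"
      using err[of n] by (metis abs_ge_zero power2_abs power_mono)
    also have "\<dots> \<le> 2 * (4 * \<tau> n)\<^sup>2 + 2 * (3 / y n)\<^sup>2"
      using zero_le_power2[of "4 * \<tau> n - 3 / y n"] by (simp add: power2_sum power2_diff)
    finally show ?thesis
      by (simp add: power_mult_distrib power_divide)
  qed
  have sum_\<tau>: "(\<Sum>n<N. (\<tau> n)\<^sup>2) \<le> 2 * s\<^sup>2" for N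
  proof -
    let ?h = "the_inv_into UNIV \<theta>"
    have "(\<Sum>n<N. (\<tau> n)\<^sup>2) = (\<Sum>n\<in>{..<N} \<inter> range \<theta>. (\<tau> n)\<^sup>2)"
      by (rule sum.mono_neutral_right) (auto simp: \<tau>_def)
    also have "\<dots> \<le> (\<Sum>n\<in>{..<N} \<inter> range \<theta>. s\<^sup>2 * (1/2)^(?h n))"
    proof (rule sum_mono)
      fix n
      assume "n \<in> {..<N} \<inter> range \<theta>"
      then obtain k where k: "n = \<theta> k"
        by blast
      have "?h n = k"
        unfolding k using \<theta>_inj by (rule the_inv_into_f_f) simp
      have "(\<tau> n)\<^sup>2 \<le> (s * (1/2)^k)\<^sup>2"
        using \<theta>[of k] by (intro power_mono) (simp_all add: \<tau>_def k)
      also have "\<dots> = s\<^sup>2 * ((1/2)^k * (1/2)^k)"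
        by (simp add: power2_eq_square)
      also have "\<dots> \<le> s\<^sup>2 * (1 * (1/2)^k)"
        by (intro mult_left_mono mult_right_mono) (simp_all add: power_le_one)
      finally show "(\<tau> n)\<^sup>2 \<le> s\<^sup>2 * (1/2)^(?h n)"
        using \<open>?h n = k\<close> by simp
    qed
    also have "\<dots> \<le> 2 * s\<^sup>2"
    proof (rule sum_reindexed_le)
      show "inj_on ?h ({..<N} \<inter> range \<theta>)"
        using inj_on_the_inv_into[OF \<theta>_inj] by (rule inj_on_subset) simp
      show "(\<Sum>k<K. s\<^sup>2 * (1/2)^k) \<le> 2 * s\<^sup>2" for K
      proof -
        have "(\<Sum>k<K. (1/2::real)^k) \<le> 2"
          by (induction K) (auto simp: sum_gp_strict)
        then show ?thesis
          unfolding sum_distrib_left[symmetric] mult.commute[of 2] by (rule mult_left_mono) simp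
      qed
    qed simp_all
    finally show ?thesis .
  qed
  \<comment> \<open>On each side an index is replaced by its rank there, so the sum is bounded by
    the one over all ranks.\<close>
  have sum_y: "(\<Sum>n<N. (1 / y n)\<^sup>2) \<le> 2 * (\<eta> / 144)" for N
  proof -
    have g: "(\<Sum>k<K. (1 / x k)\<^sup>2) \<le> \<eta> / 144" for K
      unfolding x_def using sum_inverse_square_le[OF m(1)] m(3) order_trans by blast
    have "(\<Sum>n<N. (1 / y n)\<^sup>2) = (\<Sum>n\<in>{..<N} \<inter> L. (1 / y n)\<^sup>2) + (\<Sum>n\<in>{..<N} - L. (1 / y n)\<^sup>2)"
      by (rule sum.Int_Diff) simp
    also have "(\<Sum>n\<in>{..<N} \<inter> L. (1 / y n)\<^sup>2) = (\<Sum>n\<in>{..<N} \<inter> L. (1 / x (iL n))\<^sup>2)"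
      by (rule sum.cong) (auto simp: y_def)
    also have "\<dots> \<le> \<eta> / 144"
      by (rule sum_reindexed_le[where g = "\<lambda>k. (1 / x k)\<^sup>2"])
         (use g injL in \<open>auto intro: inj_on_subset\<close>)
    also have "(\<Sum>n\<in>{..<N} - L. (1 / y n)\<^sup>2) = (\<Sum>n\<in>{..<N} - L. (1 / x (iR n))\<^sup>2)"
      by (rule sum.cong) (auto simp: y_def)
    also have "\<dots> \<le> \<eta> / 144"
      by (rule sum_reindexed_le[where g = "\<lambda>k. (1 / x k)\<^sup>2"])
         (use g injR in \<open>auto simp: R_def intro: inj_on_subset\<close>)
    finally show ?thesis
      by simp
  qed
  have partial: "(\<Sum>n<N. (d n / w n - 1)\<^sup>2) \<le> \<eta>" for N
  proof -
    have "(\<Sum>n<N. (d n / w n - 1)\<^sup>2) \<le> (\<Sum>n<N. 32 * (\<tau> n)\<^sup>2 + 18 * (1 / y n)\<^sup>2)"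
      by (intro sum_mono err2)
    also have "\<dots> = 32 * (\<Sum>n<N. (\<tau> n)\<^sup>2) + 18 * (\<Sum>n<N. (1 / y n)\<^sup>2)"
      by (simp only: sum.distrib sum_distrib_left)
    also have "\<dots> \<le> \<eta>"
      using sum_\<tau>[of N] sum_y[of N] s(2) eta by linarith
    finally show ?thesis .
  qed
  show ?thesis
  proof (rule that[of \<sigma> w])
    show summ: "summable (\<lambda>n. (d n / w n - 1)\<^sup>2)"
      by (rule summableI_nonneg_bounded[of _ \<eta>]) (use partial in auto)
    show "(\<Sum>n. (d n / w n - 1)\<^sup>2) \<le> \<eta>"
      by (rule suminf_le_const[OF summ partial])
    have "w (\<sigma> (int k)) \<le> r * (real (k + m) / real (k + m + 1))\<^sup>2 \<and>
        r * (real (k + m + 1) / real (k + m))\<^sup>2 \<le> w (\<sigma> (- int k - 1))" for k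
    proof
      have "enumerate R k \<notin> L"
        using inR[of k] by (simp add: R_def)
      then have "w (\<sigma> (int k)) \<le> r * (x k / (x k + 1))\<^sup>2"
        by (simp add: w_def \<sigma>_def iR)
      then show "w (\<sigma> (int k)) \<le> r * (real (k + m) / real (k + m + 1))\<^sup>2"
        by (simp only: x(2)) (simp only: x_def)
      have "r * ((x k + 1) / x k)\<^sup>2 \<le> w (\<sigma> (- int k - 1))"
        using inL[of k] by (simp add: w_def \<sigma>_def iL)
      then show "r * (real (k + m + 1) / real (k + m))\<^sup>2 \<le> w (\<sigma> (- int k - 1))"
        by (simp only: x(2)) (simp only: x_def)
    qed
    then show "((\<forall>n. w n \<le> M) \<and> (\<forall>\<epsilon>>0. \<exists>n. w n < \<epsilon>)) \<or>
     (\<exists>r>0. \<exists>m\<ge>1. \<forall>k. w (\<sigma> (int k)) \<le> r * (real (k + m) / real (k + m + 1))\<^sup>2 \<and>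
        r * (real (k + m + 1) / real (k + m))\<^sup>2 \<le> w (\<sigma> (- int k - 1)))"
      using r m(2) by blast
  qed (use \<open>bij \<sigma>\<close> wpos in auto)
qed

section \<open>Assembling the unitary and the compact perturbation\<close>

theorem theorem1p2:
  fixes T :: "'a::complex_hilbert_space \<Rightarrow>\<^sub>L 'a"
  assumes separable: "separable_space (euclidean :: 'a topology)"
    and infinite_dim: "infinite_dimensional TYPE('a)"
    and T_linear: "complex_linear T"
    and T_kernel: "{x. blinfun_apply T x = 0} = {0}"
    and T_range: "closure (range (blinfun_apply T)) = UNIV"
  shows "\<forall>\<epsilon>::real. \<epsilon> > 0 \<longrightarrow>
    (\<exists>U K :: 'a \<Rightarrow>\<^sub>L 'a. unitary_operator U \<and> compact_operator K \<and> norm K < \<epsilon> \<and>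
       strongly_irreducible ((U + K) o\<^sub>L T) \<and> invertible_operator (U + K))"
proof (intro allI impI)
  fix \<epsilon> :: real
  assume eps: "\<epsilon> > 0"
  have T0: "x = 0" if "T x = 0" for x
    using T_kernel that by blast
  \<comment> \<open>As c <= 1/2, the quotient c/(1 - c) is at most 2 c, hence at most half of
    \<open>\<epsilon>\<close>.\<close>
  define c where "c = min (1/2) (\<epsilon> / 4)"
  have c: "c > 0" "c < 1" "c / (1 - c) < \<epsilon>"
  proof -
    show "c > 0" "c < 1"
      using eps by (simp_all add: c_def)
    have "c \<le> \<epsilon> * (1/4)" "\<epsilon> * (1/2) \<le> \<epsilon> * (1 - c)"
      using eps by (auto simp: c_def intro: mult_left_mono)
    then have "c < \<epsilon> * (1 - c)"
      using eps by linarith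
    then show "c / (1 - c) < \<epsilon>"
      using \<open>c < 1\<close> by (simp add: divide_less_eq)
  qed
  have "c\<^sup>2 > 0" "c\<^sup>2 < 1"
    using c by (simp_all add: power_less_one_iff)
  then have "c\<^sup>2 / 16 > 0" "c\<^sup>2 / 4 > 0"
    by simp_all
  \<comment> \<open>The squared norms of \<open>k n\<close> below are at most
    \<open>8 * (\<delta> n)\<^sup>2 + 2 * (d n / w n - 1)\<^sup>2\<close>, so the budgets
    \<open>c\<^sup>2 / 16\<close> and \<open>c\<^sup>2 / 4\<close> contribute half of
    \<open>c\<^sup>2\<close> each.\<close>
  obtain e :: "nat \<Rightarrow> 'a" and \<delta> where e: "orthonormal e" "complete_family e" and \<delta>: "\<And>n. 0 \<le> \<delta> n"
    "summable (\<lambda>n. (\<delta> n)\<^sup>2)" "(\<Sum>n. (\<delta> n)\<^sup>2) \<le> c\<^sup>2 / 16"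
    and almost: "\<And>n y. \<forall>j\<le>n. cinner y (e j) = 0 \<Longrightarrow>
      cmod (cinner (T (e n)) (T y)) \<le> \<delta> n * norm (T (e n)) * norm (T y)"
    by (rule approximate_diagonal_basis[OF separable infinite_dim T_linear T0 \<open>c\<^sup>2 / 16 > 0\<close>]) (assumption | blast)+
  have \<delta>1: "\<delta> n < 1" for n
  proof -
    have "(\<delta> n)\<^sup>2 \<le> (\<Sum>n. (\<delta> n)\<^sup>2)"
      using sum_le_suminf[OF \<delta>(2), of "{n}"] by simp
    also have "\<dots> < 1\<^sup>2"
      using \<delta>(3) \<open>c\<^sup>2 < 1\<close> by simp
    finally show ?thesis
      by (rule power2_less_imp_less) simp
  qed
  obtain f :: "nat \<Rightarrow> 'a" where f: "orthonormal f"
    "\<And>n. norm (T (e n) /\<^sub>R norm (T (e n)) - f n) \<le> 2 * \<delta> n"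
    using orthonormal_near_images[OF T_linear T0 e(1) \<delta>(1) \<delta>1 almost] by blast
  define d where "d n = norm (T (e n))" for n
  have ne: "norm (e n) = 1" for n
    using e(1) by (rule orthonormal_norm)
  have d: "0 < d n" "d n \<le> norm T" for n
    using T0[of "e n"] ne[of n] norm_blinfun[of T "e n"] by (auto simp: d_def)
  obtain \<sigma> :: "int \<Rightarrow> nat" and w where \<sigma>: "bij \<sigma>" and w: "\<And>n. w n > 0"
    "summable (\<lambda>n. (d n / w n - 1)\<^sup>2)" "(\<Sum>n. (d n / w n - 1)\<^sup>2) \<le> c\<^sup>2 / 4"
    and cases: "((\<forall>n. w n \<le> norm T) \<and> (\<forall>\<epsilon>>0. \<exists>n. w n < \<epsilon>)) \<or>
     (\<exists>r>0. \<exists>m\<ge>1. \<forall>k. w (\<sigma> (int k)) \<le> r * (real (k + m) / real (k + m + 1))\<^sup>2 \<and>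
        r * (real (k + m + 1) / real (k + m))\<^sup>2 \<le> w (\<sigma> (- int k - 1)))"
    by (rule choose_weights[of d "norm T" "c\<^sup>2 / 4", OF d \<open>c\<^sup>2 / 4 > 0\<close>]) (assumption | blast)+
  define k where "k n = T (e n) /\<^sub>R w n - f n" for n
  have k_le: "(norm (k n))\<^sup>2 \<le> 8 * (\<delta> n)\<^sup>2 + 2 * (d n / w n - 1)\<^sup>2" for n
  proof -
    let ?g = "T (e n) /\<^sub>R d n"
    have Te: "T (e n) /\<^sub>R w n = (d n / w n) *\<^sub>R ?g"
      using d(1)[of n] by (simp add: divide_inverse)
    \<comment> \<open>The first term is the error in length, the second the error in
      direction.\<close>
    have "k n = (d n / w n - 1) *\<^sub>R ?g + (?g - f n)"
      unfolding k_def Te by (simp only: scaleR_diff_left scaleR_one add_diff_eq diff_add_cancel)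
    then have "norm (k n) \<le> norm ((d n / w n - 1) *\<^sub>R ?g) + norm (?g - f n)"
      by (simp only: norm_triangle_ineq)
    also have "norm ((d n / w n - 1) *\<^sub>R ?g) = \<bar>d n / w n - 1\<bar>"
      using d(1)[of n] by (simp add: d_def abs_mult)
    also have "norm (?g - f n) \<le> 2 * \<delta> n"
      using f(2)[of n] by (simp add: d_def)
    finally have "(norm (k n))\<^sup>2 \<le> (\<bar>d n / w n - 1\<bar> + 2 * \<delta> n)\<^sup>2"
      by (intro power_mono) auto
    also have "\<dots> \<le> 2 * \<bar>d n / w n - 1\<bar>\<^sup>2 + 2 * (2 * \<delta> n)\<^sup>2"
      using zero_le_power2[of "\<bar>d n / w n - 1\<bar> - 2 * \<delta> n"] by (simp only: power2_sum power2_diff)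
    finally show ?thesis
      by (simp add: power_mult_distrib)
  qed
  have bsum: "summable (\<lambda>n. 8 * (\<delta> n)\<^sup>2 + 2 * (d n / w n - 1)\<^sup>2)"
    by (intro summable_add summable_mult \<delta>(2) w(2))
  have ksum: "summable (\<lambda>n. (norm (k n))\<^sup>2)"
    by (rule summable_comparison_test'[OF bsum, of 0]) (use k_le in simp)
  have "(\<Sum>n. (norm (k n))\<^sup>2) \<le> (\<Sum>n. 8 * (\<delta> n)\<^sup>2 + 2 * (d n / w n - 1)\<^sup>2)"
    by (rule suminf_le[OF k_le ksum bsum])
  also have "\<dots> = 8 * (\<Sum>n. (\<delta> n)\<^sup>2) + 2 * (\<Sum>n. (d n / w n - 1)\<^sup>2)"
    using \<delta>(2) w(2) by (simp add: suminf_add[symmetric] suminf_mult summable_mult)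
  also have "\<dots> \<le> c\<^sup>2"
    using \<delta>(3) w(3) by linarith
  finally have kc: "sqrt (\<Sum>n. (norm (k n))\<^sup>2) \<le> c"
    using c(1) by (intro real_le_lsqrt) auto
  \<comment> \<open>The successor map on the integers, transported by \<open>\<sigma>\<close>: the
    vector \<open>e (\<sigma> j)\<close> is to be sent to a multiple of
    \<open>e (\<sigma> (j + 1))\<close>.\<close>
  define \<pi> where "\<pi> = \<sigma> \<circ> (\<lambda>j. j + 1) \<circ> inv \<sigma>"
  have "bij \<pi>"
  proof -
    have "bij (\<lambda>j::int. j + 1)"
      by (rule bij_plus_right)
    then show ?thesis
      unfolding \<pi>_def by (intro bij_comp \<sigma> bij_imp_bij_inv)
  qed
  obtain U K :: "'a \<Rightarrow>\<^sub>L 'a" where UK: "unitary_operator U" "compact_operator K" "norm K < \<epsilon>"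
    "invertible_operator (U + K)" "\<And>n. (U + K) (T (e n)) = w n *\<^sub>R e (\<pi> n)"
    using realize_on_basis[OF T_linear T_range e f(1) w(1) \<open>bij \<pi>\<close> ksum[unfolded k_def] kc[unfolded k_def] c(2,3)]
    by metis
  define z where "z j = e (\<sigma> j)" for j
  interpret weighted_shift z "\<lambda>j. w (\<sigma> j)" "(U + K) o\<^sub>L T"
  proof
    show "orthonormal z"
      using e(1) bij_is_inj[OF \<sigma>] by (auto simp: orthonormal_def z_def inj_eq)
    show "complete_family z"
      using e(2) bij_is_surj[OF \<sigma>] unfolding complete_family_def z_def by (metis surjD)
    show "w (\<sigma> j) > 0" for j
      by (rule w(1))
    show "complex_linear ((U + K) o\<^sub>L T)"
      using UK(4) T_linear by (simp add: invertible_operator_def complex_linear_def)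
    show "((U + K) o\<^sub>L T) (z j) = w (\<sigma> j) *\<^sub>R z (j + 1)" for j
      using UK(5)[of "\<sigma> j"] bij_is_inj[OF \<sigma>] by (simp add: z_def \<pi>_def)
  qed
  have "strongly_irreducible ((U + K) o\<^sub>L T)"
    using cases
  proof (elim disjE exE conjE)
    assume small: "\<forall>n. w n \<le> norm T" "\<forall>\<epsilon>>0. \<exists>n. w n < \<epsilon>"
    show ?thesis
    proof (rule strongly_irreducible_if_weights_small)
      show "w (\<sigma> j) \<le> norm T" for j
        using small(1) by blast
      show "\<exists>j. w (\<sigma> j) < \<epsilon>'" if "\<epsilon>' > 0" for \<epsilon>'
        using small(2) that bij_is_surj[OF \<sigma>] by (metis surjD)
    qed
  next
    fix r and m :: nat
    assume "r > 0" "m \<ge> 1"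
      and "\<forall>k. w (\<sigma> (int k)) \<le> r * (real (k + m) / real (k + m + 1))\<^sup>2 \<and>
        r * (real (k + m + 1) / real (k + m))\<^sup>2 \<le> w (\<sigma> (- int k - 1))"
    then show ?thesis
      by (intro strongly_irreducible_if_decay[of r m]) blast+
  qed
  then show "\<exists>U K. unitary_operator U \<and> compact_operator K \<and> norm K < \<epsilon> \<and>
       strongly_irreducible ((U + K) o\<^sub>L T) \<and> invertible_operator (U + K)"
    using UK by blast
qed

end
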